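(* (i) There exists an X-tree with track number $5$. (ii) There exists a Halin graph with track number $5$. (iii) There exists a weakly leveled planar graph with track number $6$.
   Context: For an integer $D\ge 0$, the X-tree of depth $D$ is obtained from the complete binary tree of depth $D$ by adding, for each level $d$ with vertices $v_1,\dots,v_{2^d}$ in left-to-right order, the edges $(v_i,v_{i+1})$ for $1\le i<2^d$. A Halin graph is obtained from a plane embedded tree with at least $4$ vertices and no vertices of degree $2$ by adding a cycle through all its leaves in the cyclic order given by the embedding. A graph is weakly leveled planar if it has a straight-line crossing-free drawing in the plane in which the vertices lie on a sequence of parallel lines (levels) and every edge either joins vertices on two consecutive levels or joins two vertices that are consecutive on the same level. A $t$-track assignment of a graph $G$ is a partition of $V(G)$ into $t$ sets $V_1,\dots,V_t$ (tracks), each an independent set of $G$, together with a total order $<_i$ on each $V_i$. An X-crossing consists of two edges $(u,v)$ and $(x,y)$ with $u,x\in V_i$, $v,y\in V_j$ ($i\neq j$), $u<_i x$ and $y<_j v$. A $t$-track layout is a $t$-track assignment with no X-crossing; the track number $\mathrm{tn}(G)$ is the minimum $t$ for which $G$ has a $t$-track layout. *)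

theory Defs
  imports "HOL-Analysis.Analysis"
begin

section \<open>Finite simple graphs\<close>

text \<open>A finite simple graph is a finite vertex set V together with a set E of
  2-element subsets of V.\<close>

definition graph :: "'a set \<Rightarrow> 'a set set \<Rightarrow> bool" where
  "graph V E \<longleftrightarrow> finite V \<and>
     (\<forall>e\<in>E. \<exists>u v. e = {u, v} \<and> u \<noteq> v \<and> u \<in> V \<and> v \<in> V)"

definition neighbors :: "'a set set \<Rightarrow> 'a \<Rightarrow> 'a set" where
  "neighbors E v = {u. {v, u} \<in> E}"

definition degree :: "'a set set \<Rightarrow> 'a \<Rightarrow> nat" where
  "degree E v = card (neighbors E v)"

definition connected_graph :: "'a set \<Rightarrow> 'a set set \<Rightarrow> bool" where
  "connected_graph V E \<longleftrightarrow>
     (\<forall>u\<in>V. \<forall>v\<in>V. (u, v) \<in> {(x, y). {x, y} \<in> E}\<^sup>*)"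

text \<open>A cycle: a list of at least 3 distinct vertices, consecutive ones (cyclically) adjacent.\<close>
definition is_cycle :: "'a set set \<Rightarrow> 'a list \<Rightarrow> bool" where
  "is_cycle E vs \<longleftrightarrow> length vs \<ge> 3 \<and> distinct vs \<and>
     (\<forall>i < length vs. {vs ! i, vs ! ((i + 1) mod length vs)} \<in> E)"

definition tree :: "'a set \<Rightarrow> 'a set set \<Rightarrow> bool" where
  "tree V E \<longleftrightarrow> graph V E \<and> V \<noteq> {} \<and> connected_graph V E \<and>
     \<not> (\<exists>vs. is_cycle E vs)"

section \<open>Track layouts and track number\<close>

text \<open>Track assignment: tr v is the track of v (tracks 0..t-1), ord i is a total
  order on track i.  The strict order is u <_i x iff (u,x) in ord i and u \<noteq> x.\<close>

definition track_layout ::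
  "'a set \<Rightarrow> 'a set set \<Rightarrow> nat \<Rightarrow> ('a \<Rightarrow> nat) \<Rightarrow> (nat \<Rightarrow> 'a rel) \<Rightarrow> bool" where
  "track_layout V E t tr ord \<longleftrightarrow>
     (\<forall>v\<in>V. tr v < t) \<and>
     (\<forall>i<t. linear_order_on {v\<in>V. tr v = i} (ord i)) \<and>
     (\<forall>u v. {u, v} \<in> E \<longrightarrow> tr u \<noteq> tr v) \<and>
     (\<forall>u v x y. {u, v} \<in> E \<longrightarrow> {x, y} \<in> E \<longrightarrow>
        tr u = tr x \<longrightarrow> tr v = tr y \<longrightarrow> tr u \<noteq> tr v \<longrightarrow>
        \<not> ((u, x) \<in> ord (tr u) \<and> u \<noteq> x \<and> (y, v) \<in> ord (tr v) \<and> y \<noteq> v))"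

definition track_number :: "'a set \<Rightarrow> 'a set set \<Rightarrow> nat" where
  "track_number V E = (LEAST t. \<exists>tr ord. track_layout V E t tr ord)"

section \<open>X-trees\<close>

text \<open>Vertex (d, i) is the i-th vertex (from the left, 0-based) on level d;
  the children of (d, i) are (d+1, 2i) and (d+1, 2i+1).\<close>

definition xtree_V :: "nat \<Rightarrow> (nat \<times> nat) set" where
  "xtree_V D = {(d, i). d \<le> D \<and> i < 2 ^ d}"

definition xtree_E :: "nat \<Rightarrow> (nat \<times> nat) set set" where
  "xtree_E D =
     {{(d, i), (d + 1, 2 * i + c)} | d i c. d < D \<and> i < 2 ^ d \<and> c < 2} \<union>
     {{(d, i), (d, i + 1)} | d i. d \<le> D \<and> i + 1 < 2 ^ d}"

section \<open>Halin graphs\<close>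

text \<open>A plane embedding of a tree is given combinatorially by a rotation system:
  for every vertex v, rot v is a cyclic permutation of the neighbours of v.
  (Every rotation system of a tree is realised by a plane embedding and vice versa.)
  The boundary walk of the (unique) face traverses darts by
  (u, v) \<mapsto> (v, rot v u); the cyclic order of the leaves given by the embedding
  is the order in which this walk reaches them.\<close>

definition cyclic_perm_on :: "'a set \<Rightarrow> ('a \<Rightarrow> 'a) \<Rightarrow> bool" where
  "cyclic_perm_on S \<sigma> \<longleftrightarrow> bij_betw \<sigma> S S \<and> (\<forall>x\<in>S. \<forall>y\<in>S. \<exists>k. (\<sigma> ^^ k) x = y)"

definition face_step :: "('a \<Rightarrow> 'a \<Rightarrow> 'a) \<Rightarrow> 'a \<times> 'a \<Rightarrow> 'a \<times> 'a" where
  "face_step rot d = (snd d, rot (snd d) (fst d))"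

definition leaf :: "'a set set \<Rightarrow> 'a \<Rightarrow> bool" where
  "leaf T v \<longleftrightarrow> degree T v = 1"

text \<open>b is the leaf following leaf a in the cyclic leaf order of the embedding.\<close>
definition next_leaf :: "'a set set \<Rightarrow> ('a \<Rightarrow> 'a \<Rightarrow> 'a) \<Rightarrow> 'a \<Rightarrow> 'a \<Rightarrow> bool" where
  "next_leaf T rot a b \<longleftrightarrow> leaf T a \<and> leaf T b \<and>
     (\<exists>u k. {u, a} \<in> T \<and> k > 0 \<and> snd ((face_step rot ^^ k) (u, a)) = b \<and>
        (\<forall>j. 0 < j \<and> j < k \<longrightarrow> \<not> leaf T (snd ((face_step rot ^^ j) (u, a)))))"

definition halin :: "'a set \<Rightarrow> 'a set set \<Rightarrow> bool" where
  "halin V E \<longleftrightarrow> graph V E \<and>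
     (\<exists>T rot. tree V T \<and> card V \<ge> 4 \<and> (\<forall>v\<in>V. degree T v \<noteq> 2) \<and>
        (\<forall>v\<in>V. cyclic_perm_on (neighbors T v) (rot v)) \<and>
        E = T \<union> {{a, b} | a b. next_leaf T rot a b})"

section \<open>Weakly leveled planar graphs\<close>

text \<open>Levels are the horizontal lines y = h 0 < h 1 < h 2 < ...; vertex v lies
  at the point (xc v, h (lev v)).  Edges are straight-line segments.\<close>

definition weakly_leveled_planar :: "'a set \<Rightarrow> 'a set set \<Rightarrow> bool" where
  "weakly_leveled_planar V E \<longleftrightarrow>
     (\<exists>(xc :: 'a \<Rightarrow> real) (lev :: 'a \<Rightarrow> nat) (h :: nat \<Rightarrow> real).
        strict_mono h \<and>
        (let pos = (\<lambda>v. (xc v, h (lev v))) in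
          inj_on pos V \<and>
          (\<forall>u v. {u, v} \<in> E \<longrightarrow>
             lev u = lev v + 1 \<or> lev v = lev u + 1 \<or>
             (lev u = lev v \<and> \<not> (\<exists>w\<in>V. lev w = lev u \<and>
                 min (xc u) (xc v) < xc w \<and> xc w < max (xc u) (xc v)))) \<and>
          (\<forall>u v w. {u, v} \<in> E \<longrightarrow> w \<in> V \<longrightarrow> w \<noteq> u \<longrightarrow> w \<noteq> v \<longrightarrow>
             pos w \<notin> closed_segment (pos u) (pos v)) \<and>
          (\<forall>u v x y. {u, v} \<in> E \<longrightarrow> {x, y} \<in> E \<longrightarrow> {u, v} \<noteq> {x, y} \<longrightarrow>
             closed_segment (pos u) (pos v) \<inter> closed_segment (pos x) (pos y)
               \<subseteq> pos ` ({u, v} \<inter> {x, y}))))"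

end

theory Submission
  imports Defs
begin

text \<open>
  A track layout amounts to a track for every vertex together with one linear order of all
  vertices (concatenate the tracks) such that for edges uv and xy with u, x on one track and v, y on
  another, u precedes x iff v precedes y.  For a fixed graph and a fixed number of tracks this is a
  propositional condition, and each lower bound comes from a graph for which it is unsatisfiable:
  the X-tree of depth 5; a hub with three children, each of which carries three leaves, a
  vertex with two leaves, and three more leaves; and a graph with levels of 1, 3, 5, 11 and 1 vertices.
  Tracks may be renamed, so one fixes the tracks of a triangle, or, in the Halin graph, of the hub
  and its children up to rotation.  For the upper bounds, the third graph needs at most 6
  tracks because one can use two alternating tracks per level and reuse them modulo 3, and the
  other two have explicit layouts on 5 tracks.
\<close>

section \<open>Track layouts of graphs on natural numbers\<close>

text \<open>Tracks are compared only through \<open>same\<close>, so a crossing clause mentions two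
  \<open>same\<close> and two \<open>before\<close> variables whatever the number of tracks; a
  single order for all vertices keeps \<open>before\<close> independent of the tracks as well. Using
  \<open>before\<close> only on increasing pairs builds in totality and antisymmetry. The price is a
  flipped form of the crossing clauses, and two clauses for a triple in place of all instances of
  transitivity. Track symmetry is broken without renaming the layout: tracks are addressed by their
  index in a list that begins with the tracks of the chosen vertices. The hub and its children in
  the Halin graph can share tracks in several ways; up to rotation the three children lie on one,
  two or three tracks, which gives three refutations. A layout on 5 tracks is certified in linear
  size: for each pair of tracks the edges between them are listed so that both ends never move
  backwards, which excludes crossings after a comparison of neighbouring list entries only.\<close>

definition rank_layout :: "nat set \<Rightarrow> (nat \<times> nat) set \<Rightarrow> nat \<Rightarrow> (nat \<Rightarrow> nat) \<Rightarrow> (nat \<Rightarrow> nat \<Rightarrow> bool) \<Rightarrow> bool" where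
  "rank_layout N F t \<tau> L \<longleftrightarrow>
     (\<forall>v\<in>N. \<tau> v < t) \<and>
     (\<forall>(u, v)\<in>F. \<tau> u \<noteq> \<tau> v) \<and>
     (\<forall>u\<in>N. \<forall>v\<in>N. u \<noteq> v \<longrightarrow> (L u v \<or> L v u) \<and> \<not> (L u v \<and> L v u)) \<and>
     (\<forall>u\<in>N. \<forall>v\<in>N. \<forall>w\<in>N. u \<noteq> v \<longrightarrow> v \<noteq> w \<longrightarrow> u \<noteq> w \<longrightarrow> L u v \<longrightarrow> L v w \<longrightarrow> L u w) \<and>
     (\<forall>(u, v)\<in>F. \<forall>(x, y)\<in>F. u \<noteq> x \<longrightarrow> v \<noteq> y \<longrightarrow> \<tau> u = \<tau> x \<longrightarrow> \<tau> v = \<tau> y \<longrightarrow> (L u x \<longleftrightarrow> L v y))"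

text \<open>Both orientations of every edge occur, so two edges are compared under either matching
  of their ends, just as with the unordered edges in \<open>track_layout\<close>.\<close>

definition arcs :: "('a \<Rightarrow> nat) \<Rightarrow> 'a set set \<Rightarrow> (nat \<times> nat) set" where
  "arcs g E = {(g a, g b) | a b. {a, b} \<in> E}"

lemma arcsI: "{a, b} \<in> E \<Longrightarrow> u = g a \<Longrightarrow> v = g b \<Longrightarrow> (u, v) \<in> arcs g E"
  unfolding arcs_def by blast

lemma arcs_sym: "(u, v) \<in> arcs g E \<Longrightarrow> (v, u) \<in> arcs g E"
  unfolding arcs_def by (fastforce simp: insert_commute)

lemma rank_layoutD:
  assumes "rank_layout N F t \<tau> L"
  shows rank_layout_lt: "v \<in> N \<Longrightarrow> \<tau> v < t"
    and rank_layout_proper: "(u, v) \<in> F \<Longrightarrow> \<tau> u \<noteq> \<tau> v"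
    and rank_layout_total: "u \<in> N \<Longrightarrow> v \<in> N \<Longrightarrow> u \<noteq> v \<Longrightarrow> (L u v \<or> L v u) \<and> \<not> (L u v \<and> L v u)"
    and rank_layout_trans: "\<lbrakk>u \<in> N; v \<in> N; w \<in> N; u \<noteq> v; v \<noteq> w; u \<noteq> w; L u v; L v w\<rbrakk> \<Longrightarrow> L u w"
    and rank_layout_cross: "\<lbrakk>(u, v) \<in> F; (x, y) \<in> F; u \<noteq> x; v \<noteq> y; \<tau> u = \<tau> x; \<tau> v = \<tau> y\<rbrakk>
      \<Longrightarrow> L u x \<longleftrightarrow> L v y"
proof -
  note * = assms[unfolded rank_layout_def]
  show "v \<in> N \<Longrightarrow> \<tau> v < t" using *[THEN conjunct1] by blast
  show "(u, v) \<in> F \<Longrightarrow> \<tau> u \<noteq> \<tau> v" using *[THEN conjunct2, THEN conjunct1] by blast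
  show "u \<in> N \<Longrightarrow> v \<in> N \<Longrightarrow> u \<noteq> v \<Longrightarrow> (L u v \<or> L v u) \<and> \<not> (L u v \<and> L v u)"
    using *[THEN conjunct2, THEN conjunct2, THEN conjunct1] by blast
  show "\<lbrakk>u \<in> N; v \<in> N; w \<in> N; u \<noteq> v; v \<noteq> w; u \<noteq> w; L u v; L v w\<rbrakk> \<Longrightarrow> L u w"
    using *[THEN conjunct2, THEN conjunct2, THEN conjunct2, THEN conjunct1, rule_format] .
  show "\<lbrakk>(u, v) \<in> F; (x, y) \<in> F; u \<noteq> x; v \<noteq> y; \<tau> u = \<tau> x; \<tau> v = \<tau> y\<rbrakk> \<Longrightarrow> L u x \<longleftrightarrow> L v y"
    using *[THEN conjunct2, THEN conjunct2, THEN conjunct2, THEN conjunct2, rule_format, of "(u, v)"]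
    by fast
qed

lemma track_layout_imp_rank_layout:
  assumes G: "graph V E" and g: "inj_on g V" and lay: "track_layout V E t tr ord"
  shows "\<exists>\<tau> L. rank_layout (g ` V) (arcs g E) t \<tau> L"
proof -
  define f where "f = the_inv_into V g"
  have f [simp]: "f (g a) = a" if "a \<in> V" for a
    using that g by (simp add: f_def the_inv_into_f_f)
  define \<tau> where "\<tau> = tr \<circ> f"
  define L where "L = (\<lambda>u v. \<tau> u < \<tau> v \<or> \<tau> u = \<tau> v \<and> (f u, f v) \<in> ord (\<tau> u))"
  have lt: "tr a < t" if "a \<in> V" for a
    using lay that by (auto simp: track_layout_def)
  have lin: "linear_order_on {v \<in> V. tr v = i} (ord i)" if "i < t" for i
    using lay that by (auto simp: track_layout_def)
  have E: "a \<in> V \<and> b \<in> V" if "{a, b} \<in> E" for a b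
    using G that unfolding graph_def by (metis doubleton_eq_iff)
  have proper: "tr a \<noteq> tr b" if "{a, b} \<in> E" for a b
    using lay that by (auto simp: track_layout_def)
  have cross: "\<not> ((u, x) \<in> ord (tr u) \<and> u \<noteq> x \<and> (y, v) \<in> ord (tr v) \<and> y \<noteq> v)"
    if "{u, v} \<in> E" "{x, y} \<in> E" "tr u = tr x" "tr v = tr y" for u v x y
  proof -
    \<comment> \<open>Properness supplies the premise of the crossing condition that the two tracks
      differ, so later uses only have to match tracks.\<close>
    have "tr u \<noteq> tr v" using proper that(1) .
    then show ?thesis using lay that unfolding track_layout_def by blast
  qed
  have total: "((a, b) \<in> ord (tr a) \<or> (b, a) \<in> ord (tr a)) \<and> \<not> ((a, b) \<in> ord (tr a) \<and> (b, a) \<in> ord (tr a))"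
    if "a \<in> V" "b \<in> V" "tr a = tr b" "a \<noteq> b" for a b
  proof -
    have "linear_order_on {v \<in> V. tr v = tr a} (ord (tr a))" using lin lt that(1) by blast
    then show ?thesis
      using that unfolding linear_order_on_def partial_order_on_def total_on_def antisym_def by auto
  qed
  have trans: "(a, c) \<in> ord (tr a)"
    if "a \<in> V" "(a, b) \<in> ord (tr a)" "(b, c) \<in> ord (tr a)" for a b c
  proof -
    have "trans (ord (tr a))"
      using lin[OF lt[OF that(1)]]
      by (auto simp: linear_order_on_def partial_order_on_def preorder_on_def)
    then show ?thesis using that by (meson transD)
  qed
  have "rank_layout (g ` V) (arcs g E) t \<tau> L"
    unfolding rank_layout_def
  proof (intro conjI ballI impI)
    show "\<tau> v < t" if "v \<in> g ` V" for v using that lt by (auto simp: \<tau>_def)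
    show "case p of (u, v) \<Rightarrow> \<tau> u \<noteq> \<tau> v" if "p \<in> arcs g E" for p
      using that E proper by (fastforce simp: arcs_def \<tau>_def)
    show "L u v \<or> L v u" "\<not> (L u v \<and> L v u)" if "u \<in> g ` V" "v \<in> g ` V" "u \<noteq> v" for u v
    proof -
      from that obtain a b where ab: "u = g a" "v = g b" "a \<in> V" "b \<in> V" "a \<noteq> b" by blast
      show "L u v \<or> L v u"
        using total[OF ab(3,4) _ ab(5)] ab(3,4)
        by (cases "tr a" "tr b" rule: linorder_cases) (simp_all add: L_def \<tau>_def ab(1,2))
      show "\<not> (L u v \<and> L v u)"
        using total[OF ab(3,4) _ ab(5)] ab(3,4)
        by (cases "tr a" "tr b" rule: linorder_cases) (simp_all add: L_def \<tau>_def ab(1,2))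
    qed
    show "L u w" if "u \<in> g ` V" "v \<in> g ` V" "w \<in> g ` V" "L u v" "L v w" for u v w
    proof -
      from that(1-3) obtain a b c
        where "u = g a" "v = g b" "w = g c" "a \<in> V" "b \<in> V" "c \<in> V" by blast
      then show ?thesis using that(4,5) trans[of a b c] by (auto simp: L_def \<tau>_def)
    qed
    show "case p of (u, v) \<Rightarrow> \<forall>(x, y)\<in>arcs g E. u \<noteq> x \<longrightarrow> v \<noteq> y \<longrightarrow> \<tau> u = \<tau> x \<longrightarrow> \<tau> v = \<tau> y \<longrightarrow>
            (L u x \<longleftrightarrow> L v y)" if "p \<in> arcs g E" for p
    proof (clarify)
      fix u v x y assume p: "p = (u, v)" and xy: "(x, y) \<in> arcs g E"
        and ne: "u \<noteq> x" "v \<noteq> y" and tau: "\<tau> u = \<tau> x" "\<tau> v = \<tau> y"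
      from that p obtain a b where ab: "u = g a" "v = g b" "{a, b} \<in> E" by (auto simp: arcs_def)
      from xy obtain c d where cd: "x = g c" "y = g d" "{c, d} \<in> E" by (auto simp: arcs_def)
      have V: "a \<in> V" "b \<in> V" "c \<in> V" "d \<in> V" using E ab cd by auto
      have tr: "tr a = tr c" "tr b = tr d" using tau V by (auto simp: \<tau>_def ab cd)
      have neq: "a \<noteq> c" "b \<noteq> d" using ne ab cd by auto
      \<comment> \<open>The crossing condition forbids only one direction; applied to the two edges
        in both orders, and with both track orders total, it yields the equivalence required of
        \<open>L\<close>.\<close>
      have 1: "\<not> ((a, c) \<in> ord (tr a) \<and> (d, b) \<in> ord (tr b))"
        using cross[OF ab(3) cd(3)] tr neq by auto
      have 2: "\<not> ((c, a) \<in> ord (tr a) \<and> (b, d) \<in> ord (tr b))"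
        using cross[OF cd(3) ab(3)] tr neq by auto
      have "(a, c) \<in> ord (tr a) \<longleftrightarrow> (b, d) \<in> ord (tr b)"
        using 1 2 total V tr neq by metis
      then show "L u x \<longleftrightarrow> L v y"
        using V tr by (simp add: L_def \<tau>_def ab cd)
    qed
  qed
  then show ?thesis by blast
qed

text \<open>Each track order is the restriction of \<open>L\<close> to that track. The diagonal is
  added because \<open>linear_order_on\<close> is reflexive, while \<open>rank_layout\<close> leaves
  \<open>L u u\<close> open.\<close>

lemma rank_layout_imp_track_layout:
  assumes G: "graph V E" and g: "inj_on g V" and lay: "rank_layout (g ` V) (arcs g E) t \<tau> L"
  shows "\<exists>tr ord. track_layout V E t tr ord"
proof -
  define tr where "tr = \<tau> \<circ> g"
  define ord where "ord = (\<lambda>i. {(a, b). a \<in> V \<and> b \<in> V \<and> tr a = i \<and> tr b = i \<and> (a = b \<or> L (g a) (g b))})"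
  have total: "(L (g a) (g b) \<or> L (g b) (g a)) \<and> \<not> (L (g a) (g b) \<and> L (g b) (g a))" if "a \<in> V" "b \<in> V" "a \<noteq> b" for a b
  proof -
    have "g a \<noteq> g b" using that g by (auto dest: inj_onD)
    then show ?thesis using rank_layout_total[OF lay] that by blast
  qed
  have trans: "L (g a) (g c)"
    if "a \<in> V" "b \<in> V" "c \<in> V" "a \<noteq> b" "b \<noteq> c" "a \<noteq> c" "L (g a) (g b)" "L (g b) (g c)" for a b c
  proof -
    have "g a \<noteq> g b" "g b \<noteq> g c" "g a \<noteq> g c" using that g by (auto dest: inj_onD)
    then show ?thesis using rank_layout_trans[OF lay] that by blast
  qed
  have E: "a \<in> V \<and> b \<in> V" if "{a, b} \<in> E" for a b
    using G that unfolding graph_def by (metis doubleton_eq_iff)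
  have arc: "(g a, g b) \<in> arcs g E" if "{a, b} \<in> E" for a b using that by (auto simp: arcs_def)
  have "track_layout V E t tr ord"
    unfolding track_layout_def
  proof (intro conjI allI impI ballI)
    show "tr v < t" if "v \<in> V" for v using rank_layout_lt[OF lay] that by (simp add: tr_def)
    show "linear_order_on {v \<in> V. tr v = i} (ord i)" for i
    proof -
      have "refl_on {v \<in> V. tr v = i} (ord i)" by (auto simp: refl_on_def ord_def)
      moreover have "ord i \<subseteq> {v \<in> V. tr v = i} \<times> {v \<in> V. tr v = i}" by (auto simp: ord_def)
      moreover have "trans (ord i)"
      proof (rule transI)
        fix a b c assume "(a, b) \<in> ord i" "(b, c) \<in> ord i"
        then show "(a, c) \<in> ord i" using trans[of a b c] total[of a b] unfolding ord_def by auto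
      qed
      moreover have "antisym (ord i)"
        using total by (auto simp: antisym_def ord_def)
      moreover have "total_on {v \<in> V. tr v = i} (ord i)"
        using total by (auto simp: total_on_def ord_def)
      ultimately show ?thesis
        by (auto simp: linear_order_on_def partial_order_on_def preorder_on_def)
    qed
    show "tr u \<noteq> tr v" if "{u, v} \<in> E" for u v
      using rank_layout_proper[OF lay arc[OF that]] by (simp add: tr_def)
    show "\<not> ((u, x) \<in> ord (tr u) \<and> u \<noteq> x \<and> (y, v) \<in> ord (tr v) \<and> y \<noteq> v)"
      if "{u, v} \<in> E" "{x, y} \<in> E" "tr u = tr x" "tr v = tr y" for u v x y
    proof
      assume *: "(u, x) \<in> ord (tr u) \<and> u \<noteq> x \<and> (y, v) \<in> ord (tr v) \<and> y \<noteq> v"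
      have V: "u \<in> V" "v \<in> V" "x \<in> V" "y \<in> V" using E that by auto
      have ne: "g u \<noteq> g x" "g v \<noteq> g y" using * V g by (auto dest: inj_onD)
      have "L (g u) (g x) \<longleftrightarrow> L (g v) (g y)"
        using rank_layout_cross[OF lay arc[OF that(1)] arc[OF that(2)] ne] that(3,4)
        by (simp add: tr_def)
      then show False using * total[of v y] V unfolding ord_def by auto
    qed
  qed
  then show ?thesis by blast
qed

lemma rank_layoutI:
  assumes "\<And>v. v \<in> N \<Longrightarrow> \<tau> v < t"
    and "\<And>u v. (u, v) \<in> F \<Longrightarrow> \<tau> u \<noteq> \<tau> v"
    and "\<And>u v. \<lbrakk>u \<in> N; v \<in> N; u \<noteq> v\<rbrakk> \<Longrightarrow> (L u v \<or> L v u) \<and> \<not> (L u v \<and> L v u)"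
    and "\<And>u v w. \<lbrakk>u \<in> N; v \<in> N; w \<in> N; u \<noteq> v; v \<noteq> w; u \<noteq> w; L u v; L v w\<rbrakk> \<Longrightarrow> L u w"
    and "\<And>u v x y. \<lbrakk>(u, v) \<in> F; (x, y) \<in> F; u \<noteq> x; v \<noteq> y; \<tau> u = \<tau> x; \<tau> v = \<tau> y\<rbrakk>
      \<Longrightarrow> L u x \<longleftrightarrow> L v y"
  shows "rank_layout N F t \<tau> L"
  unfolding rank_layout_def
proof (intro conjI ballI impI)
  fix p assume p: "p \<in> F"
  show "case p of (u, v) \<Rightarrow> \<tau> u \<noteq> \<tau> v" using p assms(2) by (cases p) blast
  show "case p of (u, v) \<Rightarrow> \<forall>(x, y)\<in>F. u \<noteq> x \<longrightarrow> v \<noteq> y \<longrightarrow> \<tau> u = \<tau> x \<longrightarrow> \<tau> v = \<tau> y \<longrightarrow>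
          (L u x \<longleftrightarrow> L v y)"
    using p assms(5) by (cases p) blast
next
  show "\<tau> v < t" if "v \<in> N" for v using assms(1) that .
  show "L u v \<or> L v u" "\<not> (L u v \<and> L v u)" if "u \<in> N" "v \<in> N" "u \<noteq> v" for u v
    using assms(3)[OF that] by auto
  show "L u w" if "u \<in> N" "v \<in> N" "w \<in> N" "u \<noteq> v" "v \<noteq> w" "u \<noteq> w" "L u v" "L v w" for u v w
    using assms(4) that .
qed

lemma rank_layout_mono:
  assumes "rank_layout N F t \<tau> L" "F' \<subseteq> F" "t \<le> t'"
  shows "rank_layout N F' t' \<tau> L"
proof (rule rank_layoutI)
  show "\<tau> v < t'" if "v \<in> N" for v
    using rank_layout_lt[OF assms(1) that] assms(3) by simp
  show "L u x \<longleftrightarrow> L v y" if "(u, v) \<in> F'" "(x, y) \<in> F'" "u \<noteq> x" "v \<noteq> y" "\<tau> u = \<tau> x" "\<tau> v = \<tau> y" for u v x y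
    using rank_layout_cross[OF assms(1) _ _ that(3-6)] that(1,2) assms(2) by blast
  show "\<tau> u \<noteq> \<tau> v" if "(u, v) \<in> F'" for u v
    using rank_layout_proper[OF assms(1)] that assms(2) by blast
qed (fact rank_layout_total[OF assms(1)] rank_layout_trans[OF assms(1)])+

text \<open>Adding empty tracks turns a layout on fewer tracks into one on \<open>t\<close>, so
  refuting exactly \<open>t\<close> tracks refutes all smaller numbers too.\<close>

lemma track_number_eqI:
  assumes G: "graph V E" and g: "inj_on g V"
    and upper: "rank_layout (g ` V) (arcs g E) (Suc t) \<tau> L"
    and lower: "\<And>\<tau> L. \<not> rank_layout (g ` V) (arcs g E) t \<tau> L"
  shows "track_number V E = Suc t"
  unfolding track_number_def
proof (rule Least_equality)
  show "\<exists>tr ord. track_layout V E (Suc t) tr ord"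
    using rank_layout_imp_track_layout[OF G g upper] .
  fix s assume "\<exists>tr ord. track_layout V E s tr ord"
  then obtain \<tau> L where "rank_layout (g ` V) (arcs g E) s \<tau> L"
    using track_layout_imp_rank_layout[OF G g] by blast
  then show "Suc t \<le> s"
    using lower rank_layout_mono[OF _ subset_refl, of _ _ s \<tau> L t] by force
qed

section \<open>Propositional clauses satisfied by every layout\<close>

lemma extend_to_track_list:
  assumes "distinct xs" "set xs \<subseteq> {..<t}"
  obtains ks where "length ks = t" "set ks = {..<t}" "\<And>i. i < length xs \<Longrightarrow> ks ! i = xs ! i"
proof
  \<comment> \<open>The remaining tracks follow in any order. With \<open>col v i\<close> read as
    \<open>\<tau> v = ks ! i\<close>, the prescribed tracks get the indices 0, 1, ... for
    free.\<close>
  define ys where "ys = sorted_list_of_set ({..<t} - set xs)"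
  have ys: "distinct ys" "set ys = {..<t} - set xs" by (auto simp: ys_def)
  show "set (xs @ ys) = {..<t}" using assms ys by auto
  then show "length (xs @ ys) = t"
    using assms(1) ys distinct_card[of "xs @ ys"] by auto
  show "\<And>i. i < length xs \<Longrightarrow> (xs @ ys) ! i = xs ! i" by (simp add: nth_append)
qed

text \<open>An index may be missing from the list \<open>is\<close> of a vertex only if an adjacent
  vertex in \<open>fx\<close> is already known to have that track. The list \<open>cs\<close> makes
  the indices explicit, so that the side condition is checked by rewriting.\<close>

lemma colour_instances:
  assumes lay: "rank_layout N F t \<tau> L" and ks: "length ks = t" "set ks = {..<t}"
    and cs: "{..<t} \<subseteq> set cs"
    and fixed: "\<forall>(a, i)\<in>set fx. \<tau> a = ks ! i"
    and check: "\<forall>(v, is)\<in>set xs. v \<in> N \<and> (\<forall>i\<in>set cs. i \<in> set is \<or> (\<exists>(a, j)\<in>set fx. j = i \<and> (a, v) \<in> F))"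
  shows "\<forall>(v, is)\<in>set xs. \<exists>i\<in>set is. \<tau> v = ks ! i"
proof (clarify)
  fix v "is" assume "(v, is) \<in> set xs"
  from bspec[OF check this] have v: "v \<in> N"
    and c: "i < t \<Longrightarrow> i \<in> set is \<or> (\<exists>(a, j)\<in>set fx. j = i \<and> (a, v) \<in> F)" for i using cs by auto
  have "\<tau> v \<in> set ks" using rank_layout_lt[OF lay v] ks by simp
  then obtain i where i: "i < t" "\<tau> v = ks ! i" using ks(1) by (metis in_set_conv_nth)
  have "i \<in> set is"
    using c[OF i(1)] fixed i(2) rank_layout_proper[OF lay] by fastforce
  then show "\<exists>i\<in>set is. \<tau> v = ks ! i" using i(2) by blast
qed

lemma proper_instances:
  assumes lay: "rank_layout N F t \<tau> L" and check: "\<forall>(u, v, i)\<in>set xs. (u, v) \<in> F"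
  shows "\<forall>(u, v, i)\<in>set xs. \<not> (\<tau> u = ks ! i \<and> \<tau> v = ks ! i)"
  using check rank_layout_proper[OF lay] by fastforce

lemma same_instances:
  "\<forall>(u, v, i)\<in>set xs. \<tau> u = ks ! i \<longrightarrow> \<tau> v = ks ! i \<longrightarrow> \<tau> u = \<tau> v"
  by auto

lemma cross_instances:
  assumes lay: "rank_layout N F t \<tau> L"
    and check: "\<forall>(u, v, x, y)\<in>set xs. (u, v) \<in> F \<and> (x, y) \<in> F \<and> u < x \<and> v < y"
  shows "\<forall>(u, v, x, y)\<in>set xs. \<tau> u = \<tau> x \<longrightarrow> \<tau> v = \<tau> y \<longrightarrow> (L u x \<longleftrightarrow> L v y)"
proof (clarify)
  fix u v x y assume "(u, v, x, y) \<in> set xs" and \<tau>: "\<tau> u = \<tau> x" "\<tau> v = \<tau> y"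
  then have "(u, v) \<in> F" "(x, y) \<in> F" "u \<noteq> x" "v \<noteq> y" using check by auto
  then show "L u x \<longleftrightarrow> L v y" using rank_layout_cross[OF lay] \<tau> by blast
qed

text \<open>Here the second ends are numbered in the opposite order, so the comparison has to be
  read off the pair \<open>(y, v)\<close>; totality turns \<open>L v y\<close> into the negation of
  \<open>L y v\<close>.\<close>

lemma cross_flip_instances:
  assumes lay: "rank_layout N F t \<tau> L" and F: "F \<subseteq> N \<times> N"
    and check: "\<forall>(u, v, x, y)\<in>set xs. (u, v) \<in> F \<and> (x, y) \<in> F \<and> u < x \<and> y < v"
  shows "\<forall>(u, v, x, y)\<in>set xs. \<tau> u = \<tau> x \<longrightarrow> \<tau> y = \<tau> v \<longrightarrow> (L u x \<longleftrightarrow> \<not> L y v)"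
proof (clarify)
  fix u v x y assume "(u, v, x, y) \<in> set xs" and \<tau>: "\<tau> u = \<tau> x" "\<tau> y = \<tau> v"
  then have *: "(u, v) \<in> F" "(x, y) \<in> F" "u \<noteq> x" "v \<noteq> y" using check by auto
  then have "L u x \<longleftrightarrow> L v y" using rank_layout_cross[OF lay] \<tau> by auto
  moreover have "L v y \<longleftrightarrow> \<not> L y v" using rank_layout_total[OF lay, of v y] * F by blast
  ultimately show "L u x \<longleftrightarrow> \<not> L y v" by simp
qed

lemma trans_instances:
  assumes lay: "rank_layout N F t \<tau> L"
    and check: "\<forall>(u, v, w)\<in>set xs. u \<in> N \<and> v \<in> N \<and> w \<in> N \<and> u < v \<and> v < w"
  shows "\<forall>(u, v, w)\<in>set xs. L u v \<longrightarrow> L v w \<longrightarrow> L u w"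
proof (clarify)
  fix u v w assume "(u, v, w) \<in> set xs" and *: "L u v" "L v w"
  then have "u \<in> N" "v \<in> N" "w \<in> N" "u \<noteq> v" "v \<noteq> w" "u \<noteq> w" using check by auto
  then show "L u w" using rank_layout_trans[OF lay] * by blast
qed

text \<open>Among increasing pairs, a triple has two cyclic orientations to exclude.
  \<open>trans_instances\<close> excludes the one through \<open>L u v\<close>,
  \<open>L v w\<close>, \<open>L w u\<close>; this clause excludes the reverse one through
  \<open>L u w\<close>, \<open>L w v\<close>, \<open>L v u\<close>.\<close>

lemma negtrans_instances:
  assumes lay: "rank_layout N F t \<tau> L"
    and check: "\<forall>(u, v, w)\<in>set xs. u \<in> N \<and> v \<in> N \<and> w \<in> N \<and> u < v \<and> v < w"
  shows "\<forall>(u, v, w)\<in>set xs. L u w \<longrightarrow> L u v \<or> L v w"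
proof (clarify)
  fix u v w assume "(u, v, w) \<in> set xs" and *: "L u w" "\<not> L v w"
  then have N: "u \<in> N" "v \<in> N" "w \<in> N" "u \<noteq> v" "v \<noteq> w" "u \<noteq> w" using check by auto
  have "L w v" using rank_layout_total[OF lay N(2,3,5)] * by blast
  then show "L u v" using rank_layout_trans[OF lay N(1,3,2)] N * by blast
qed

section \<open>Table lookup and certificates for upper bounds\<close>

lemma nth_table:
  assumes "xs = x # y # ys" "length xs = n"
  shows "xs ! 0 = x" "xs ! 1 = y" "map ((!) xs) [2..<n] = ys"
proof -
  \<comment> \<open>For a literal table, simplification splits this equation into one rewrite rule
    per entry. The indices 0 and 1 are not \<open>numeral\<close> terms and are stated
    separately.\<close>
  show "map ((!) xs) [2..<n] = ys"
    using assms(2) by (intro nth_equalityI) (auto simp: assms(1) simp del: upt_Suc)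
qed (simp_all add: assms(1))

text \<open>A list whose entries increase weakly at both ends makes any two of its edges comparable
  in the product order, which excludes a crossing. Weak increase is the right notion, since
  consecutive edges may share an end; its transitivity extends the neighbour checks of
  \<open>successively\<close> to all pairs. \<open>dist\<close> allows one list per pair of tracks,
  so any two edges between the same tracks lie in a common chain.\<close>

lemma chains_imp_rank_layout:
  fixes pos :: "nat \<Rightarrow> nat"
  assumes lt: "\<forall>v\<in>N. \<tau> v < t" and inj: "inj_on pos N" and F: "F \<subseteq> N \<times> N"
    and cover: "\<forall>(u, v)\<in>F. \<exists>(i, j, es)\<in>set ess. (u, v) \<in> set es \<or> (v, u) \<in> set es"
    and chains: "\<forall>(i, j, es)\<in>set ess. i < j \<and> (\<forall>(u, v)\<in>set es. \<tau> u = i \<and> \<tau> v = j) \<and>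
      successively (\<lambda>(u, v) (x, y). pos u \<le> pos x \<and> pos v \<le> pos y) es"
    and dist: "distinct (map (\<lambda>(i, j, es). (i, j)) ess)"
  shows "rank_layout N F t \<tau> (\<lambda>u v. pos u < pos v)"
proof (rule rank_layoutI)
  have ex: "\<exists>i j es. (i, j, es) \<in> set ess \<and> i < j \<and>
      ((u, v) \<in> set es \<and> \<tau> u = i \<and> \<tau> v = j \<or> (v, u) \<in> set es \<and> \<tau> v = i \<and> \<tau> u = j)"
    if "(u, v) \<in> F" for u v
    using cover chains that by fastforce
  show "\<tau> v < t" if "v \<in> N" for v using lt that by blast
  show "\<tau> u \<noteq> \<tau> v" if "(u, v) \<in> F" for u v using ex[OF that] by auto
  show "(pos u < pos v \<or> pos v < pos u) \<and> \<not> (pos u < pos v \<and> pos v < pos u)"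
    if "u \<in> N" "v \<in> N" "u \<noteq> v" for u v
    using inj_onD[OF inj] that by (metis less_asym' linorder_neqE_nat)
  show "pos u < pos w" if "pos u < pos v" "pos v < pos w" for u v w using that by simp
  have mono: "pos u \<le> pos x \<and> pos v \<le> pos y \<or> pos x \<le> pos u \<and> pos y \<le> pos v"
    if es: "(i, j, es) \<in> set ess" and mem: "(u, v) \<in> set es" "(x, y) \<in> set es" for i j es u v x y
  proof -
    have "successively (\<lambda>(u, v) (x, y). pos u \<le> pos x \<and> pos v \<le> pos y) es" using chains es by fastforce
    then have s: "sorted_wrt (\<lambda>(u, v) (x, y). pos u \<le> pos x \<and> pos v \<le> pos y) es"
      by (subst (asm) successively_conv_sorted_wrt) (auto simp: transp_def)
    obtain m n where "m < length es" "es ! m = (u, v)" "n < length es" "es ! n = (x, y)"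
      using mem by (metis in_set_conv_nth)
    then show ?thesis
      using s by (cases m n rule: linorder_cases) (fastforce simp: sorted_wrt_iff_nth_less)+
  qed
  have uniq: "es = es'" if "(i, j, es) \<in> set ess" "(i, j, es') \<in> set ess" for i j es es'
    using dist that inj_onD[of "\<lambda>(i, j, es). (i, j)" "set ess" "(i, j, es)" "(i, j, es')"]
    by (simp add: distinct_map)
  show "pos u < pos x \<longleftrightarrow> pos v < pos y"
    if uv: "(u, v) \<in> F" and xy: "(x, y) \<in> F" and ne: "u \<noteq> x" "v \<noteq> y" and \<tau>: "\<tau> u = \<tau> x" "\<tau> v = \<tau> y"
    for u v x y
  proof -
    have N: "u \<in> N" "v \<in> N" "x \<in> N" "y \<in> N" using uv xy F by auto
    then have p: "pos u \<noteq> pos x" "pos v \<noteq> pos y" using inj_onD[OF inj] ne by blast+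
    from ex[OF uv] obtain i j es where 1: "(i, j, es) \<in> set ess" "i < j"
      "(u, v) \<in> set es \<and> \<tau> u = i \<and> \<tau> v = j \<or> (v, u) \<in> set es \<and> \<tau> v = i \<and> \<tau> u = j" by blast
    from ex[OF xy] obtain i' j' es' where 2: "(i', j', es') \<in> set ess" "i' < j'"
      "(x, y) \<in> set es' \<and> \<tau> x = i' \<and> \<tau> y = j' \<or> (y, x) \<in> set es' \<and> \<tau> y = i' \<and> \<tau> x = j'" by blast
    have "i = i'" "j = j'" using 1 2 \<tau> by auto
    then have "es = es'" using uniq 1 2 by blast
    have "(u, v) \<in> set es \<and> (x, y) \<in> set es \<or> (v, u) \<in> set es \<and> (y, x) \<in> set es"
      using 1 2 \<tau> \<open>es = es'\<close> by auto
    then have "pos u \<le> pos x \<and> pos v \<le> pos y \<or> pos x \<le> pos u \<and> pos y \<le> pos v"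
      using mono[OF 1(1)] by blast
    then show ?thesis using p by linarith
  qed
qed

section \<open>X-trees\<close>

text \<open>
  The refutations below are unsatisfiable cores, found by a SAT solver, of the clauses describing a
  layout: col v i says that v is on the i-th track of a fixed enumeration of the tracks, same u v
  that u and v share a track, and before is the linear order, used only for pairs u < v.
  The lists only select instances of the clauses.
\<close>

lemma xtree_clauses_unsat:
  fixes col same before :: "nat \<Rightarrow> nat \<Rightarrow> bool"
  \<comment> \<open>In heap numbering 12 and 13 are the children of 6 and adjacent to each other, so
    these three tracks are pairwise distinct. The facts are written as equations with
    \<open>True\<close> so that unfolding can substitute them.\<close>
  assumes fixed: "col 6 0 = True" "col 12 1 = True" "col 13 2 = True"
    and some: "\<forall>(v,is)\<in>set
      [(1,[0,1,2,3]), (2,[0,1,2,3]), (3,[1,2,3]), (4,[0,1,2,3]), (5,[1,2,3]), (7,[1,2,3]),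
      (8,[0,1,2,3]), (9,[0,1,2,3]), (10,[0,1,2,3]), (11,[0,2,3]), (14,[0,1,3]), (15,[0,1,2,3]),
      (20,[0,1,2,3]), (21,[0,1,2,3]), (22,[0,1,2,3]), (23,[0,1,2,3]), (24,[0,2,3]), (25,[0,2,3]),
      (26,[0,1,3]), (27,[0,1,3]), (28,[0,1,2,3]), (29,[0,1,2,3]), (49,[0,1,2,3]), (50,[0,1,2,3]),
      (51,[0,1,2,3])].
      \<exists>i\<in>set is. col v i"
    and proper: "\<forall>(u,v,i)\<in>set
      [(1,2,0), (1,2,1), (1,2,2), (1,2,3), (1,3,1), (1,3,2), (1,3,3), (2,3,1), (2,3,2), (2,3,3),
      (2,4,0), (2,4,1), (2,4,2), (2,4,3), (2,5,1), (2,5,2), (2,5,3), (3,7,1), (3,7,2), (3,7,3),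
      (4,5,1), (4,5,2), (4,5,3), (4,8,0), (4,8,1), (4,8,2), (4,8,3), (4,9,0), (4,9,1), (4,9,2),
      (4,9,3), (5,10,1), (5,10,2), (5,10,3), (5,11,2), (5,11,3), (7,14,1), (7,14,3), (7,15,1),
      (7,15,2), (7,15,3), (8,9,0), (8,9,1), (8,9,2), (8,9,3), (9,10,0), (9,10,1), (9,10,2),
      (9,10,3), (10,11,0), (10,11,2), (10,11,3), (10,20,0), (10,20,1), (10,20,2), (10,20,3),
      (10,21,0), (10,21,1), (10,21,2), (10,21,3), (11,22,0), (11,22,2), (11,22,3), (11,23,0),
      (11,23,2), (11,23,3), (14,15,0), (14,15,1), (14,15,3), (14,28,0), (14,29,0), (20,21,0),
      (20,21,1), (20,21,2), (20,21,3), (21,22,1), (21,22,2), (21,22,3), (22,23,0), (22,23,1),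
      (22,23,2), (22,23,3), (23,24,0), (23,24,2), (23,24,3), (24,25,0), (24,25,2), (24,25,3),
      (24,49,2), (25,26,0), (25,26,3), (25,50,2), (25,50,3), (25,51,2), (25,51,3), (26,27,0),
      (26,27,1), (26,27,3), (27,28,3), (28,29,1), (28,29,2), (28,29,3), (50,51,0), (50,51,1),
      (50,51,2), (50,51,3)].
      \<not> (col u i \<and> col v i)"
    and same: "\<forall>(u,v,i)\<in>set
      [(1,5,1), (1,5,2), (1,5,3), (1,6,0), (1,7,2), (1,9,2), (1,10,0), (1,10,1), (1,10,2), (1,10,3),
      (1,11,2), (1,11,3), (1,12,1), (1,13,2), (1,14,1), (1,22,2), (1,23,1), (1,24,2), (1,24,3),
      (1,25,2), (1,25,3), (1,50,2), (1,51,2), (2,6,0), (2,7,1), (2,7,2), (2,7,3), (2,9,1),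
      (2,9,2), (2,10,0), (2,10,1), (2,10,2), (2,10,3), (2,11,0), (2,11,2), (2,11,3), (2,12,1),
      (2,13,2), (2,14,1), (2,14,3), (2,15,0), (2,20,1), (2,20,2), (2,20,3), (2,21,2), (2,21,3),
      (2,22,0), (2,22,1), (2,22,2), (2,22,3), (2,23,0), (2,23,1), (2,23,2), (2,23,3), (2,24,2),
      (2,24,3), (2,25,2), (2,25,3), (2,26,0), (2,26,3), (2,50,0), (2,51,0), (3,4,1), (3,4,2),
      (3,4,3), (3,5,1), (3,5,2), (3,5,3), (3,9,1), (3,9,3), (3,10,1), (3,10,2), (3,10,3),
      (3,11,2), (3,11,3), (3,12,1), (3,13,2), (3,14,1), (3,14,3), (3,15,1), (3,20,1), (3,20,3),
      (3,21,1), (3,21,2), (3,21,3), (3,22,1), (3,22,2), (3,22,3), (3,23,1), (3,23,2), (3,23,3),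
      (3,24,2), (3,24,3), (3,25,2), (3,25,3), (3,26,1), (3,26,3), (3,27,3), (3,50,2), (3,50,3),
      (3,51,2), (3,51,3), (4,6,0), (4,7,1), (4,7,2), (4,7,3), (4,10,0), (4,10,1), (4,10,2),
      (4,10,3), (4,11,0), (4,11,2), (4,11,3), (4,12,1), (4,13,2), (4,14,1), (4,15,1), (4,20,1),
      (4,20,2), (4,20,3), (4,21,0), (4,21,1), (4,21,2), (4,21,3), (4,22,0), (4,22,1), (4,22,2),
      (4,22,3), (4,23,0), (4,23,1), (4,23,2), (4,23,3), (4,24,0), (4,24,2), (4,24,3), (4,25,0),
      (4,25,2), (4,25,3), (4,26,1), (4,50,1), (4,50,2), (4,50,3), (4,51,1), (4,51,2), (4,51,3),
      (5,7,1), (5,7,2), (5,7,3), (5,8,1), (5,8,2), (5,8,3), (5,9,1), (5,9,2), (5,9,3), (5,12,1),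
      (5,13,2), (5,14,1), (5,14,3), (5,15,2), (5,20,1), (5,20,2), (5,20,3), (5,21,1), (5,21,2),
      (5,21,3), (5,22,1), (5,22,2), (5,22,3), (5,23,1), (5,23,2), (5,23,3), (5,24,2), (5,24,3),
      (5,25,2), (5,25,3), (5,26,3), (5,27,3), (5,50,1), (5,50,3), (5,51,1), (5,51,3), (6,8,0),
      (6,9,0), (6,10,0), (6,11,0), (6,14,0), (6,15,0), (6,20,0), (6,21,0), (6,22,0), (6,23,0),
      (6,24,0), (6,25,0), (6,26,0), (6,27,0), (6,49,0), (6,50,0), (6,51,0), (7,10,1), (7,10,2),
      (7,10,3), (7,11,2), (7,11,3), (7,12,1), (7,13,2), (7,20,3), (7,21,3), (7,22,1), (7,22,2),
      (7,22,3), (7,23,1), (7,23,2), (7,23,3), (7,24,2), (7,24,3), (7,25,2), (7,25,3), (7,26,1),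
      (7,26,3), (7,27,3), (7,28,3), (7,50,1), (7,50,3), (7,51,1), (7,51,3), (8,10,1), (8,10,2),
      (8,11,0), (8,11,2), (8,11,3), (8,12,1), (8,13,2), (9,11,0), (9,11,2), (9,11,3), (9,12,1),
      (9,13,2), (9,14,3), (9,15,3), (9,20,2), (9,20,3), (9,21,3), (9,22,2), (9,22,3), (9,23,2),
      (9,25,3), (9,50,3), (10,12,1), (10,13,2), (10,14,1), (10,14,3), (10,15,2), (10,22,1),
      (10,22,2), (10,22,3), (10,23,1), (10,23,2), (10,23,3), (10,24,2), (10,24,3), (10,25,2),
      (10,25,3), (10,26,0), (10,27,1), (10,50,1), (10,51,1), (11,13,2), (11,14,3), (11,15,0),
      (11,15,2), (11,15,3), (11,20,0), (11,20,2), (11,20,3), (11,21,0), (11,21,2), (11,21,3),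
      (11,24,0), (11,24,2), (11,24,3), (11,25,0), (11,25,2), (11,25,3), (11,26,0), (11,26,3),
      (11,27,0), (11,27,3), (11,50,0), (11,50,2), (11,50,3), (11,51,0), (11,51,2), (11,51,3),
      (12,14,1), (12,15,1), (12,20,1), (12,21,1), (12,22,1), (12,23,1), (12,26,1), (12,27,1),
      (12,28,1), (12,29,1), (12,49,1), (12,50,1), (12,51,1), (13,15,2), (13,20,2), (13,21,2),
      (13,22,2), (13,23,2), (13,24,2), (13,25,2), (13,28,2), (13,29,2), (13,50,2), (13,51,2),
      (14,23,1), (14,23,3), (14,24,3), (14,25,0), (14,25,3), (14,26,0), (14,27,0), (15,23,1),
      (15,24,2), (15,24,3), (20,22,2), (20,22,3), (20,23,3), (20,25,2), (20,25,3), (20,50,3),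
      (20,51,3), (21,23,3), (21,24,0), (21,25,2), (21,25,3), (22,24,0), (22,24,3), (22,25,0),
      (22,25,3), (22,26,0), (22,26,3), (22,27,0), (22,50,2), (22,50,3), (22,51,2), (22,51,3),
      (23,25,0), (23,25,2), (23,25,3), (23,26,0), (23,26,3), (23,27,1), (23,50,1), (23,51,1),
      (24,26,0), (24,26,3), (24,27,0), (24,27,3), (24,28,3), (24,29,3), (24,50,0), (24,50,2),
      (24,50,3), (24,51,0), (24,51,3), (25,27,0), (25,49,3), (26,28,3), (26,29,3), (27,29,3)].
      col u i \<longrightarrow> col v i \<longrightarrow> same u v"
    and cross: "\<forall>(u,v,x,y)\<in>set
      [(1,2,5,6), (1,2,5,10), (1,2,5,11), (1,2,6,7), (1,2,6,12), (1,2,6,13), (1,2,7,6), (1,2,7,15),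
      (1,2,9,10), (1,2,10,11), (1,2,10,20), (1,2,10,21), (1,2,11,10), (1,2,11,12), (1,2,12,6),
      (1,2,12,11), (1,2,12,13), (1,2,12,24), (1,2,12,25), (1,2,13,6), (1,2,13,12), (1,2,14,7),
      (1,2,23,22), (1,2,23,24), (1,2,24,12), (1,2,24,23), (1,2,25,12), (1,2,25,50), (1,2,25,51),
      (1,3,5,4), (1,3,5,10), (1,3,5,11), (1,3,6,5), (1,3,6,13), (1,3,7,15), (1,3,9,4), (1,3,10,5),
      (1,3,10,21), (1,3,11,5), (1,3,11,10), (1,3,11,12), (1,3,11,22), (1,3,12,11), (1,3,12,13),
      (1,3,12,24), (1,3,12,25), (1,3,13,26), (1,3,13,27), (1,3,14,13), (1,3,22,11), (1,3,23,22),
      (1,3,23,24), (1,3,24,23), (1,3,24,25), (1,3,25,24), (1,3,25,26), (1,3,25,50), (1,3,25,51),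
      (1,3,50,25), (1,3,51,25), (2,3,6,5), (2,3,6,12), (2,3,6,13), (2,3,10,9), (2,3,10,11),
      (2,3,10,20), (2,3,10,21), (2,3,11,10), (2,3,11,12), (2,3,11,22), (2,3,11,23), (2,3,12,11),
      (2,3,12,13), (2,3,12,24), (2,3,12,25), (2,3,13,12), (2,3,13,26), (2,3,14,13), (2,3,21,20),
      (2,3,22,21), (2,3,22,23), (2,3,23,22), (2,3,23,24), (2,3,24,25), (2,3,25,24), (2,3,25,50),
      (2,3,25,51), (2,3,26,25), (2,3,51,50), (2,4,6,7), (2,4,6,12), (2,4,6,13), (2,4,7,6),
      (2,4,9,10), (2,4,10,11), (2,4,10,20), (2,4,10,21), (2,4,11,10), (2,4,11,12), (2,4,11,22),
      (2,4,11,23), (2,4,12,6), (2,4,12,11), (2,4,12,13), (2,4,12,25), (2,4,13,6), (2,4,13,12),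
      (2,4,20,10), (2,4,20,21), (2,4,21,10), (2,4,22,11), (2,4,22,21), (2,4,22,23), (2,4,23,11),
      (2,4,23,24), (2,4,24,12), (2,4,24,25), (2,4,25,12), (2,4,25,24), (2,4,26,13), (2,4,26,25),
      (2,4,50,25), (2,4,50,51), (2,4,51,25), (2,4,51,50), (2,5,6,7), (2,5,6,12), (2,5,6,13),
      (2,5,7,14), (2,5,9,8), (2,5,10,9), (2,5,10,20), (2,5,10,21), (2,5,11,12), (2,5,11,22),
      (2,5,11,23), (2,5,12,13), (2,5,12,24), (2,5,12,25), (2,5,13,12), (2,5,13,26), (2,5,13,27),
      (2,5,14,7), (2,5,14,13), (2,5,15,14), (2,5,21,20), (2,5,22,21), (2,5,22,23), (2,5,23,22),
      (2,5,23,24), (2,5,24,12), (2,5,24,23), (2,5,24,25), (2,5,25,12), (2,5,25,24), (2,5,25,50),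
      (2,5,25,51), (2,5,26,13), (3,2,5,10), (3,2,5,11), (3,2,11,22), (3,2,11,23), (3,2,12,24),
      (3,2,12,25), (3,2,25,50), (3,2,25,51), (3,6,4,8), (3,6,4,9), (3,6,5,10), (3,6,5,11),
      (3,6,9,10), (3,6,10,20), (3,6,10,21), (3,6,11,10), (3,6,11,22), (3,6,11,23), (3,6,12,11),
      (3,6,12,24), (3,6,12,25), (3,6,13,14), (3,6,13,26), (3,6,14,15), (3,6,20,10), (3,6,21,10),
      (3,6,22,11), (3,6,22,23), (3,6,23,11), (3,6,23,22), (3,6,23,24), (3,6,24,23), (3,6,24,25),
      (3,6,25,24), (3,6,25,26), (3,6,25,50), (3,6,25,51), (3,6,26,27), (3,6,27,26), (3,7,5,10),
      (3,7,5,11), (3,7,10,11), (3,7,11,10), (3,7,11,12), (3,7,11,23), (3,7,12,11), (3,7,12,13),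
      (3,7,12,24), (3,7,12,25), (3,7,13,12), (3,7,13,26), (3,7,13,27), (3,7,14,13), (3,7,21,22),
      (3,7,22,11), (3,7,22,23), (3,7,23,11), (3,7,23,22), (3,7,23,24), (3,7,24,12), (3,7,24,23),
      (3,7,24,25), (3,7,25,12), (3,7,25,24), (3,7,25,26), (3,7,25,50), (3,7,25,51), (3,7,26,13),
      (3,7,27,13), (3,7,27,26), (3,7,50,25), (3,7,50,51), (3,7,51,25), (3,7,51,50), (4,5,6,7),
      (4,5,6,12), (4,5,6,13), (4,5,7,14), (4,5,10,9), (4,5,10,20), (4,5,10,21), (4,5,11,12),
      (4,5,11,22), (4,5,11,23), (4,5,12,13), (4,5,12,24), (4,5,12,25), (4,5,13,12), (4,5,13,14),
      (4,5,13,26), (4,5,13,27), (4,5,21,20), (4,5,22,21), (4,5,22,23), (4,5,23,22), (4,5,23,24),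
      (4,5,24,23), (4,5,24,25), (4,5,25,24), (4,5,25,26), (4,5,25,50), (4,5,25,51), (4,5,26,25),
      (4,5,26,27), (4,5,50,51), (4,8,6,12), (4,8,10,11), (4,8,11,12), (4,8,12,11), (4,8,20,10),
      (4,8,21,10), (4,8,22,11), (4,8,23,11), (4,8,24,12), (4,8,25,12), (4,9,6,12), (4,9,10,11),
      (4,9,11,12), (4,9,12,13), (4,9,13,12), (4,9,14,15), (4,9,15,14), (4,9,22,11), (4,9,22,21),
      (4,9,23,11), (4,9,23,22), (4,9,24,23), (4,9,24,25), (4,9,51,50), (5,4,12,24), (5,4,12,25),
      (5,6,7,14), (5,6,7,15), (5,6,8,9), (5,6,9,8), (5,6,9,10), (5,6,12,11), (5,6,12,24),
      (5,6,12,25), (5,6,13,14), (5,6,13,26), (5,6,15,14), (5,6,20,21), (5,6,21,20), (5,6,22,21),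
      (5,6,22,23), (5,6,23,22), (5,6,23,24), (5,6,24,25), (5,6,25,24), (5,6,25,26), (5,6,26,25),
      (5,6,27,26), (5,6,50,51), (5,6,51,50), (5,10,7,14), (5,10,12,13), (5,10,12,24),
      (5,10,13,12), (5,10,13,14), (5,10,14,13), (5,10,21,22), (5,10,22,23), (5,10,23,22),
      (5,10,23,24), (5,10,24,12), (5,10,24,23), (5,10,24,25), (5,10,25,12), (5,10,25,24),
      (5,10,25,26), (5,10,26,13), (5,10,26,25), (5,10,26,27), (5,10,27,13), (5,10,50,51),
      (5,10,51,25), (5,10,51,50), (5,11,7,14), (5,11,7,15), (5,11,12,13), (5,11,12,24),
      (5,11,12,25), (5,11,13,14), (5,11,13,26), (5,11,13,27), (5,11,14,13), (5,11,20,21),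
      (5,11,21,20), (5,11,22,21), (5,11,23,24), (5,11,24,25), (5,11,25,24), (5,11,25,26),
      (5,11,26,13), (5,11,26,25), (5,11,26,27), (5,11,27,13), (5,11,27,26), (5,11,50,25),
      (5,11,50,51), (5,11,51,25), (5,11,51,50), (6,5,10,20), (6,5,10,21), (6,5,11,22),
      (6,5,11,23), (6,7,9,10), (6,7,10,11), (6,7,11,10), (6,7,11,12), (6,7,11,22), (6,7,11,23),
      (6,7,14,13), (6,7,14,28), (6,7,20,21), (6,7,21,20), (6,7,22,21), (6,7,22,23), (6,7,23,22),
      (6,7,23,24), (6,7,24,23), (6,7,24,25), (6,7,25,24), (6,7,25,26), (6,7,27,26), (6,12,10,21),
      (6,12,11,22), (6,12,11,23), (6,12,14,15), (6,12,14,28), (6,12,14,29), (6,12,20,21),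
      (6,12,21,20), (6,12,21,22), (6,12,22,21), (6,12,22,23), (6,12,23,22), (6,12,24,23),
      (6,12,25,26), (6,12,26,27), (6,12,27,26), (6,12,50,51), (6,12,51,50), (6,13,10,21),
      (6,13,11,23), (6,13,14,15), (6,13,14,28), (6,13,14,29), (6,13,21,20), (6,13,21,22),
      (6,13,22,21), (6,13,22,23), (6,13,23,24), (6,13,24,23), (6,13,24,25), (6,13,25,24),
      (6,13,26,25), (6,13,49,24), (6,13,49,50), (6,13,50,25), (6,13,51,25), (7,6,10,21),
      (7,6,11,22), (7,6,11,23), (7,6,12,24), (7,6,12,25), (7,6,13,26), (7,6,13,27), (7,6,25,50),
      (7,6,25,51), (7,14,22,23), (7,14,24,23), (7,14,24,25), (7,14,26,27), (7,14,28,27),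
      (7,15,22,23), (7,15,25,24), (8,9,10,20), (8,9,10,21), (8,9,11,12), (8,9,11,22), (8,9,11,23),
      (8,9,12,11), (9,10,11,12), (9,10,11,22), (9,10,11,23), (9,10,12,13), (9,10,12,25),
      (9,10,13,12), (9,10,14,13), (9,10,22,23), (10,9,12,25), (10,9,25,50), (10,11,12,13),
      (10,11,12,24), (10,11,12,25), (10,11,13,14), (10,11,13,26), (10,11,13,27), (10,11,14,13),
      (10,11,22,21), (10,11,23,24), (10,11,25,24), (10,11,26,27), (10,20,12,25), (10,20,22,23),
      (10,20,24,23), (10,20,50,25), (10,20,50,51), (10,20,51,25), (10,20,51,50), (10,21,12,24),
      (10,21,12,25), (10,21,22,23), (10,21,23,24), (10,21,24,25), (10,21,50,25), (10,21,51,25),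
      (11,10,13,26), (11,12,13,14), (11,12,13,26), (11,12,13,27), (11,12,14,15), (11,12,15,14),
      (11,12,20,21), (11,12,21,20), (11,12,21,22), (11,12,24,23), (11,12,25,26), (11,12,25,50),
      (11,12,25,51), (11,12,26,27), (11,12,50,51), (11,12,51,50), (11,22,24,25), (11,22,25,24),
      (11,22,25,26), (11,22,25,50), (11,22,25,51), (11,22,26,25), (11,22,26,27), (11,22,27,26),
      (11,23,13,26), (11,23,24,25), (11,23,25,26), (11,23,26,25), (11,23,50,25), (11,23,51,25),
      (12,13,22,23), (12,13,23,22), (12,13,23,24), (12,13,26,25), (12,13,50,51), (12,13,51,50),
      (12,24,26,27), (12,24,28,27), (12,24,28,29), (12,24,29,28), (12,24,49,50), (12,24,50,51),
      (12,24,51,50), (12,25,26,27), (13,12,24,49), (13,12,25,50), (13,12,25,51), (13,14,24,25),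
      (13,14,25,26), (13,14,28,27), (13,26,28,29), (13,26,29,28), (13,27,28,29), (14,15,23,24),
      (14,15,24,23), (22,23,26,27), (22,23,50,51), (22,23,51,50), (23,22,25,50), (23,22,25,51),
      (23,24,25,50), (23,24,25,51), (23,24,27,26), (23,24,50,51), (23,24,51,50), (24,25,50,49)].
      same u x \<longrightarrow> same v y \<longrightarrow> (before u x \<longleftrightarrow> before v y)"
    and cross_flip: "\<forall>(u,v,x,y)\<in>set
      [(2,4,6,3), (2,5,6,3), (2,5,7,3), (3,6,5,4), (3,7,4,5), (3,7,5,4), (3,7,10,5), (3,7,11,5),
      (4,8,6,5), (4,8,7,6), (4,8,10,5), (4,8,11,5), (4,8,12,6), (4,9,6,5), (4,9,7,6), (4,9,10,5),
      (4,9,11,5), (4,9,12,6), (4,9,13,6), (5,10,7,6), (5,10,9,8), (5,10,12,6), (5,10,13,6),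
      (5,10,14,7), (5,11,7,6), (5,11,9,8), (5,11,12,6), (5,11,13,6), (5,11,14,7), (5,11,15,7),
      (6,12,9,10), (6,12,10,9), (6,12,11,10), (6,12,14,7), (6,12,15,7), (6,12,20,10),
      (6,12,21,10), (6,13,8,9), (6,13,9,8), (6,13,9,10), (6,13,10,9), (6,13,10,11), (6,13,11,10),
      (6,13,14,7), (6,13,15,7), (6,13,20,10), (6,13,21,10), (6,13,22,11), (6,13,23,11),
      (7,14,10,11), (7,14,11,10), (7,14,12,11), (7,14,13,12), (7,14,24,12), (7,14,25,12),
      (7,15,10,9), (7,15,11,10), (7,15,11,12), (7,15,12,11), (7,15,13,12), (7,15,22,11),
      (7,15,24,12), (7,15,25,12), (7,15,26,13), (7,15,27,13), (10,20,13,12), (10,20,22,11),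
      (10,20,24,12), (10,21,12,11), (10,21,13,12), (10,21,22,11), (10,21,23,11), (10,21,24,12),
      (11,22,13,12), (11,22,21,20), (11,22,24,12), (11,22,25,12), (11,22,26,13), (11,22,27,13),
      (11,23,13,12), (11,23,13,14), (11,23,21,20), (11,23,24,12), (11,23,25,12), (11,23,26,13),
      (11,23,27,13), (12,24,14,13), (12,24,14,15), (12,24,15,14), (12,24,21,22), (12,24,23,22),
      (12,24,26,13), (12,25,20,21), (12,25,21,20), (12,25,21,22), (12,25,22,21), (12,25,22,23),
      (12,25,23,22), (12,25,26,13), (12,25,27,13), (12,25,28,14), (12,25,29,14), (13,26,23,22),
      (13,26,24,23), (13,26,25,24), (13,26,28,14), (13,27,15,14), (13,27,23,22), (13,27,23,24),
      (13,27,25,24), (13,27,28,14), (13,27,29,14), (14,28,25,26), (14,28,27,26), (14,29,25,24),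
      (14,29,25,26), (14,29,27,26), (24,49,50,25)].
      same u x \<longrightarrow> same y v \<longrightarrow> (before u x \<longleftrightarrow> \<not> before y v)"
    and trans: "\<forall>(u,v,w)\<in>set
      [(1,10,25), (1,13,25), (1,13,50), (1,13,51), (2,7,20), (2,10,13), (2,10,25), (3,4,14), (3,4,15),
      (3,11,13), (3,13,50), (3,13,51), (4,7,22), (4,7,25), (4,12,50), (4,12,51), (4,13,24),
      (4,22,50), (4,22,51), (5,13,24), (7,12,50), (7,12,51), (7,22,26), (7,22,50), (7,22,51),
      (8,11,13), (9,11,13), (9,20,22), (10,12,27), (10,13,15), (13,15,24), (14,25,27), (20,23,25),
      (21,23,25), (22,24,26), (22,24,27), (24,26,28), (24,26,29)].
      before u v \<longrightarrow> before v w \<longrightarrow> before u w"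
    and negtrans: "\<forall>(u,v,w)\<in>set
      [(1,10,25), (1,13,22), (1,13,25), (2,7,20), (2,10,25), (3,11,13), (3,11,26), (3,13,22), (3,13,24),
      (3,13,51), (4,13,24), (4,22,50), (4,22,51), (6,10,26), (7,10,12), (7,10,23), (7,11,13),
      (7,11,26), (7,12,50), (7,12,51), (11,13,20), (13,15,24), (20,22,50), (20,22,51), (22,25,27),
      (24,27,29)].
      before u w \<longrightarrow> before u v \<or> before v w"
  shows False
  using some proper same cross cross_flip trans negtrans [[argo_timeout = 1000]]
  \<comment> \<open>The quantifiers over explicit lists become finite conjunctions of ground
    clauses, and only propositional reasoning remains.\<close>
  unfolding list.set ball_simps bex_simps prod.case fixed simp_thms
  by (elim conjE) argo

section \<open>X-trees in heap numbering\<close>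

definition heap_index :: "nat \<times> nat \<Rightarrow> nat" where
  "heap_index = (\<lambda>(d, i). 2 ^ d + i)"

lemma inj_on_heap_index: "inj_on heap_index (xtree_V D)"
proof -
  \<comment> \<open>Level \<open>d\<close> occupies the numbers from \<open>2 ^ d\<close> up to but
    excluding \<open>2 ^ (d + 1)\<close>, so numbers on different levels cannot collide.\<close>
  have *: "2 ^ d + i < 2 ^ d' + i'" if "d < d'" "i < 2 ^ d" for d d' i i' :: nat
  proof -
    have "2 ^ d + i < 2 ^ Suc d" using that(2) by simp
    also have "(2::nat) ^ Suc d \<le> 2 ^ d'" using that(1) by (intro power_increasing) auto
    finally show ?thesis by simp
  qed
  show ?thesis
  proof (rule inj_onI, clarsimp simp: heap_index_def xtree_V_def)
    fix d i d' i' :: nat assume a: "i < 2 ^ d" "i' < 2 ^ d'" "2 ^ d + i = 2 ^ d' + i'"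
    then have "d = d'" using *[of d d' i i'] *[of d' d i' i] by (metis less_irrefl linorder_neqE_nat)
    then show "d = d' \<and> i = i'" using a by simp
  qed
qed

lemma heap_index_cases:
  fixes u :: nat
  assumes "1 \<le> u"
  obtains d i where "u = 2 ^ d + i" "i < 2 ^ d"
proof -
  obtain d where "2 ^ d \<le> u" "u < 2 ^ (d + 1)" using ex_power_ivl1[of 2 u] assms by auto
  then show ?thesis using that[of d "u - 2 ^ d"] by simp
qed

lemma graph_xtree: "graph (xtree_V D) (xtree_E D)"
  unfolding graph_def
proof (intro conjI ballI)
  have "xtree_V D \<subseteq> {..D} \<times> {..<2 ^ D}"
    by (auto simp: xtree_V_def intro: less_le_trans[OF _ power_increasing])
  then show "finite (xtree_V D)" by (rule finite_subset) simp
  fix e assume "e \<in> xtree_E D"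
  then consider d i c where "e = {(d, i), (d + 1, 2 * i + c)}" "d < D" "i < 2 ^ d" "c < 2"
    | d i where "e = {(d, i), (d, i + 1)}" "d \<le> D" "i + 1 < 2 ^ d"
    unfolding xtree_E_def by blast
  then show "\<exists>u v. e = {u, v} \<and> u \<noteq> v \<and> u \<in> xtree_V D \<and> v \<in> xtree_V D"
  proof cases
    case 1
    then show ?thesis by (intro exI[of _ "(d, i)"] exI[of _ "(d + 1, 2 * i + c)"]) (auto simp: xtree_V_def)
  next
    case 2
    then show ?thesis by (intro exI[of _ "(d, i)"] exI[of _ "(d, i + 1)"]) (auto simp: xtree_V_def)
  qed
qed

lemma heap_index_image: "heap_index ` xtree_V D = {1..<2 ^ (D + 1)}"
proof
  show "heap_index ` xtree_V D \<subseteq> {1..<2 ^ (D + 1)}"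
  proof (rule image_subsetI)
    fix a assume "a \<in> xtree_V D"
    then obtain d i where a: "a = (d, i)" "d \<le> D" "i < 2 ^ d" by (auto simp: xtree_V_def)
    then have "(2::nat) ^ d \<le> 2 ^ D" by (intro power_increasing) auto
    then have "2 ^ d + i < 2 * 2 ^ D" using a(3) by linarith
    moreover have "Suc 0 \<le> 2 ^ d" by (simp add: Suc_leI)
    ultimately show "heap_index a \<in> {1..<2 ^ (D + 1)}" using a by (simp add: heap_index_def)
  qed
  show "{1..<2 ^ (D + 1)} \<subseteq> heap_index ` xtree_V D"
  proof
    fix u :: nat assume u: "u \<in> {1..<2 ^ (D + 1)}"
    then obtain d i where di: "u = 2 ^ d + i" "i < 2 ^ d" using heap_index_cases[of u] by auto
    then have "(2::nat) ^ d < 2 ^ (D + 1)" using u by auto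
    then have "d \<le> D" by (subst (asm) power_strict_increasing_iff) auto
    then show "u \<in> heap_index ` xtree_V D"
      using di by (auto simp: heap_index_def xtree_V_def intro!: rev_image_eqI[of "(d, i)"])
  qed
qed

text \<open>The X-tree of depth 5 in heap numbering, with each edge directed upwards in number. The
  excluded targets are the leftmost vertices of the levels: their numerical predecessor is the last
  vertex of the level above, not a neighbour on the same level.\<close>

definition heap_arcs :: "(nat \<times> nat) set" where
  "heap_arcs = {(u, v). 1 \<le> u \<and> v < 64 \<and> (v = 2 * u \<or> v = 2 * u + 1 \<or> v = u + 1 \<and> v \<notin> {2, 4, 8, 16, 32})}"

definition xtree_arcs :: "(nat \<times> nat) set" where
  "xtree_arcs = heap_arcs \<union> heap_arcs\<inverse>"

lemma arcs_xtree: "arcs heap_index (xtree_E 5) = xtree_arcs"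
  unfolding xtree_arcs_def
proof
  have fwd: "(heap_index a, heap_index b) \<in> heap_arcs \<union> heap_arcs\<inverse>" if "{a, b} \<in> xtree_E 5" for a b
  proof -
    have child: "(2 ^ d + i, 2 ^ (d + 1) + (2 * i + c)) \<in> heap_arcs" if "d < 5" "i < 2 ^ d" "c < 2" for d i c :: nat
    proof -
      have "(2::nat) ^ d \<le> 2 ^ 4" using that(1) by (intro power_increasing) auto
      moreover have "(0::nat) < 2 ^ d" by simp
      moreover have "c = 0 \<or> c = 1" using that(3) by auto
      ultimately show ?thesis using that(2) by (auto simp: heap_arcs_def)
    qed
    have sibling: "(2 ^ d + i, 2 ^ d + (i + 1)) \<in> heap_arcs" if "d \<le> 5" "i + 1 < 2 ^ d" for d i :: nat
    proof -
      \<comment> \<open>Once the level is a literal, its bounds evaluate to numbers and can be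
        compared with the excluded powers of two.\<close>
      have "d = 0 \<or> d = 1 \<or> d = 2 \<or> d = 3 \<or> d = 4 \<or> d = 5" using that(1) by auto
      then show ?thesis using that(2) by (elim disjE) (auto simp: heap_arcs_def)
    qed
    from that consider d i c where "{a, b} = {(d, i), (d + 1, 2 * i + c)}" "d < 5" "i < 2 ^ d" "c < 2"
      | d i where "{a, b} = {(d, i), (d, i + 1)}" "d \<le> 5" "i + 1 < 2 ^ d"
      unfolding xtree_E_def by blast
    then show ?thesis
    proof cases
      case 1
      then have "a = (d, i) \<and> b = (d + 1, 2 * i + c) \<or> b = (d, i) \<and> a = (d + 1, 2 * i + c)"
        unfolding doubleton_eq_iff by blast
      then show ?thesis using child[OF 1(2-4)] by (elim disjE) (simp_all add: heap_index_def)
    next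
      case 2
      then have "a = (d, i) \<and> b = (d, i + 1) \<or> b = (d, i) \<and> a = (d, i + 1)"
        unfolding doubleton_eq_iff by blast
      then show ?thesis using sibling[OF 2(2,3)] by (elim disjE) (simp_all add: heap_index_def)
    qed
  qed
  then show "arcs heap_index (xtree_E 5) \<subseteq> heap_arcs \<union> heap_arcs\<inverse>" by (auto simp: arcs_def)
  have bwd: "(u, v) \<in> arcs heap_index (xtree_E 5)" if "(u, v) \<in> heap_arcs" for u v
  proof -
    have u: "1 \<le> u" "v < 64" using \<open>(u, v) \<in> heap_arcs\<close> by (auto simp: heap_arcs_def)
    then obtain d i where di: "u = 2 ^ d + i" "i < 2 ^ d" using heap_index_cases by blast
    have child: ?thesis if "v = 2 * u + c" "c < 2" for c
    proof -
      have "(2::nat) ^ d < 32" using u di that by linarith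
      then have "(2::nat) ^ d < 2 ^ 5" by simp
      then have "d < 5" by (subst (asm) power_strict_increasing_iff) auto
      then have "{(d, i), (d + 1, 2 * i + c)} \<in> xtree_E 5" using di that unfolding xtree_E_def by blast
      then show ?thesis by (rule arcsI) (simp_all add: heap_index_def di that)
    qed
    have sibling: ?thesis if "v = u + 1" "v \<notin> {2, 4, 8, 16, 32}"
    proof -
      have "(2::nat) ^ d < 64" using u di that by linarith
      then have "(2::nat) ^ d < 2 ^ 6" by simp
      then have "d < 6" by (subst (asm) power_strict_increasing_iff) auto
      then have "d = 0 \<or> d = 1 \<or> d = 2 \<or> d = 3 \<or> d = 4 \<or> d = 5" by linarith
      \<comment> \<open>If \<open>u\<close> were last on its level, then \<open>v\<close> would be
        \<open>2 ^ (d + 1)\<close>: one of the excluded numbers, or 64 when \<open>d = 5\<close>,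
        which the bound on \<open>v\<close> forbids.\<close>
      then have "i + 1 \<noteq> 2 ^ d" using that di u by (elim disjE) auto
      then have "d \<le> 5 \<and> i + 1 < 2 ^ d" using di \<open>d < 6\<close> by linarith
      then have "{(d, i), (d, i + 1)} \<in> xtree_E 5" unfolding xtree_E_def by blast
      then show ?thesis by (rule arcsI) (simp_all add: heap_index_def di that)
    qed
    from \<open>(u, v) \<in> heap_arcs\<close> show ?thesis
      using child[of 0] child[of 1] sibling unfolding heap_arcs_def by auto
  qed
  then show "heap_arcs \<union> heap_arcs\<inverse> \<subseteq> arcs heap_index (xtree_E 5)"
    using arcs_sym[of _ _ heap_index "xtree_E 5"] by auto
qed

lemma xtree_arcs_iff:
  "(u, v) \<in> xtree_arcs \<longleftrightarrow>
     1 \<le> u \<and> v < 64 \<and> (v = 2 * u \<or> v = 2 * u + 1 \<or> v = u + 1 \<and> v \<notin> {2, 4, 8, 16, 32}) \<or>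
     1 \<le> v \<and> u < 64 \<and> (u = 2 * v \<or> u = 2 * v + 1 \<or> u = v + 1 \<and> u \<notin> {2, 4, 8, 16, 32})"
  by (simp add: xtree_arcs_def heap_arcs_def)

lemma xtree_arcs_subset: "xtree_arcs \<subseteq> {1..<64} \<times> {1..<64}"
proof -
  have "u < v \<and> 1 \<le> u \<and> v < 64" if "(u, v) \<in> heap_arcs" for u v
    using that unfolding heap_arcs_def by fastforce
  then show ?thesis unfolding xtree_arcs_def by fastforce
qed

section \<open>The track number of the X-tree of depth 5\<close>

lemma xtree_no_4_tracks: "\<not> rank_layout {1..<64} xtree_arcs 4 \<tau> L"
proof
  assume lay: "rank_layout {1..<64} xtree_arcs 4 \<tau> L"
  \<comment> \<open>The triangle formed by a vertex and its two children breaks the symmetry between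
    the tracks.\<close>
  have "distinct [\<tau> 6, \<tau> 12, \<tau> 13]"
    using rank_layout_proper[OF lay, of 6 12] rank_layout_proper[OF lay, of 6 13]
      rank_layout_proper[OF lay, of 12 13] by (simp add: xtree_arcs_iff)
  moreover have "set [\<tau> 6, \<tau> 12, \<tau> 13] \<subseteq> {..<4}" using rank_layout_lt[OF lay] by simp
  ultimately obtain ks where ks: "length ks = 4" "set ks = {..<4}"
    and nth: "\<And>i. i < length [\<tau> 6, \<tau> 12, \<tau> 13] \<Longrightarrow> ks ! i = [\<tau> 6, \<tau> 12, \<tau> 13] ! i"
    by (rule extend_to_track_list) blast
  have fixed: "\<tau> 6 = ks ! 0" "\<tau> 12 = ks ! 1" "\<tau> 13 = ks ! 2"
    using nth[of 0] nth[of 1] nth[of 2] by auto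
  \<comment> \<open>Simplified, these two facts give a rewrite rule for every single arc, so the
    side conditions of the clause instances reduce to lookups.\<close>
  have arcs_child: "list_all (\<lambda>u. (u, 2 * u) \<in> xtree_arcs \<and> (2 * u, u) \<in> xtree_arcs \<and>
      (u, 2 * u + 1) \<in> xtree_arcs \<and> (2 * u + 1, u) \<in> xtree_arcs) (1 # [2..<32])"
    by (auto simp: list_all_iff xtree_arcs_iff)
  have arcs_sibling: "list_all (\<lambda>u. u + 1 \<notin> {2, 4, 8, 16, 32} \<longrightarrow>
      (u, u + 1) \<in> xtree_arcs \<and> (u + 1, u) \<in> xtree_arcs) (1 # [2..<63])"
    unfolding list_all_iff set_upt list.set xtree_arcs_iff by simp
  note arcs = arcs_child[simplified] arcs_sibling[simplified]
  have cs: "{..<4} \<subseteq> set [0, 1, 2, 3 :: nat]" by auto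
  show False
    apply (rule xtree_clauses_unsat[of "\<lambda>v i. \<tau> v = ks ! i" "\<lambda>u v. \<tau> u = \<tau> v" L])
             apply (simp_all add: fixed)[3]
    subgoal
      by (rule colour_instances[OF lay ks cs, where fx = "[(6, 0), (12, 1), (13, 2)]"])
        (simp_all add: fixed arcs)
    subgoal by (rule proper_instances[OF lay]) (unfold list.set ball_simps prod.case, simp add: arcs)
    subgoal by (rule same_instances)
    subgoal by (rule cross_instances[OF lay]) (unfold list.set ball_simps prod.case, simp add: arcs)
    subgoal by (rule cross_flip_instances[OF lay xtree_arcs_subset]) (unfold list.set ball_simps prod.case, simp add: arcs)
    subgoal by (rule trans_instances[OF lay]) (unfold list.set ball_simps prod.case, simp)
    subgoal by (rule negtrans_instances[OF lay]) (unfold list.set ball_simps prod.case, simp)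
    done
qed

text \<open>Entry 0 is a filler, here and in \<open>xtree_pos\<close>, because heap numbers start at
  1.\<close>

definition xtree_track :: "nat list" where
  "xtree_track =
    [0, 0, 3, 2, 4, 1, 0, 3, 0, 2, 4, 3, 1, 2, 0, 1, 3, 4, 0, 1, 0, 2, 1, 4, 0, 3, 1, 4, 2, 3, 0, 3,
    2, 4, 1, 0, 3, 1, 4, 3, 1, 2, 1, 4, 2, 4, 0, 3, 2, 3, 2, 1, 0, 4, 0, 1, 4, 1, 2, 0, 2, 3, 4,
    2]"

definition xtree_pos :: "nat list" where
  "xtree_pos =
    [0, 8, 46, 36, 55, 18, 7, 45, 2, 28, 56, 47, 22, 35, 6, 17, 40, 52, 1, 15, 3, 30, 20, 59, 10, 50,
    24, 61, 34, 44, 4, 42, 26, 51, 13, 0, 39, 14, 53, 41, 16, 29, 19, 57, 32, 58, 9, 48, 37, 49,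
    38, 25, 12, 62, 11, 23, 60, 21, 33, 5, 31, 43, 54, 27]"

text \<open>One entry for each of the ten pairs of tracks, with the edges between them directed from
  the smaller track to the larger and sorted along both tracks at once. That such a sorting exists
  is the absence of X-crossings.\<close>

definition xtree_chains :: "(nat \<times> nat \<times> (nat \<times> nat) list) list" where
  "xtree_chains =
    [(0,1,[(35,34), (18,37), (18,19), (20,19), (20,40), (30,15), (14,15), (6,5), (6,12), (24,12),
    (54,55), (52,26), (52,51)]), (0,2,[(18,9), (8,9), (20,41), (20,21), (30,60), (59,60), (59,58),
    (14,28), (14,13), (6,13), (6,3), (1,3), (24,48)]), (0,3,[(35,36), (18,36), (8,16), (30,31),
    (30,61), (30,29), (59,29), (14,29), (14,7), (6,7), (1,2), (46,47), (24,49), (24,25)]),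
    (0,4,[(35,17), (18,17), (8,17), (8,4), (20,10), (46,45), (46,23), (24,23), (54,27), (54,53),
    (52,53)]), (1,2,[(19,9), (40,41), (42,41), (42,21), (22,21), (22,44), (57,58), (57,28),
    (12,13), (26,13), (51,50)]), (1,3,[(37,36), (19,39), (40,39), (15,31), (15,7), (5,2), (5,11),
    (22,11), (12,11), (12,25), (26,25), (51,25)]), (1,4,[(34,33), (34,17), (37,38), (19,38),
    (5,4), (5,10), (42,43), (22,45), (22,23), (57,56), (55,56), (55,27), (26,27), (26,53)]),
    (2,3,[(32,16), (63,31), (60,61), (58,29), (28,29), (3,7), (3,2), (48,47), (48,49), (50,49),
    (50,25)]), (2,4,[(32,33), (63,62), (9,4), (9,10), (21,10), (21,43), (44,43), (44,45), (28,56),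
    (28,27), (13,27)]), (3,4,[(16,33), (16,17), (39,38), (31,62), (61,62), (2,4), (11,10),
    (11,23), (47,23)])]"

lemma xtree_5_tracks:
  "rank_layout {1..<64} xtree_arcs 5 ((!) xtree_track) (\<lambda>u v. xtree_pos ! u < xtree_pos ! v)"
proof (rule chains_imp_rank_layout)
  have "length xtree_track = 64" "length xtree_pos = 64" by (simp_all add: xtree_track_def xtree_pos_def)
  note track = nth_table[OF xtree_track_def this(1), simplified]
    and pos = nth_table[OF xtree_pos_def this(2), simplified]
  have N: "{1..<64} = set (1 # [2..<64::nat])" unfolding list.set set_upt by auto
  show "\<forall>v\<in>{1..<64}. xtree_track ! v < 5"
    unfolding N by (simp add: track del: set_upt)
  have "distinct (map ((!) xtree_pos) (1 # [2..<64]))" by (simp add: pos)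
  then show "inj_on ((!) xtree_pos) {1..<64}" unfolding N distinct_map by blast
  show "xtree_arcs \<subseteq> {1..<64} \<times> {1..<64}" by (rule xtree_arcs_subset)
  show "\<forall>(i, j, es)\<in>set xtree_chains. i < j \<and> (\<forall>(u, v)\<in>set es. xtree_track ! u = i \<and> xtree_track ! v = j) \<and>
      successively (\<lambda>(u, v) (x, y). xtree_pos ! u \<le> xtree_pos ! x \<and> xtree_pos ! v \<le> xtree_pos ! y) es"
    by (simp add: track pos xtree_chains_def)
  show "distinct (map (\<lambda>(i, j, es). (i, j)) xtree_chains)" by (simp add: xtree_chains_def)
  let ?in = "\<lambda>u v. \<exists>(i, j, es)\<in>set xtree_chains. (u, v) \<in> set es \<or> (v, u) \<in> set es"
  have c: "\<forall>u\<in>set (1 # [2..<32]). ?in u (2 * u) \<and> ?in u (2 * u + 1)"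
    by (simp add: xtree_chains_def del: set_upt)
  have s: "\<forall>u\<in>set (1 # [2..<63]). u + 1 \<notin> {2, 4, 8, 16, 32} \<longrightarrow> ?in u (u + 1)"
    by (simp add: xtree_chains_def del: set_upt)
  have in_sym: "?in u v \<Longrightarrow> ?in v u" for u v by blast
  have "?in u v" if "(u, v) \<in> heap_arcs" for u v
  proof -
    have u: "1 \<le> u" "v < 64" and v: "v = 2 * u \<or> v = 2 * u + 1 \<or> v = u + 1 \<and> v \<notin> {2, 4, 8, 16, 32}"
      using that unfolding heap_arcs_def by auto
    have "u \<in> set (1 # [2..<32])" if "v = 2 * u \<or> v = 2 * u + 1"
      using u that unfolding list.set set_upt by auto
    moreover have "u \<in> set (1 # [2..<63])" if "v = u + 1"
      using u that unfolding list.set set_upt by auto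
    ultimately show ?thesis using v bspec[OF c, of u] bspec[OF s, of u] by blast
  qed
  then show "\<forall>(u, v)\<in>xtree_arcs. ?in u v" using in_sym unfolding xtree_arcs_def by blast
qed

lemma xtree_track_number: "track_number (xtree_V 5) (xtree_E 5) = 5"
proof -
  have "track_number (xtree_V 5) (xtree_E 5) = Suc 4"
  proof (rule track_number_eqI[OF graph_xtree inj_on_heap_index])
    have im: "heap_index ` xtree_V 5 = {1..<64}" using heap_index_image[of 5] by simp
    show "rank_layout (heap_index ` xtree_V 5) (arcs heap_index (xtree_E 5)) (Suc 4) ((!) xtree_track)
        (\<lambda>u v. xtree_pos ! u < xtree_pos ! v)"
      using xtree_5_tracks by (simp add: im arcs_xtree)
    show "\<not> rank_layout (heap_index ` xtree_V 5) (arcs heap_index (xtree_E 5)) 4 \<tau> L" for \<tau> L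
      using xtree_no_4_tracks unfolding im arcs_xtree .
  qed
  then show ?thesis by simp
qed

section \<open>Halin graphs\<close>

definition cyclic_next :: "'a list \<Rightarrow> 'a \<Rightarrow> 'a" where
  "cyclic_next xs x = the (map_of (zip xs (rotate1 xs)) x)"

lemma cyclic_next_nth:
  assumes "distinct xs" "i < length xs"
  shows "cyclic_next xs (xs ! i) = xs ! (Suc i mod length xs)"
  using assms by (simp add: cyclic_next_def map_of_zip_nth nth_rotate1)

lemma cyclic_perm_on_cyclic_next:
  assumes "distinct xs"
  shows "cyclic_perm_on (set xs) (cyclic_next xs)"
proof -
  let ?n = "length xs"
  have pow: "(cyclic_next xs ^^ k) (xs ! i) = xs ! ((i + k) mod ?n)" if "i < ?n" for i k
  proof (induction k)
    case (Suc k)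
    have "(i + k) mod ?n < ?n" by (rule mod_less_divisor) (use that in linarith)
    then show ?case using Suc cyclic_next_nth[OF assms, of "(i + k) mod ?n"] by (simp add: mod_Suc_eq)
  qed (use that in simp)
  have reach: "\<exists>k. (cyclic_next xs ^^ k) x = y" if xy: "x \<in> set xs" "y \<in> set xs" for x y
  proof -
    obtain i j where ij: "i < ?n" "x = xs ! i" "j < ?n" "y = xs ! j" using xy by (metis in_set_conv_nth)
    \<comment> \<open>Moving from index \<open>i\<close> to index \<open>j\<close> takes
      \<open>j - i\<close> steps modulo the length; adding the length keeps the count in the natural
      numbers.\<close>
    have "(i + (?n - i + j)) mod ?n = j" using ij by simp
    then have "(cyclic_next xs ^^ (?n - i + j)) x = y" using pow[OF ij(1), of "?n - i + j"] ij by simp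
    then show ?thesis by blast
  qed
  have sub: "cyclic_next xs ` set xs \<subseteq> set xs"
  proof
    fix y assume "y \<in> cyclic_next xs ` set xs"
    then obtain i where "i < ?n" "y = cyclic_next xs (xs ! i)" by (auto simp: in_set_conv_nth)
    moreover from this have "Suc i mod ?n < ?n" by (intro mod_less_divisor) linarith
    ultimately show "y \<in> set xs" using cyclic_next_nth[OF assms, of i] by simp
  qed
  have "set xs \<subseteq> cyclic_next xs ` set xs"
  proof
    fix y assume "y \<in> set xs"
    then obtain j where j: "j < ?n" "y = xs ! j" by (auto simp: in_set_conv_nth)
    \<comment> \<open>The cyclic predecessor of \<open>j\<close>: adding the length minus 1 avoids
      truncated subtraction at \<open>j = 0\<close>.\<close>
    define i where "i = (j + (?n - 1)) mod ?n"
    have i: "i < ?n" unfolding i_def by (rule mod_less_divisor) (use j in linarith)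
    have "Suc i mod ?n = (Suc (j + (?n - 1))) mod ?n" unfolding i_def by (rule mod_Suc_eq)
    also have "Suc (j + (?n - 1)) = j + ?n" using j by simp
    finally have "Suc i mod ?n = j" using j by simp
    then have "y = cyclic_next xs (xs ! i)" using cyclic_next_nth[OF assms i] j by simp
    then show "y \<in> cyclic_next xs ` set xs" using i by auto
  qed
  with sub have im: "cyclic_next xs ` set xs = set xs" by blast
  \<comment> \<open>A surjection of a finite set onto itself is injective.\<close>
  then have "inj_on (cyclic_next xs) (set xs)" by (intro eq_card_imp_inj_on) auto
  then show ?thesis using im reach unfolding cyclic_perm_on_def bij_betw_def by blast
qed

text \<open>A plane tree is presented by neighbour lists, the order of a list being the rotation at
  the vertex. The numbering gives every vertex except 0 exactly one smaller neighbour, its parent;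
  this replaces connectedness and acyclicity by conditions that can be checked vertex by
  vertex.\<close>

locale neighbour_lists =
  fixes n :: nat and nb :: "nat \<Rightarrow> nat list"
  assumes n_pos: "0 < n"
    and nb_dist: "u < n \<Longrightarrow> distinct (nb u)"
    and nb_sym: "u < n \<Longrightarrow> v \<in> set (nb u) \<Longrightarrow> v < n \<and> v \<noteq> u \<and> u \<in> set (nb v)"
    and nb_parent: "0 < u \<Longrightarrow> u < n \<Longrightarrow> \<exists>p<u. p \<in> set (nb u)"
    and nb_parent_unique: "u < n \<Longrightarrow> v \<in> set (nb u) \<Longrightarrow> w \<in> set (nb u) \<Longrightarrow> v < u \<Longrightarrow> w < u \<Longrightarrow> v = w"
begin

definition T :: "nat set set" where
  "T = {{u, v} | u v. u < n \<and> v \<in> set (nb u)}"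

lemma edge_T: "{u, v} \<in> T \<longleftrightarrow> u < n \<and> v \<in> set (nb u)"
proof
  assume "{u, v} \<in> T"
  then obtain a b where ab: "{u, v} = {a, b}" "a < n" "b \<in> set (nb a)" unfolding T_def by blast
  then show "u < n \<and> v \<in> set (nb u)" using nb_sym[of a b] by (auto simp: doubleton_eq_iff)
qed (auto simp: T_def)

lemma neighbors_T: "u < n \<Longrightarrow> neighbors T u = set (nb u)"
  unfolding neighbors_def edge_T by auto

lemma degree_T: "u < n \<Longrightarrow> degree T u = length (nb u)"
  by (simp add: degree_def neighbors_T nb_dist distinct_card)

lemma leaf_T: "leaf T u \<longleftrightarrow> u < n \<and> length (nb u) = 1"
proof (cases "u < n")
  case False
  then have "neighbors T u = {}" unfolding neighbors_def edge_T by auto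
  then show ?thesis using False by (simp add: leaf_def degree_def)
qed (simp add: leaf_def degree_T)

lemma graph_T: "graph {..<n} T"
  unfolding graph_def
proof (intro conjI ballI)
  fix e assume "e \<in> T"
  then obtain u v where "e = {u, v}" "u < n" "v \<in> set (nb u)" unfolding T_def by blast
  then show "\<exists>u v. e = {u, v} \<and> u \<noteq> v \<and> u \<in> {..<n} \<and> v \<in> {..<n}" 
    using nb_sym[of u v] by (intro exI[of _ u] exI[of _ v]) auto
qed simp

text \<open>The largest vertex of a cycle would have two smaller neighbours.\<close>
lemma acyclic_T: "\<not> is_cycle T vs"
proof
  assume cyc: "is_cycle T vs"
  let ?m = "length vs"
  have len: "3 \<le> ?m" and dist: "distinct vs"
    and adj: "\<And>i. i < ?m \<Longrightarrow> {vs ! i, vs ! (Suc i mod ?m)} \<in> T"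
    using cyc unfolding is_cycle_def by auto
  have ne: "vs \<noteq> []" using len by auto
  then have "Max (set vs) \<in> set vs" by simp
  then obtain i where i: "i < ?m" "vs ! i = Max (set vs)" by (metis in_set_conv_nth)
  \<comment> \<open>The position cyclically before the maximum, as \<open>?k\<close> below is the
    one after it.\<close>
  define j where "j = (i + (?m - 1)) mod ?m"
  have j: "j < ?m" unfolding j_def by (rule mod_less_divisor) (use len in linarith)
  have "Suc j mod ?m = (Suc (i + (?m - 1))) mod ?m" unfolding j_def by (rule mod_Suc_eq)
  also have "Suc (i + (?m - 1)) = i + ?m" using len by simp
  finally have ji: "Suc j mod ?m = i" using i by simp
  let ?k = "Suc i mod ?m"
  have k: "?k < ?m" by (rule mod_less_divisor) (use len in linarith)
  have "?k \<noteq> i" using i(1) len by (cases "Suc i = ?m") auto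
  have "j \<noteq> i" using ji i(1) len by (cases "Suc j = ?m") auto
  \<comment> \<open>The two neighbours on the cycle would coincide only if the cycle had length
    2.\<close>
  have "j \<noteq> ?k"
  proof
    assume "j = ?k"
    then show False using ji i(1) len by (cases "Suc i = ?m"; cases "Suc (Suc i) = ?m") auto
  qed
  have le: "vs ! l \<le> vs ! i" if "l < ?m" for l using that i(2) by simp
  have "vs ! j \<noteq> vs ! i" "vs ! ?k \<noteq> vs ! i" "vs ! j \<noteq> vs ! ?k"
    using dist i(1) j k \<open>?k \<noteq> i\<close> \<open>j \<noteq> i\<close> \<open>j \<noteq> ?k\<close> by (auto simp: nth_eq_iff_index_eq)
  then have lt: "vs ! j < vs ! i" "vs ! ?k < vs ! i" using le[OF j] le[OF k] by auto
  have "{vs ! i, vs ! ?k} \<in> T" using adj[OF i(1)] .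
  moreover have "{vs ! i, vs ! j} \<in> T" using adj[OF j] ji by (simp add: insert_commute)
  ultimately show False
    using nb_parent_unique lt \<open>vs ! j \<noteq> vs ! ?k\<close> unfolding edge_T by blast
qed

text \<open>Following parents strictly decreases the number, so every vertex reaches 0; symmetry of
  adjacency then joins any two vertices through 0.\<close>

lemma connected_T: "connected_graph {..<n} T"
proof -
  let ?R = "{(x, y). {x, y} \<in> T}"
  have root: "u < n \<Longrightarrow> (u, 0) \<in> ?R\<^sup>*" for u
  proof (induction u rule: less_induct)
    case (less u)
    show ?case
    proof (cases "u = 0")
      case False
      then obtain p where p: "p < u" "p \<in> set (nb u)" using nb_parent less.prems by blast
      then have "(u, p) \<in> ?R" using less.prems by (simp add: edge_T)
      moreover have "(p, 0) \<in> ?R\<^sup>*" using less p by simp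
      ultimately show ?thesis by (rule converse_rtrancl_into_rtrancl)
    qed simp
  qed
  have "sym ?R" by (auto simp: sym_def insert_commute)
  then have "sym (?R\<^sup>*)" by (rule sym_rtrancl)
  then show ?thesis
    unfolding connected_graph_def using root by (meson lessThan_iff rtrancl_trans symD)
qed

lemma tree_T: "tree {..<n} T"
  unfolding tree_def using graph_T connected_T acyclic_T n_pos by auto

definition rot :: "nat \<Rightarrow> nat \<Rightarrow> nat" where "rot v = cyclic_next (nb v)"

lemma rot_cyclic: "v < n \<Longrightarrow> cyclic_perm_on (neighbors T v) (rot v)"
  using cyclic_perm_on_cyclic_next[OF nb_dist[of v]] by (simp add: rot_def neighbors_T)

text \<open>An executable search for the next leaf along the face walk, with a bound on the number
  of steps. A step is taken before the first test, so the starting leaf does not stop the search.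
  When the bound is exhausted the current vertex is returned, which may fail to be a leaf; the
  lemmas below therefore assume that the result is one.\<close>

fun walk :: "nat \<Rightarrow> nat \<times> nat \<Rightarrow> nat" where
  "walk 0 d = snd d"
| "walk (Suc k) d = (let d' = face_step rot d in if length (nb (snd d')) = 1 then snd d' else walk k d')"

lemma first_leaf_walk:
  assumes "leaf T (walk (Suc m) d)"
  shows "\<exists>k>0. snd ((face_step rot ^^ k) d) = walk (Suc m) d \<and>
    (\<forall>j. 0 < j \<and> j < k \<longrightarrow> \<not> leaf T (snd ((face_step rot ^^ j) d)))"
  using assms
proof (induction m arbitrary: d)
  case 0
  then show ?case by (intro exI[of _ 1]) (auto simp: Let_def)
next
  case (Suc m)
  let ?d = "face_step rot d"
  show ?case
  proof (cases "length (nb (snd ?d)) = 1")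
    case True
    then show ?thesis by (intro exI[of _ 1]) (auto simp: Let_def)
  next
    case False
    then have w: "walk (Suc (Suc m)) d = walk (Suc m) ?d" by (simp add: Let_def)
    have nl: "\<not> leaf T (snd ?d)" using False by (simp add: leaf_T)
    obtain k where k: "k > 0" "snd ((face_step rot ^^ k) ?d) = walk (Suc m) ?d"
      "\<forall>j. 0 < j \<and> j < k \<longrightarrow> \<not> leaf T (snd ((face_step rot ^^ j) ?d))"
      using Suc.IH[of ?d] Suc.prems w by auto
    have "\<not> leaf T (snd ((face_step rot ^^ j) d))" if j: "0 < j" "j < Suc k" for j
    proof (cases j)
      case (Suc i)
      then show ?thesis using k(3) nl j by (cases "i = 0") (auto simp: funpow_swap1)
    qed (use j in simp)
    then show ?thesis
      using k(2) w by (intro exI[of _ "Suc k"]) (auto simp: funpow_swap1)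
  qed
qed

text \<open>A leaf is entered by a single dart, from its only neighbour, so the choice of
  \<open>u\<close> in \<open>next_leaf\<close> is forced and the successor of a leaf is
  unique.\<close>

lemma next_leaf_walk:
  assumes a: "leaf T a" and w: "leaf T (walk (Suc m) (hd (nb a), a))"
  shows "next_leaf T rot a b \<longleftrightarrow> b = walk (Suc m) (hd (nb a), a)"
proof -
  have "a < n" "length (nb a) = 1" using a by (auto simp: leaf_T)
  then have nba: "nb a = [hd (nb a)]" by (cases "nb a") auto
  have u: "{u, a} \<in> T \<longleftrightarrow> u = hd (nb a)" for u
  proof -
    have "{u, a} \<in> T \<longleftrightarrow> u \<in> set (nb a)" using edge_T[of a u] \<open>a < n\<close> by (simp add: insert_commute)
    then show ?thesis by (subst (asm) nba) simp
  qed
  obtain k where k: "k > 0" "snd ((face_step rot ^^ k) (hd (nb a), a)) = walk (Suc m) (hd (nb a), a)"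
    "\<forall>j. 0 < j \<and> j < k \<longrightarrow> \<not> leaf T (snd ((face_step rot ^^ j) (hd (nb a), a)))"
    using first_leaf_walk[OF w] by blast
  show ?thesis
  proof
    assume "next_leaf T rot a b"
    then obtain k' where k': "leaf T b" "k' > 0" "snd ((face_step rot ^^ k') (hd (nb a), a)) = b"
      "\<forall>j. 0 < j \<and> j < k' \<longrightarrow> \<not> leaf T (snd ((face_step rot ^^ j) (hd (nb a), a)))"
      unfolding next_leaf_def u by blast
    \<comment> \<open>Both are the first positive time at which the walk stands on a leaf.\<close>
    have "k = k'" using k k' w by (metis linorder_neqE_nat)
    then show "b = walk (Suc m) (hd (nb a), a)" using k k' by simp
  next
    assume "b = walk (Suc m) (hd (nb a), a)"
    then show "next_leaf T rot a b" unfolding next_leaf_def u using a w k by blast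
  qed
qed

text \<open>The relation \<open>C\<close> stands for the rim in explicit form, so that an instance
  can supply a finite list; \<open>a \<noteq> b\<close> ensures that the rim adds no loops.\<close>

lemma halin:
  assumes n: "4 \<le> n" and deg: "\<And>v. v < n \<Longrightarrow> length (nb v) \<noteq> 2"
    and rim: "\<And>a b. next_leaf T rot a b \<longleftrightarrow> (a, b) \<in> C"
    and C: "\<And>a b. (a, b) \<in> C \<Longrightarrow> a < n \<and> b < n \<and> a \<noteq> b"
  shows "halin {..<n} (T \<union> {{a, b} | a b. (a, b) \<in> C})"
proof -
  have "graph {..<n} (T \<union> {{a, b} | a b. (a, b) \<in> C})"
    unfolding graph_def
  proof (intro conjI ballI)
    fix e assume "e \<in> T \<union> {{a, b} | a b. (a, b) \<in> C}"
    then consider "e \<in> T" | a b where "e = {a, b}" "(a, b) \<in> C" by blast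
    then show "\<exists>u v. e = {u, v} \<and> u \<noteq> v \<and> u \<in> {..<n} \<and> v \<in> {..<n}"
    proof cases
      case 1
      then show ?thesis using graph_T unfolding graph_def by blast
    next
      case 2
      then show ?thesis using C[of a b] by blast
    qed
  qed simp
  then show ?thesis
    unfolding halin_def
  proof (intro conjI exI)
    show "tree {..<n} T" by (rule tree_T)
    show "4 \<le> card {..<n}" using n by simp
    show "\<forall>v\<in>{..<n}. degree T v \<noteq> 2" using deg by (simp add: degree_T)
    show "\<forall>v\<in>{..<n}. cyclic_perm_on (neighbors T v) (rot v)" using rot_cyclic by simp
    show "T \<union> {{a, b} | a b. (a, b) \<in> C} = T \<union> {{a, b} | a b. next_leaf T rot a b}" by (simp add: rim)
  qed
qed

end

text \<open>Another core of the kind used for the X-tree. The hub 0 has index 0, and the three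
  digits in the name are the indices of its children 1, 11 and 21: here all three children share one
  track.\<close>

lemma halin_clauses_unsat_111:
  fixes col same before :: "nat \<Rightarrow> nat \<Rightarrow> bool"
  assumes fixed: "col 0 0 = True" "col 1 1 = True" "col 11 1 = True" "col 21 1 = True"
    and some: "\<forall>(v,is)\<in>set
      [(2,[0,2,3]), (3,[0,2,3]), (4,[0,2,3]), (5,[0,2,3]), (6,[0,1,2,3]), (7,[0,1,2,3]), (8,[0,2,3]),
      (9,[0,2,3]), (10,[0,2,3]), (12,[0,2,3]), (13,[0,2,3]), (14,[0,2,3]), (15,[0,2,3]),
      (16,[0,1,2,3]), (17,[0,1,2,3]), (18,[0,2,3]), (19,[0,2,3]), (20,[0,2,3]), (22,[0,2,3]),
      (23,[0,2,3]), (24,[0,2,3]), (25,[0,2,3]), (26,[0,1,2,3]), (27,[0,1,2,3]), (28,[0,2,3]),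
      (29,[0,2,3]), (30,[0,2,3])].
      \<exists>i\<in>set is. col v i"
    and proper: "\<forall>(u,v,i)\<in>set
      [(2,3,0), (2,3,2), (2,3,3), (3,4,2), (3,4,3), (4,6,2), (4,6,3), (5,6,2), (5,6,3), (5,7,2),
      (5,7,3), (6,7,0), (6,7,1), (6,7,2), (6,7,3), (7,8,2), (7,8,3), (8,9,2), (8,9,3), (9,10,0),
      (9,10,2), (9,10,3), (10,12,0), (10,12,2), (10,12,3), (12,13,0), (12,13,2), (12,13,3),
      (13,14,2), (13,14,3), (14,16,2), (14,16,3), (15,16,2), (15,16,3), (15,17,2), (15,17,3),
      (16,17,0), (16,17,1), (16,17,2), (16,17,3), (17,18,2), (17,18,3), (18,19,2), (18,19,3),
      (19,20,0), (19,20,2), (19,20,3), (20,22,0), (20,22,2), (20,22,3), (22,23,0), (22,23,2),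
      (22,23,3), (23,24,2), (23,24,3), (24,26,2), (24,26,3), (25,26,2), (25,26,3), (25,27,2),
      (25,27,3), (26,27,0), (26,27,1), (26,27,2), (26,27,3), (27,28,2), (27,28,3), (28,29,2),
      (28,29,3), (29,30,0), (29,30,2), (29,30,3), (30,2,0), (30,2,2), (30,2,3)].
      \<not> (col u i \<and> col v i)"
    and same: "\<forall>(u,v,i)\<in>set
      [(0,2,0), (0,3,0), (0,4,0), (0,5,0), (0,6,0), (0,7,0), (0,8,0), (0,9,0), (0,10,0), (0,12,0),
      (0,13,0), (0,14,0), (0,15,0), (0,16,0), (0,17,0), (0,18,0), (0,19,0), (0,20,0), (0,22,0),
      (0,23,0), (0,24,0), (0,25,0), (0,26,0), (0,27,0), (0,28,0), (0,29,0), (0,30,0), (1,6,1),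
      (1,7,1), (1,11,1), (1,16,1), (1,17,1), (1,21,1), (1,26,1), (1,27,1), (2,4,2), (2,4,3),
      (2,5,2), (2,5,3), (2,7,2), (2,7,3), (2,8,2), (2,8,3), (2,10,2), (2,10,3), (2,12,0),
      (2,12,2), (2,12,3), (2,13,2), (2,13,3), (2,14,2), (2,14,3), (2,15,2), (2,15,3), (2,16,0),
      (2,16,2), (2,16,3), (2,17,0), (2,17,2), (2,17,3), (2,18,2), (2,18,3), (2,19,2), (2,19,3),
      (2,20,0), (2,20,2), (2,20,3), (2,22,0), (2,22,2), (2,22,3), (2,23,2), (2,23,3), (2,26,0),
      (2,29,2), (2,29,3), (3,6,2), (3,6,3), (3,7,2), (3,7,3), (3,8,2), (3,8,3), (3,9,2), (3,9,3),
      (3,12,2), (3,12,3), (3,13,2), (3,13,3), (3,14,2), (3,14,3), (3,15,2), (3,15,3), (3,16,2),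
      (3,16,3), (3,17,2), (3,17,3), (3,18,2), (3,18,3), (3,20,2), (3,20,3), (3,22,2), (3,22,3),
      (3,23,2), (3,23,3), (3,30,2), (3,30,3), (4,5,2), (4,5,3), (4,7,2), (4,7,3), (4,8,2),
      (4,8,3), (4,9,2), (4,9,3), (4,10,2), (4,10,3), (4,19,2), (4,19,3), (4,20,2), (4,20,3),
      (4,22,2), (4,22,3), (4,23,2), (4,23,3), (5,8,2), (5,8,3), (5,10,2), (5,10,3), (5,19,2),
      (5,19,3), (5,20,2), (5,20,3), (5,22,2), (5,22,3), (5,23,2), (5,23,3), (6,8,2), (6,8,3),
      (6,9,2), (6,9,3), (6,11,1), (6,12,0), (6,19,2), (6,19,3), (6,20,0), (6,20,2), (6,20,3),
      (6,21,1), (6,22,0), (6,22,2), (6,22,3), (6,23,2), (6,23,3), (7,9,2), (7,9,3), (7,11,1),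
      (7,19,2), (7,19,3), (7,20,0), (7,20,2), (7,20,3), (7,21,1), (7,22,0), (7,22,2), (7,22,3),
      (7,23,2), (7,23,3), (7,30,0), (8,10,2), (8,10,3), (8,19,2), (8,19,3), (8,20,2), (8,20,3),
      (8,22,2), (8,22,3), (8,23,2), (8,23,3), (9,12,2), (9,12,3), (9,19,2), (9,19,3), (9,20,2),
      (9,20,3), (9,24,2), (9,24,3), (9,25,2), (9,25,3), (9,26,2), (9,26,3), (9,27,2), (9,27,3),
      (9,28,2), (9,28,3), (9,29,2), (9,29,3), (9,30,2), (9,30,3), (10,13,2), (10,13,3), (10,17,0),
      (10,19,2), (10,19,3), (10,20,0), (10,22,0), (10,23,2), (10,23,3), (10,24,2), (10,24,3),
      (10,25,2), (10,25,3), (10,26,0), (10,26,2), (10,26,3), (10,27,0), (10,27,2), (10,27,3),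
      (10,28,2), (10,28,3), (10,29,2), (10,29,3), (10,30,0), (10,30,2), (10,30,3), (11,16,1),
      (11,17,1), (11,21,1), (11,26,1), (11,27,1), (12,14,2), (12,14,3), (12,15,2), (12,15,3),
      (12,17,2), (12,17,3), (12,18,2), (12,18,3), (12,20,2), (12,20,3), (12,22,2), (12,22,3),
      (12,23,2), (12,23,3), (12,24,2), (12,24,3), (12,25,2), (12,25,3), (12,26,0), (12,26,2),
      (12,26,3), (12,27,0), (12,27,2), (12,27,3), (12,28,2), (12,28,3), (12,29,2), (12,29,3),
      (12,30,0), (12,30,2), (12,30,3), (13,16,2), (13,16,3), (13,17,2), (13,17,3), (13,18,2),
      (13,18,3), (13,19,2), (13,19,3), (13,22,2), (13,22,3), (13,23,2), (13,23,3), (13,24,2),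
      (13,24,3), (13,25,2), (13,25,3), (13,26,2), (13,26,3), (13,27,2), (13,27,3), (13,28,2),
      (13,28,3), (13,30,2), (13,30,3), (14,15,2), (14,15,3), (14,19,2), (14,19,3), (14,20,2),
      (14,20,3), (14,29,2), (14,29,3), (14,30,2), (14,30,3), (15,18,2), (15,18,3), (15,20,2),
      (15,20,3), (15,29,2), (15,29,3), (15,30,2), (15,30,3), (16,18,2), (16,18,3), (16,19,2),
      (16,19,3), (16,21,1), (16,22,0), (16,29,2), (16,29,3), (16,30,0), (16,30,2), (16,30,3),
      (17,19,2), (17,19,3), (17,21,1), (17,29,2), (17,29,3), (17,30,0), (17,30,2), (17,30,3),
      (18,20,2), (18,20,3), (18,29,2), (18,29,3), (18,30,2), (18,30,3), (19,22,2), (19,22,3),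
      (19,29,2), (19,29,3), (19,30,2), (19,30,3), (20,23,2), (20,23,3), (20,27,0), (20,29,2),
      (20,29,3), (20,30,2), (20,30,3), (21,26,1), (21,27,1), (22,24,2), (22,24,3), (22,25,2),
      (22,25,3), (22,28,2), (22,28,3), (22,30,2), (22,30,3), (23,26,2), (23,26,3), (23,27,2),
      (23,27,3), (23,28,2), (23,28,3), (23,29,2), (23,29,3), (24,25,2), (24,25,3), (24,27,2),
      (24,27,3), (24,29,2), (24,29,3), (24,30,2), (24,30,3), (25,28,2), (25,28,3), (25,30,2),
      (25,30,3), (26,28,2), (26,29,2), (26,29,3), (26,30,3), (27,29,2), (27,29,3), (28,30,2),
      (28,30,3)].
      col u i \<longrightarrow> col v i \<longrightarrow> same u v"
    and cross: "\<forall>(u,v,x,y)\<in>set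
      [(0,1,12,11), (0,1,13,11), (0,1,14,11), (0,1,15,11), (0,1,16,17), (0,1,17,16), (0,1,18,11),
      (0,1,19,11), (0,1,20,11), (0,1,22,21), (0,1,23,21), (0,1,24,21), (0,1,25,21), (0,1,26,27),
      (0,1,27,26), (0,1,28,21), (0,1,29,21), (0,1,30,21), (0,11,16,17), (0,11,17,16),
      (0,11,22,21), (0,11,23,21), (0,11,24,21), (0,11,25,21), (0,11,26,27), (0,11,27,26),
      (0,11,28,21), (0,11,29,21), (0,11,30,21), (0,21,26,27), (0,21,27,26), (1,2,6,7),
      (1,2,11,12), (1,2,11,13), (1,2,11,14), (1,2,11,15), (1,2,11,18), (1,2,11,19), (1,2,11,20),
      (1,2,16,14), (1,2,16,17), (1,2,17,16), (1,2,17,18), (1,2,21,22), (1,2,21,23), (1,2,21,29),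
      (1,3,7,8), (1,3,11,12), (1,3,11,13), (1,3,11,14), (1,3,11,15), (1,3,11,18), (1,3,11,20),
      (1,3,16,14), (1,3,17,18), (1,3,21,22), (1,3,21,23), (1,3,21,30), (1,4,6,5), (1,4,6,7),
      (1,4,11,19), (1,4,11,20), (1,4,21,22), (1,4,21,23), (1,5,7,8), (1,5,11,19), (1,5,11,20),
      (1,5,21,22), (1,5,21,23), (1,8,11,19), (1,8,11,20), (1,8,21,22), (1,8,21,23), (1,9,11,12),
      (1,9,11,19), (1,9,11,20), (1,9,21,24), (1,9,21,25), (1,9,21,28), (1,9,21,29), (1,9,21,30),
      (1,9,26,24), (1,9,27,28), (1,10,11,13), (1,10,11,19), (1,10,11,20), (1,10,21,22),
      (1,10,21,23), (1,10,21,24), (1,10,21,25), (1,10,21,28), (1,10,21,29), (1,10,21,30),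
      (1,10,26,24), (1,10,26,27), (1,10,27,26), (1,10,27,28), (2,3,4,6), (2,3,5,6), (2,3,7,8),
      (2,3,8,7), (2,3,8,9), (2,3,10,9), (2,3,10,12), (2,3,16,14), (2,3,16,17), (2,3,17,16),
      (2,3,17,18), (2,3,20,22), (2,3,22,20), (3,2,15,16), (3,2,15,17), (3,4,8,7), (3,4,8,9),
      (3,4,9,8), (3,4,9,10), (3,4,12,10), (3,4,22,20), (4,6,8,9), (4,6,9,8), (4,6,10,9),
      (4,6,10,12), (4,6,19,20), (4,6,20,22), (4,6,22,20), (4,6,23,22), (5,6,10,12), (5,6,19,20),
      (5,6,20,22), (5,6,22,20), (5,6,23,22), (5,7,10,9), (5,7,19,20), (5,7,20,22), (5,7,22,20),
      (5,7,23,22), (6,4,11,19), (6,4,11,20), (6,4,21,22), (6,4,21,23), (6,7,11,20), (6,7,19,20),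
      (6,7,20,19), (6,7,20,22), (6,7,21,22), (6,7,22,20), (6,7,22,23), (6,7,23,22), (7,6,11,20),
      (7,6,21,22), (7,8,9,10), (7,8,11,19), (7,8,11,20), (7,8,20,19), (7,8,20,22), (7,8,21,22),
      (7,8,21,23), (7,8,22,20), (7,8,22,23), (8,9,10,12), (9,10,24,26), (9,10,25,26),
      (9,10,25,27), (9,10,26,27), (9,10,27,26), (9,10,28,27), (10,12,13,14), (10,12,17,18),
      (10,12,19,18), (10,12,19,20), (10,12,20,22), (10,12,22,20), (10,12,23,24), (10,12,24,23),
      (10,12,24,26), (10,12,25,26), (10,12,25,27), (10,12,26,24), (10,12,26,27), (10,12,27,26),
      (10,12,27,28), (10,12,28,27), (10,12,28,29), (10,12,29,30), (11,12,16,14), (11,12,16,17),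
      (11,12,21,22), (11,12,21,23), (11,12,21,24), (11,12,21,25), (11,12,21,28), (11,12,21,29),
      (11,12,21,30), (11,12,26,24), (11,12,26,27), (11,12,27,26), (11,12,27,28), (11,13,17,18),
      (11,13,21,22), (11,13,21,23), (11,13,21,24), (11,13,21,25), (11,13,21,28), (11,13,21,30),
      (11,13,26,24), (11,13,27,28), (11,14,16,15), (11,14,21,29), (11,14,21,30), (11,15,17,18),
      (11,15,21,29), (11,15,21,30), (11,18,21,29), (11,18,21,30), (11,19,21,22), (11,19,21,29),
      (11,19,21,30), (11,20,21,23), (11,20,21,29), (11,20,21,30), (12,10,15,17), (12,10,25,26),
      (12,10,25,27), (12,13,14,16), (12,13,15,16), (12,13,17,18), (12,13,18,17), (12,13,18,19),
      (12,13,20,19), (12,13,26,24), (12,13,26,27), (12,13,27,26), (12,13,27,28), (13,12,25,26),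
      (13,12,25,27), (13,14,18,19), (13,14,19,20), (13,14,22,20), (14,16,19,18), (14,16,20,19),
      (14,16,20,22), (14,16,29,30), (15,16,20,22), (15,16,29,30), (15,17,20,19), (15,17,29,30),
      (16,14,21,29), (16,14,21,30), (16,17,21,30), (16,17,29,30), (16,17,30,29), (17,16,21,30),
      (17,18,19,20), (17,18,21,29), (17,18,21,30), (17,18,30,29), (18,19,20,22), (20,22,23,24),
      (20,22,27,28), (20,22,29,28), (20,22,29,30), (21,22,26,24), (21,23,27,28), (21,24,26,25),
      (21,24,26,27), (21,25,27,28), (22,20,25,27), (22,23,24,26), (22,23,25,26), (22,23,28,27),
      (22,23,28,29), (22,23,30,29), (23,24,28,27), (23,24,28,29), (23,24,29,30), (24,26,29,28),
      (24,26,29,30), (24,26,30,29), (25,27,30,29), (27,28,29,30)].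
      same u x \<longrightarrow> same v y \<longrightarrow> (before u x \<longleftrightarrow> before v y)"
    and cross_flip: "\<forall>(u,v,x,y)\<in>set
      [(0,11,6,7), (0,11,7,6), (0,21,6,7), (0,21,7,6), (0,21,16,17), (0,21,17,16), (1,2,11,0),
      (1,2,21,0), (1,3,11,0), (1,3,21,0), (1,4,11,0), (1,4,21,0), (1,5,6,4), (1,5,11,0),
      (1,5,21,0), (1,8,7,6), (1,8,11,0), (1,8,21,0), (1,9,6,4), (1,9,11,0), (1,9,21,0),
      (1,10,11,0), (1,10,21,0), (2,30,5,7), (2,30,8,9), (2,30,10,12), (2,30,12,13), (2,30,14,16),
      (2,30,15,16), (2,30,15,17), (2,30,16,17), (2,30,17,18), (2,30,18,19), (2,30,20,22),
      (2,30,23,24), (3,4,30,2), (5,7,8,1), (7,8,30,2), (9,10,30,2), (10,12,30,2), (11,12,21,0),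
      (11,13,21,0), (11,14,21,0), (11,15,16,14), (11,15,21,0), (11,18,17,16), (11,18,21,0),
      (11,19,16,14), (11,19,21,0), (11,20,17,18), (11,20,21,0), (12,13,30,2), (14,16,30,2),
      (15,16,30,2), (15,17,18,11), (15,17,30,2), (16,17,30,2), (17,18,30,2), (18,19,30,2),
      (20,22,30,2), (21,25,26,24), (21,28,27,26), (21,29,26,24), (21,30,27,26), (21,30,27,28),
      (24,26,30,2), (25,26,30,2), (25,27,28,21), (28,29,30,2)].
      same u x \<longrightarrow> same y v \<longrightarrow> (before u x \<longleftrightarrow> \<not> before y v)"
    and trans: "\<forall>(u,v,w)\<in>set
      [(1,11,21), (2,13,16), (2,13,17), (3,6,22), (3,6,23), (3,7,22), (3,7,23), (3,13,16), (3,13,17),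
      (6,9,19), (6,9,20), (7,9,19), (7,9,20), (9,26,29), (9,27,29), (10,26,29), (10,27,29),
      (12,23,26), (12,23,27), (13,23,26), (13,23,27), (16,19,29), (16,19,30), (17,19,29),
      (17,19,30)].
      before u v \<longrightarrow> before v w \<longrightarrow> before u w"
    and negtrans: "\<forall>(u,v,w)\<in>set
      [(1,11,21), (2,13,16), (2,13,17), (3,6,22), (3,6,23), (3,7,22), (3,7,23), (3,13,16), (3,13,17),
      (6,9,19), (6,9,20), (7,9,19), (7,9,20), (9,26,29), (9,27,29), (10,26,29), (10,27,29),
      (12,23,26), (12,23,27), (13,23,26), (13,23,27), (16,19,29), (16,19,30), (17,19,29),
      (17,19,30)].
      before u w \<longrightarrow> before u v \<or> before v w"
  shows False
  using some proper same cross cross_flip trans negtrans [[argo_timeout = 1000]]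
  unfolding list.set ball_simps bex_simps prod.case fixed simp_thms
  by (elim conjE) argo

text \<open>The case in which the first two children of the hub share a track and the third has
  another one.\<close>

lemma halin_clauses_unsat_112:
  fixes col same before :: "nat \<Rightarrow> nat \<Rightarrow> bool"
  assumes fixed: "col 0 0 = True" "col 1 1 = True" "col 11 1 = True" "col 21 2 = True"
    and some: "\<forall>(v,is)\<in>set
      [(2,[0,2,3]), (3,[0,2,3]), (4,[0,2,3]), (5,[0,2,3]), (6,[0,1,2,3]), (7,[0,1,2,3]), (8,[0,2,3]),
      (9,[0,2,3]), (10,[0,2,3]), (12,[0,2,3]), (13,[0,2,3]), (14,[0,2,3]), (15,[0,2,3]),
      (16,[0,1,2,3]), (17,[0,1,2,3]), (18,[0,2,3]), (19,[0,2,3]), (20,[0,2,3]), (22,[0,1,3]),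
      (23,[0,1,3]), (24,[0,1,3]), (25,[0,1,3]), (26,[0,1,2,3]), (27,[0,1,2,3]), (28,[0,1,3]),
      (29,[0,1,3]), (30,[0,1,3])].
      \<exists>i\<in>set is. col v i"
    and proper: "\<forall>(u,v,i)\<in>set
      [(2,3,0), (2,3,2), (2,3,3), (3,4,0), (3,4,2), (3,4,3), (4,6,0), (4,6,2), (4,6,3), (5,6,0),
      (5,6,2), (5,6,3), (5,7,0), (5,7,2), (5,7,3), (6,7,0), (6,7,1), (6,7,2), (6,7,3), (7,8,0),
      (7,8,2), (7,8,3), (8,9,0), (8,9,2), (8,9,3), (9,10,0), (9,10,2), (9,10,3), (10,12,0),
      (10,12,2), (10,12,3), (12,13,0), (12,13,2), (12,13,3), (13,14,0), (13,14,2), (13,14,3),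
      (14,16,0), (14,16,2), (14,16,3), (15,16,0), (15,16,2), (15,16,3), (15,17,0), (15,17,2),
      (15,17,3), (16,17,0), (16,17,1), (16,17,2), (16,17,3), (17,18,0), (17,18,2), (17,18,3),
      (18,19,0), (18,19,2), (18,19,3), (19,20,0), (19,20,2), (19,20,3), (20,22,0), (20,22,3),
      (22,23,0), (22,23,1), (22,23,3), (23,24,0), (23,24,1), (23,24,3), (24,26,0), (24,26,1),
      (24,26,3), (25,26,0), (25,26,1), (25,26,3), (25,27,0), (25,27,1), (25,27,3), (26,27,0),
      (26,27,1), (26,27,2), (26,27,3), (27,28,0), (27,28,1), (27,28,3), (28,29,0), (28,29,1),
      (28,29,3), (29,30,0), (29,30,1), (29,30,3), (30,2,0), (30,2,3)].
      \<not> (col u i \<and> col v i)"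
    and same: "\<forall>(u,v,i)\<in>set
      [(0,2,0), (0,3,0), (0,4,0), (0,5,0), (0,6,0), (0,7,0), (0,8,0), (0,9,0), (0,10,0), (0,12,0),
      (0,13,0), (0,14,0), (0,15,0), (0,16,0), (0,17,0), (0,18,0), (0,19,0), (0,20,0), (0,22,0),
      (0,23,0), (0,24,0), (0,25,0), (0,26,0), (0,27,0), (0,28,0), (0,29,0), (0,30,0), (1,6,1),
      (1,7,1), (1,11,1), (1,16,1), (1,17,1), (1,22,1), (1,23,1), (1,24,1), (1,25,1), (1,26,1),
      (1,27,1), (1,28,1), (1,29,1), (1,30,1), (2,4,0), (2,4,2), (2,4,3), (2,5,0), (2,5,2),
      (2,5,3), (2,7,2), (2,7,3), (2,8,0), (2,8,2), (2,8,3), (2,9,2), (2,9,3), (2,10,0), (2,10,2),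
      (2,10,3), (2,12,0), (2,12,2), (2,12,3), (2,13,0), (2,13,2), (2,13,3), (2,14,0), (2,14,2),
      (2,14,3), (2,15,2), (2,15,3), (2,16,0), (2,16,2), (2,16,3), (2,17,0), (2,17,2), (2,17,3),
      (2,18,0), (2,18,2), (2,18,3), (2,19,0), (2,19,2), (2,19,3), (2,20,0), (2,20,2), (2,20,3),
      (2,21,2), (2,22,0), (2,22,3), (2,23,0), (2,23,3), (2,24,0), (2,24,3), (2,25,0), (2,25,3),
      (2,26,0), (2,26,2), (2,26,3), (2,27,0), (2,27,2), (2,27,3), (2,29,0), (2,29,3), (3,6,0),
      (3,6,2), (3,6,3), (3,7,0), (3,7,2), (3,7,3), (3,8,0), (3,8,2), (3,8,3), (3,9,0), (3,9,2),
      (3,9,3), (3,10,0), (3,10,2), (3,10,3), (3,12,0), (3,12,2), (3,12,3), (3,13,2), (3,13,3),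
      (3,14,2), (3,14,3), (3,15,2), (3,15,3), (3,16,2), (3,16,3), (3,17,2), (3,17,3), (3,18,2),
      (3,18,3), (3,19,3), (3,20,0), (3,20,2), (3,20,3), (3,21,2), (3,22,0), (3,22,3), (3,23,0),
      (3,23,3), (3,24,0), (3,24,3), (3,25,0), (3,25,3), (3,26,0), (3,26,2), (3,26,3), (3,27,0),
      (3,27,3), (3,28,0), (3,28,3), (3,29,0), (3,29,3), (3,30,0), (3,30,3), (4,5,2), (4,5,3),
      (4,8,2), (4,8,3), (4,9,2), (4,9,3), (4,10,2), (4,10,3), (4,19,2), (4,19,3), (4,20,0),
      (4,20,2), (4,20,3), (4,21,2), (4,22,0), (4,22,3), (4,23,0), (4,23,3), (4,29,0), (4,29,3),
      (5,8,0), (5,8,2), (5,8,3), (5,10,2), (5,10,3), (5,19,2), (5,19,3), (5,20,0), (5,20,2),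
      (5,20,3), (5,21,2), (5,22,0), (5,22,3), (5,29,0), (5,29,3), (5,30,0), (5,30,3), (6,8,2),
      (6,8,3), (6,9,0), (6,9,2), (6,9,3), (6,11,1), (6,12,0), (6,12,2), (6,19,2), (6,19,3),
      (6,20,0), (6,20,2), (6,20,3), (6,21,2), (6,22,0), (6,22,3), (6,23,0), (6,23,3), (6,29,0),
      (6,29,3), (6,30,0), (6,30,1), (6,30,3), (7,9,0), (7,9,2), (7,9,3), (7,11,1), (7,19,2),
      (7,19,3), (7,20,0), (7,20,2), (7,20,3), (7,21,2), (7,22,0), (7,22,3), (7,23,1), (7,23,3),
      (7,29,0), (7,29,1), (7,29,3), (7,30,0), (7,30,3), (8,10,0), (8,10,2), (8,10,3), (8,19,2),
      (8,19,3), (8,20,0), (8,20,2), (8,20,3), (8,21,2), (8,22,0), (8,22,3), (8,23,3), (8,29,0),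
      (8,30,0), (8,30,3), (9,12,0), (9,12,2), (9,12,3), (9,19,2), (9,19,3), (9,20,0), (9,20,2),
      (9,20,3), (9,21,2), (9,22,0), (9,22,3), (9,23,3), (9,28,0), (9,28,3), (9,29,0), (9,29,3),
      (9,30,0), (9,30,3), (10,13,0), (10,13,2), (10,13,3), (10,17,0), (10,17,2), (10,19,0),
      (10,19,2), (10,19,3), (10,20,0), (10,20,2), (10,20,3), (10,21,2), (10,22,0), (10,22,3),
      (10,23,0), (10,23,3), (10,24,0), (10,24,3), (10,27,0), (10,27,3), (10,28,0), (10,28,3),
      (10,29,0), (10,29,3), (10,30,0), (10,30,3), (11,16,1), (11,17,1), (11,22,1), (11,23,1),
      (11,24,1), (11,25,1), (11,26,1), (11,27,1), (11,28,1), (11,29,1), (11,30,1), (12,14,0),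
      (12,14,2), (12,14,3), (12,15,2), (12,15,3), (12,18,2), (12,18,3), (12,19,0), (12,19,2),
      (12,19,3), (12,20,0), (12,20,2), (12,20,3), (12,21,2), (12,22,0), (12,22,3), (12,23,0),
      (12,23,3), (12,24,0), (12,24,3), (12,26,0), (12,26,2), (12,26,3), (12,27,3), (12,28,0),
      (12,28,3), (12,29,0), (12,29,3), (12,30,0), (12,30,3), (13,16,0), (13,16,2), (13,16,3),
      (13,17,0), (13,17,2), (13,17,3), (13,18,0), (13,18,2), (13,18,3), (13,19,0), (13,19,2),
      (13,19,3), (13,20,0), (13,20,2), (13,20,3), (13,21,2), (13,22,0), (13,22,3), (13,23,3),
      (13,24,0), (13,24,3), (13,29,3), (13,30,0), (13,30,3), (14,15,0), (14,15,2), (14,15,3),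
      (14,17,2), (14,17,3), (14,18,2), (14,18,3), (14,19,0), (14,19,2), (14,19,3), (14,20,0),
      (14,20,2), (14,20,3), (14,21,2), (14,22,0), (14,22,3), (14,23,0), (14,23,3), (14,29,3),
      (14,30,0), (14,30,3), (15,18,2), (15,18,3), (15,20,0), (15,20,2), (15,20,3), (15,21,2),
      (15,22,0), (15,22,3), (15,23,0), (15,23,3), (15,30,0), (15,30,3), (16,18,2), (16,19,0),
      (16,19,2), (16,19,3), (16,20,0), (16,20,2), (16,20,3), (16,21,2), (16,22,0), (16,22,1),
      (16,22,3), (16,23,0), (16,23,1), (16,23,3), (16,29,1), (16,30,0), (16,30,3), (17,19,0),
      (17,19,2), (17,19,3), (17,21,2), (17,22,0), (17,22,1), (17,22,3), (17,23,0), (17,23,3),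
      (17,29,0), (17,29,3), (17,30,0), (17,30,1), (17,30,3), (18,20,0), (18,20,2), (18,20,3),
      (18,21,2), (18,23,0), (18,23,3), (18,29,0), (18,29,3), (18,30,0), (18,30,3), (19,21,2),
      (19,22,0), (19,22,3), (19,23,0), (19,23,3), (19,24,0), (19,24,3), (19,25,0), (19,25,3),
      (19,26,0), (19,26,3), (19,27,0), (19,27,2), (19,27,3), (19,28,0), (19,28,3), (19,29,0),
      (19,29,3), (19,30,0), (19,30,3), (20,21,2), (20,23,0), (20,23,3), (20,25,0), (20,25,3),
      (20,26,0), (20,26,2), (20,26,3), (20,27,0), (20,27,2), (20,27,3), (20,28,0), (20,28,3),
      (20,29,0), (20,29,3), (20,30,0), (20,30,3), (21,26,2), (21,27,2), (22,24,0), (22,24,1),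
      (22,24,3), (22,25,0), (22,25,1), (22,25,3), (22,27,0), (22,27,1), (22,27,3), (22,28,0),
      (22,28,1), (22,28,3), (22,29,0), (22,29,1), (22,29,3), (22,30,0), (22,30,1), (22,30,3),
      (23,25,3), (23,26,0), (23,26,1), (23,26,3), (23,27,0), (23,27,1), (23,27,3), (23,28,0),
      (23,28,1), (23,28,3), (23,29,0), (23,29,1), (23,29,3), (23,30,0), (23,30,1), (23,30,3),
      (24,25,0), (24,25,1), (24,25,3), (24,27,0), (24,27,1), (24,27,3), (24,28,0), (24,28,1),
      (24,28,3), (24,29,0), (24,29,1), (24,29,3), (24,30,0), (24,30,1), (24,30,3), (25,28,0),
      (25,28,1), (25,28,3), (25,30,0), (25,30,3), (26,28,1), (26,29,0), (26,29,1), (26,29,3),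
      (26,30,0), (26,30,1), (26,30,3), (27,29,0), (27,29,1), (27,29,3), (28,30,0), (28,30,1),
      (28,30,3)].
      col u i \<longrightarrow> col v i \<longrightarrow> same u v"
    and cross: "\<forall>(u,v,x,y)\<in>set
      [(0,1,2,30), (0,1,4,6), (0,1,5,6), (0,1,5,7), (0,1,6,7), (0,1,7,6), (0,1,8,7), (0,1,12,11),
      (0,1,13,11), (0,1,14,11), (0,1,15,11), (0,1,16,17), (0,1,17,16), (0,1,18,11), (0,1,18,17),
      (0,1,19,11), (0,1,20,11), (0,1,22,23), (0,1,23,22), (0,1,23,24), (0,1,24,23), (0,1,24,26),
      (0,1,25,26), (0,1,25,27), (0,1,26,24), (0,1,26,25), (0,1,26,27), (0,1,27,25), (0,1,27,26),
      (0,1,27,28), (0,1,28,27), (0,1,28,29), (0,1,29,28), (0,1,29,30), (0,1,30,29), (0,11,14,16),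
      (0,11,15,16), (0,11,15,17), (0,11,16,17), (0,11,17,16), (0,11,18,17), (0,11,20,22),
      (0,11,22,23), (0,11,23,22), (0,11,23,24), (0,11,24,23), (0,11,24,26), (0,11,25,26),
      (0,11,25,27), (0,11,26,24), (0,11,26,25), (0,11,26,27), (0,11,27,25), (0,11,27,26),
      (0,11,27,28), (0,11,28,27), (0,11,28,29), (0,11,29,28), (0,11,29,30), (0,11,30,29),
      (0,21,24,26), (0,21,25,26), (0,21,25,27), (0,21,26,27), (0,21,27,26), (0,21,28,27),
      (1,2,6,4), (1,2,6,7), (1,2,7,5), (1,2,7,8), (1,2,11,12), (1,2,11,13), (1,2,11,14),
      (1,2,11,15), (1,2,11,18), (1,2,11,19), (1,2,11,20), (1,2,16,14), (1,2,16,15), (1,2,16,17),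
      (1,2,17,15), (1,2,17,16), (1,2,17,18), (1,2,22,20), (1,2,22,21), (1,2,22,23), (1,2,23,21),
      (1,2,23,22), (1,2,23,24), (1,2,24,21), (1,2,24,23), (1,2,24,26), (1,2,25,21), (1,2,25,26),
      (1,2,25,27), (1,2,26,24), (1,2,26,27), (1,2,27,25), (1,2,27,26), (1,2,28,21), (1,2,28,27),
      (1,2,28,29), (1,2,29,21), (1,2,30,21), (1,2,30,29), (1,3,6,7), (1,3,7,6), (1,3,7,8),
      (1,3,11,12), (1,3,11,13), (1,3,11,14), (1,3,11,15), (1,3,11,18), (1,3,11,19), (1,3,11,20),
      (1,3,16,14), (1,3,17,18), (1,3,22,20), (1,3,22,21), (1,3,22,23), (1,3,23,21), (1,3,23,22),
      (1,3,24,21), (1,3,24,23), (1,3,24,26), (1,3,25,21), (1,3,26,24), (1,3,26,25), (1,3,26,27),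
      (1,3,27,25), (1,3,27,26), (1,3,27,28), (1,3,28,21), (1,3,29,21), (1,3,29,28), (1,3,29,30),
      (1,3,30,21), (1,3,30,29), (1,4,6,5), (1,4,11,19), (1,4,11,20), (1,4,22,20), (1,4,22,21),
      (1,4,22,23), (1,4,23,21), (1,4,23,22), (1,4,30,21), (1,4,30,29), (1,5,7,8), (1,5,11,19),
      (1,5,11,20), (1,5,22,20), (1,5,22,21), (1,5,23,21), (1,5,23,22), (1,5,29,21), (1,5,29,30),
      (1,5,30,21), (1,5,30,29), (1,8,11,19), (1,8,11,20), (1,8,22,20), (1,8,22,21), (1,8,23,21),
      (1,8,23,22), (1,8,29,21), (1,8,29,30), (1,8,30,21), (1,8,30,29), (1,9,11,12), (1,9,11,19),
      (1,9,11,20), (1,9,22,20), (1,9,22,21), (1,9,22,23), (1,9,23,21), (1,9,23,22), (1,9,24,21),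
      (1,9,25,21), (1,9,27,28), (1,9,28,29), (1,9,29,21), (1,9,29,30), (1,9,30,21), (1,9,30,29),
      (1,10,11,13), (1,10,11,19), (1,10,11,20), (1,10,22,20), (1,10,22,21), (1,10,22,23),
      (1,10,23,21), (1,10,23,22), (1,10,23,24), (1,10,24,21), (1,10,24,23), (1,10,25,21),
      (1,10,25,27), (1,10,26,24), (1,10,26,27), (1,10,27,28), (1,10,28,21), (1,10,28,29),
      (1,10,29,21), (1,10,29,30), (1,10,30,21), (1,10,30,29), (2,3,4,6), (2,3,5,7), (2,3,7,8),
      (2,3,8,7), (2,3,8,9), (2,3,9,8), (2,3,9,10), (2,3,10,9), (2,3,10,12), (2,3,12,10),
      (2,3,16,14), (2,3,16,17), (2,3,17,16), (2,3,17,18), (2,3,20,22), (2,3,21,22), (2,3,21,23),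
      (2,3,21,24), (2,3,21,25), (2,3,21,28), (2,3,21,29), (2,3,21,30), (2,3,22,20), (2,3,22,23),
      (2,3,23,22), (2,3,23,24), (2,3,24,23), (2,3,24,26), (2,3,25,26), (2,3,27,28), (2,3,29,28),
      (2,3,29,30), (3,2,15,16), (3,2,15,17), (3,2,21,22), (3,2,21,23), (3,2,21,24), (3,2,21,25),
      (3,2,21,29), (3,4,7,8), (3,4,8,9), (3,4,9,8), (3,4,9,10), (3,4,10,9), (3,4,12,10),
      (3,4,20,22), (3,4,21,22), (3,4,21,29), (3,4,22,20), (3,4,22,23), (3,4,23,22), (3,4,30,29),
      (4,3,21,22), (4,3,21,23), (4,3,21,30), (4,6,8,9), (4,6,9,8), (4,6,10,9), (4,6,10,12),
      (4,6,19,20), (4,6,20,22), (4,6,21,22), (4,6,22,20), (4,6,22,23), (4,6,23,22), (4,6,29,30),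
      (5,6,10,12), (5,6,19,20), (5,6,20,11), (5,6,20,22), (5,6,21,22), (5,6,21,23), (5,6,21,30),
      (5,6,22,20), (5,6,22,21), (5,6,29,21), (5,6,30,21), (5,7,10,9), (5,7,19,20), (5,7,20,11),
      (5,7,20,22), (5,7,21,22), (5,7,22,20), (5,7,22,21), (5,7,29,21), (6,4,11,19), (6,4,11,20),
      (6,4,21,22), (6,4,21,23), (6,4,21,29), (6,7,11,20), (6,7,19,20), (6,7,20,19), (6,7,20,22),
      (6,7,21,22), (6,7,21,23), (6,7,21,29), (6,7,21,30), (6,7,22,20), (6,7,22,23), (6,7,30,29),
      (7,6,11,20), (7,6,21,22), (7,6,21,23), (7,6,21,29), (7,6,21,30), (7,8,9,10), (7,8,11,19),
      (7,8,11,20), (7,8,20,19), (7,8,20,22), (7,8,21,22), (7,8,21,23), (7,8,21,29), (7,8,21,30),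
      (7,8,22,20), (7,8,22,23), (7,8,29,30), (8,7,21,22), (8,7,21,23), (8,7,21,29), (8,9,10,12),
      (8,9,20,22), (8,9,21,22), (8,9,21,23), (8,9,21,29), (8,9,21,30), (8,9,22,20), (8,9,22,23),
      (8,9,23,22), (9,8,21,22), (9,8,21,23), (9,10,20,22), (9,10,21,22), (9,10,21,23),
      (9,10,21,24), (9,10,21,28), (9,10,21,29), (9,10,21,30), (9,10,22,20), (9,10,22,23),
      (9,10,23,22), (9,10,23,24), (9,10,28,29), (9,10,29,28), (9,10,29,30), (9,10,30,29),
      (10,9,21,22), (10,9,21,23), (10,9,21,30), (10,12,13,14), (10,12,17,18), (10,12,19,18),
      (10,12,19,20), (10,12,20,19), (10,12,20,22), (10,12,21,22), (10,12,21,23), (10,12,21,24),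
      (10,12,21,28), (10,12,21,29), (10,12,21,30), (10,12,22,20), (10,12,22,23), (10,12,23,22),
      (10,12,23,24), (10,12,24,23), (10,12,24,26), (10,12,27,28), (10,12,28,27), (10,12,28,29),
      (10,12,29,28), (10,12,29,30), (10,12,30,29), (11,12,16,14), (11,12,17,18), (11,12,22,20),
      (11,12,22,21), (11,12,22,23), (11,12,23,21), (11,12,23,22), (11,12,24,21), (11,12,24,23),
      (11,12,24,26), (11,12,26,24), (11,12,26,27), (11,12,27,26), (11,12,27,28), (11,12,28,21),
      (11,12,28,29), (11,12,29,21), (11,12,29,28), (11,12,29,30), (11,12,30,21), (11,12,30,29),
      (11,13,16,17), (11,13,17,16), (11,13,17,18), (11,13,22,20), (11,13,22,21), (11,13,23,21),
      (11,13,23,22), (11,13,24,23), (11,13,26,24), (11,13,29,21), (11,13,29,30), (11,13,30,21),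
      (11,13,30,29), (11,14,16,15), (11,14,16,17), (11,14,17,18), (11,14,22,20), (11,14,22,21),
      (11,14,22,23), (11,14,23,21), (11,14,23,22), (11,14,29,21), (11,14,29,30), (11,14,30,21),
      (11,15,17,18), (11,15,22,20), (11,15,22,21), (11,15,22,23), (11,15,23,21), (11,15,23,22),
      (11,15,29,21), (11,15,29,30), (11,15,30,21), (11,18,22,20), (11,18,22,21), (11,18,22,23),
      (11,18,29,21), (11,18,29,30), (11,18,30,21), (11,18,30,29), (11,19,22,21), (11,19,22,23),
      (11,19,23,21), (11,19,23,22), (11,19,24,21), (11,19,24,26), (11,19,25,21), (11,19,25,27),
      (11,19,26,24), (11,19,26,25), (11,19,26,27), (11,19,27,25), (11,19,27,26), (11,19,27,28),
      (11,19,28,21), (11,19,28,27), (11,19,28,29), (11,19,29,21), (11,19,29,30), (11,19,30,21),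
      (11,19,30,29), (11,20,22,21), (11,20,22,23), (11,20,23,21), (11,20,24,21), (11,20,24,23),
      (11,20,24,26), (11,20,25,21), (11,20,25,26), (11,20,25,27), (11,20,26,25), (11,20,26,27),
      (11,20,27,25), (11,20,27,26), (11,20,27,28), (11,20,28,21), (11,20,28,27), (11,20,28,29),
      (11,20,29,21), (11,20,29,28), (11,20,29,30), (11,20,30,21), (11,20,30,29), (12,10,15,17),
      (12,10,21,22), (12,10,21,23), (12,10,21,29), (12,10,21,30), (12,13,14,16), (12,13,15,16),
      (12,13,18,17), (12,13,18,19), (12,13,19,18), (12,13,19,20), (12,13,20,19), (12,13,20,22),
      (12,13,21,29), (12,13,21,30), (12,13,22,20), (12,13,22,23), (12,13,23,22), (12,13,23,24),
      (12,13,28,29), (12,13,29,30), (12,13,30,29), (13,12,21,22), (13,12,21,23), (13,12,21,28),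
      (13,12,21,29), (13,12,21,30), (13,14,17,18), (13,14,18,17), (13,14,18,19), (13,14,19,18),
      (13,14,19,20), (13,14,20,19), (13,14,20,22), (13,14,21,29), (13,14,21,30), (13,14,22,20),
      (13,14,22,23), (13,14,29,30), (13,14,30,29), (14,13,21,22), (14,13,21,23), (14,13,21,29),
      (14,13,21,30), (14,16,18,19), (14,16,19,20), (14,16,20,19), (14,16,20,22), (14,16,21,22),
      (14,16,21,23), (14,16,21,29), (14,16,21,30), (14,16,22,23), (14,16,29,30), (15,16,20,19),
      (15,16,20,22), (15,16,21,22), (15,16,21,30), (15,16,23,21), (15,16,30,21), (15,17,20,22),
      (15,17,21,22), (15,17,21,29), (15,17,21,30), (15,17,22,21), (15,17,23,21), (15,17,30,21),
      (16,14,21,22), (16,14,21,23), (16,14,21,29), (16,14,21,30), (16,17,21,22), (16,17,21,23),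
      (16,17,21,29), (16,17,21,30), (16,17,29,30), (17,16,21,22), (17,16,21,23), (17,16,21,30),
      (17,18,19,20), (17,18,21,23), (17,18,21,29), (17,18,21,30), (17,18,22,20), (17,18,29,30),
      (17,18,30,29), (18,17,21,29), (18,17,21,30), (18,19,20,22), (18,19,21,22), (18,19,21,29),
      (18,19,21,30), (18,19,23,22), (18,19,29,30), (18,19,30,29), (19,18,21,30), (19,20,21,23),
      (19,20,21,25), (19,20,21,28), (19,20,21,29), (19,20,21,30), (19,20,22,23), (19,20,24,23),
      (19,20,24,26), (19,20,27,26), (19,20,27,28), (19,20,28,29), (19,20,29,28), (19,20,29,30),
      (19,20,30,29), (20,19,21,22), (20,19,21,23), (20,19,21,24), (20,19,21,25), (20,19,21,28),
      (20,19,21,29), (20,19,21,30), (20,22,21,24), (20,22,21,25), (20,22,21,28), (20,22,21,29),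
      (20,22,21,30), (20,22,23,24), (20,22,25,27), (20,22,26,24), (20,22,26,27), (20,22,27,28),
      (20,22,28,27), (20,22,28,29), (20,22,29,28), (20,22,29,30), (20,22,30,29), (21,22,26,24),
      (21,22,26,25), (21,22,26,27), (21,22,27,25), (21,22,27,28), (21,23,26,25), (21,23,26,27),
      (21,23,27,26), (21,23,27,28), (21,24,26,25), (21,24,26,27), (21,24,27,28), (21,25,27,28),
      (22,20,25,26), (22,20,25,27), (22,23,24,26), (22,23,25,26), (22,23,25,27), (22,23,27,28),
      (22,23,28,27), (22,23,28,29), (22,23,29,28), (22,23,29,30), (22,23,30,29), (23,24,27,28),
      (23,24,28,27), (23,24,28,29), (23,24,29,28), (23,24,29,30), (23,24,30,29), (24,26,28,29),
      (24,26,29,28), (24,26,29,30), (24,26,30,29), (25,26,30,29), (27,28,29,30)].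
      same u x \<longrightarrow> same v y \<longrightarrow> (before u x \<longleftrightarrow> before v y)"
    and cross_flip: "\<forall>(u,v,x,y)\<in>set
      [(0,11,6,7), (0,11,7,6), (0,21,2,3), (0,21,3,2), (0,21,3,4), (0,21,4,3), (0,21,4,6), (0,21,5,6),
      (0,21,5,7), (0,21,6,4), (0,21,6,7), (0,21,7,6), (0,21,7,8), (0,21,8,7), (0,21,8,9),
      (0,21,9,8), (0,21,9,10), (0,21,10,9), (0,21,10,12), (0,21,12,10), (0,21,12,13),
      (0,21,13,12), (0,21,13,14), (0,21,14,13), (0,21,14,16), (0,21,15,16), (0,21,15,17),
      (0,21,16,14), (0,21,16,17), (0,21,17,16), (0,21,17,18), (0,21,18,17), (0,21,18,19),
      (0,21,19,18), (0,21,19,20), (0,21,20,19), (0,21,22,20), (0,21,30,2), (1,2,11,0), (1,3,11,0),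
      (1,4,11,0), (1,4,30,2), (1,5,6,4), (1,5,11,0), (1,5,30,2), (1,8,6,4), (1,8,7,6), (1,8,11,0),
      (1,8,30,2), (1,9,6,4), (1,9,6,7), (1,9,11,0), (1,9,30,2), (1,10,6,4), (1,10,7,8),
      (1,10,11,0), (1,10,30,2), (2,30,4,6), (2,30,5,6), (2,30,8,9), (2,30,9,10), (2,30,10,12),
      (2,30,12,13), (2,30,13,14), (2,30,14,16), (2,30,15,16), (2,30,15,17), (2,30,16,17),
      (2,30,17,18), (2,30,18,19), (2,30,19,20), (2,30,20,22), (2,30,21,22), (2,30,21,23),
      (2,30,21,24), (2,30,21,25), (2,30,21,28), (2,30,22,23), (2,30,23,24), (2,30,24,26),
      (2,30,25,26), (2,30,27,28), (3,4,30,2), (5,6,21,0), (5,7,8,1), (5,7,21,0), (7,8,30,2),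
      (8,9,30,2), (9,10,30,2), (10,12,30,2), (11,12,30,2), (11,13,30,2), (11,14,30,2),
      (11,15,16,14), (11,15,30,2), (11,18,17,16), (11,18,30,2), (11,19,16,14), (11,19,16,17),
      (11,19,17,16), (11,19,30,2), (11,20,16,14), (11,20,17,16), (11,20,17,18), (11,20,30,2),
      (12,13,30,2), (13,14,30,2), (14,16,30,2), (15,16,20,11), (15,16,21,0), (15,16,30,2),
      (15,17,18,11), (15,17,21,0), (15,17,30,2), (16,17,30,2), (17,18,30,2), (18,19,30,2),
      (19,20,30,2), (20,22,30,2), (21,25,26,24), (21,28,26,24), (21,28,27,26), (21,29,26,24),
      (21,29,26,27), (21,29,27,26), (21,30,26,24), (21,30,27,26), (21,30,27,28), (22,23,30,2),
      (23,24,30,2), (24,26,30,2), (25,26,30,2), (25,26,30,21), (25,27,28,21), (25,27,30,2),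
      (25,27,30,21), (26,27,30,2), (28,29,30,2)].
      same u x \<longrightarrow> same y v \<longrightarrow> (before u x \<longleftrightarrow> \<not> before y v)"
    and trans: "\<forall>(u,v,w)\<in>set
      [(0,2,22), (0,4,22), (0,6,9), (0,7,9), (0,9,22), (0,9,28), (0,10,22), (0,10,28), (0,12,24),
      (0,12,30), (0,13,16), (0,13,17), (0,13,24), (0,13,30), (0,18,30), (0,20,30), (1,11,22),
      (1,11,23), (1,11,26), (1,11,29), (1,11,30), (1,22,30), (1,26,29), (1,27,29), (2,7,21),
      (2,8,23), (2,10,23), (2,12,29), (2,13,16), (2,13,17), (2,13,29), (2,19,23), (2,22,29),
      (3,6,21), (3,6,29), (3,7,21), (3,7,29), (3,8,23), (3,12,22), (3,13,16), (3,13,17),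
      (3,19,23), (3,20,29), (3,23,30), (3,26,29), (3,27,29), (4,9,22), (4,9,23), (6,9,19),
      (6,9,20), (7,9,19), (7,9,20), (10,19,29), (10,22,30), (10,23,30), (11,23,26), (11,23,27),
      (12,20,30), (12,22,29), (12,23,28), (12,23,30), (13,18,29), (13,18,30), (14,19,29),
      (14,19,30), (16,19,21), (16,19,23), (17,19,21), (17,19,23), (19,22,29), (19,22,30),
      (19,23,26), (19,23,27), (20,23,25), (20,23,30)].
      before u v \<longrightarrow> before v w \<longrightarrow> before u w"
    and negtrans: "\<forall>(u,v,w)\<in>set
      [(0,2,22), (0,3,22), (0,4,22), (0,6,9), (0,7,9), (0,9,22), (0,9,28), (0,10,22), (0,10,28),
      (0,12,24), (0,12,30), (0,13,16), (0,13,17), (0,13,24), (0,13,30), (0,18,30), (0,20,30),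
      (1,11,22), (1,11,23), (1,11,27), (1,11,29), (1,11,30), (1,26,29), (1,27,29), (2,10,22),
      (2,12,29), (2,13,16), (2,13,17), (2,13,29), (2,19,22), (2,19,23), (2,22,29), (3,6,21),
      (3,6,29), (3,7,21), (3,7,29), (3,8,22), (3,13,16), (3,13,17), (3,19,23), (3,19,29),
      (3,20,29), (3,22,30), (3,23,30), (3,26,29), (3,27,29), (4,9,22), (4,9,23), (6,9,19),
      (6,9,20), (7,9,19), (7,9,20), (10,23,30), (11,23,26), (11,23,27), (11,26,29), (12,22,29),
      (12,22,30), (12,23,28), (12,23,30), (13,18,29), (13,18,30), (14,19,29), (16,18,21),
      (16,19,21), (16,19,23), (17,19,21), (17,19,23), (19,23,26), (19,23,27), (20,23,25),
      (20,23,30)].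
      before u w \<longrightarrow> before u v \<or> before v w"
  shows False
  using some proper same cross cross_flip trans negtrans [[argo_timeout = 1000]]
  unfolding list.set ball_simps bex_simps prod.case fixed simp_thms
  by (elim conjE) argo

text \<open>The case in which the hub and its children occupy all four tracks.\<close>

lemma halin_clauses_unsat_123:
  fixes col same before :: "nat \<Rightarrow> nat \<Rightarrow> bool"
  assumes fixed: "col 0 0 = True" "col 1 1 = True" "col 11 2 = True" "col 21 3 = True"
    and some: "\<forall>(v,is)\<in>set
      [(2,[0,2,3]), (3,[0,2,3]), (4,[0,2,3]), (5,[0,2,3]), (6,[0,1,2,3]), (7,[0,1,2,3]), (8,[0,2,3]),
      (9,[0,2,3]), (10,[0,2,3]), (12,[0,1,3]), (13,[0,1,3]), (14,[0,1,3]), (15,[0,1,3]),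
      (16,[0,1,2,3]), (17,[0,1,2,3]), (18,[0,1,3]), (19,[0,1,3]), (20,[0,1,3]), (22,[0,1,2]),
      (23,[0,1,2]), (24,[0,1,2]), (25,[0,1,2]), (26,[0,1,2,3]), (27,[0,1,2,3]), (28,[0,1,2]),
      (29,[0,1,2]), (30,[0,1,2])].
      \<exists>i\<in>set is. col v i"
    and proper: "\<forall>(u,v,i)\<in>set
      [(2,3,0), (2,3,2), (2,3,3), (3,4,0), (3,4,2), (3,4,3), (4,6,0), (4,6,2), (4,6,3), (5,6,0),
      (5,6,2), (5,6,3), (5,7,0), (5,7,2), (5,7,3), (6,7,0), (6,7,1), (6,7,2), (6,7,3), (7,8,0),
      (7,8,2), (7,8,3), (8,9,0), (8,9,2), (8,9,3), (9,10,0), (9,10,2), (9,10,3), (10,12,0),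
      (10,12,3), (12,13,0), (12,13,1), (12,13,3), (13,14,0), (13,14,1), (13,14,3), (14,16,0),
      (14,16,1), (14,16,3), (15,16,0), (15,16,1), (15,16,3), (15,17,0), (15,17,1), (15,17,3),
      (16,17,0), (16,17,1), (16,17,2), (16,17,3), (17,18,0), (17,18,1), (17,18,3), (18,19,0),
      (18,19,1), (18,19,3), (19,20,0), (19,20,1), (19,20,3), (20,22,0), (20,22,1), (22,23,0),
      (22,23,1), (22,23,2), (23,24,0), (23,24,1), (23,24,2), (24,26,0), (24,26,1), (24,26,2),
      (25,26,0), (25,26,1), (25,26,2), (25,27,0), (25,27,1), (25,27,2), (26,27,0), (26,27,1),
      (26,27,2), (26,27,3), (27,28,0), (27,28,1), (27,28,2), (28,29,0), (28,29,1), (28,29,2),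
      (29,30,0), (29,30,1), (29,30,2), (30,2,0), (30,2,2)].
      \<not> (col u i \<and> col v i)"
    and same: "\<forall>(u,v,i)\<in>set
      [(0,2,0), (0,3,0), (0,4,0), (0,5,0), (0,6,0), (0,7,0), (0,8,0), (0,9,0), (0,10,0), (0,12,0),
      (0,13,0), (0,14,0), (0,15,0), (0,16,0), (0,17,0), (0,18,0), (0,19,0), (0,20,0), (0,22,0),
      (0,23,0), (0,24,0), (0,25,0), (0,26,0), (0,27,0), (0,28,0), (0,29,0), (0,30,0), (1,6,1),
      (1,7,1), (1,12,1), (1,13,1), (1,14,1), (1,15,1), (1,16,1), (1,17,1), (1,18,1), (1,19,1),
      (1,20,1), (1,22,1), (1,23,1), (1,24,1), (1,25,1), (1,26,1), (1,27,1), (1,28,1), (1,29,1),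
      (1,30,1), (2,4,0), (2,4,2), (2,4,3), (2,5,0), (2,5,2), (2,6,2), (2,7,2), (2,7,3), (2,8,2),
      (2,8,3), (2,9,0), (2,9,3), (2,10,2), (2,10,3), (2,11,2), (2,12,0), (2,12,3), (2,13,0),
      (2,13,3), (2,14,3), (2,15,0), (2,15,3), (2,16,2), (2,16,3), (2,17,2), (2,17,3), (2,18,0),
      (2,18,3), (2,19,0), (2,19,3), (2,20,0), (2,20,3), (2,21,3), (2,22,0), (2,22,2), (2,23,0),
      (2,23,2), (2,25,0), (2,25,2), (2,26,0), (2,26,2), (2,26,3), (2,27,0), (2,27,2), (2,27,3),
      (2,29,0), (2,29,2), (3,6,0), (3,6,2), (3,7,0), (3,7,2), (3,8,0), (3,8,2), (3,9,0), (3,10,0),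
      (3,10,2), (3,11,2), (3,12,0), (3,12,3), (3,13,3), (3,14,0), (3,19,0), (3,19,3), (3,20,0),
      (3,20,3), (3,21,3), (3,22,0), (3,22,2), (3,23,0), (3,24,2), (3,25,0), (3,25,2), (3,26,0),
      (3,26,2), (3,26,3), (3,27,0), (3,27,2), (3,28,0), (3,28,2), (3,29,0), (3,29,2), (3,30,0),
      (3,30,2), (4,5,0), (4,5,2), (4,5,3), (4,9,0), (4,9,3), (4,10,0), (4,10,2), (4,10,3),
      (4,11,2), (4,12,3), (4,20,3), (4,21,3), (4,22,2), (4,29,0), (4,29,2), (5,8,2), (5,8,3),
      (5,10,0), (5,10,3), (5,11,2), (5,12,0), (5,12,3), (5,13,0), (5,13,3), (5,19,0), (5,20,0),
      (5,21,3), (5,22,0), (5,22,2), (5,29,0), (5,29,2), (5,30,2), (6,9,0), (6,9,3), (6,10,2),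
      (6,10,3), (6,11,2), (6,12,0), (6,12,1), (6,12,3), (6,13,0), (6,13,1), (6,13,3), (6,20,1),
      (6,20,3), (6,21,3), (6,22,1), (6,22,2), (6,29,0), (6,29,2), (6,30,0), (6,30,1), (6,30,2),
      (7,9,0), (7,9,3), (7,10,3), (7,11,2), (7,12,0), (7,12,1), (7,12,3), (7,13,0), (7,13,3),
      (7,20,3), (7,21,3), (7,22,1), (7,22,2), (7,29,0), (7,29,1), (7,29,2), (7,30,0), (7,30,1),
      (7,30,2), (8,10,0), (8,10,2), (8,10,3), (8,11,2), (8,13,0), (8,13,3), (8,19,0), (8,20,3),
      (8,21,3), (8,22,0), (8,22,2), (8,29,2), (8,30,2), (9,11,2), (9,12,0), (9,12,3), (9,13,0),
      (9,13,3), (9,14,0), (9,14,3), (9,15,0), (9,15,3), (9,16,0), (9,16,3), (9,17,0), (9,17,2),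
      (9,17,3), (9,19,0), (9,19,3), (9,20,0), (9,20,3), (9,21,3), (9,22,0), (9,22,2), (9,23,0),
      (9,23,2), (9,25,0), (9,28,0), (9,29,0), (9,29,2), (9,30,0), (10,11,2), (10,13,0), (10,13,3),
      (10,15,0), (10,15,3), (10,16,0), (10,16,2), (10,16,3), (10,17,0), (10,17,2), (10,17,3),
      (10,18,0), (10,18,3), (10,19,0), (10,19,3), (10,20,0), (10,20,3), (10,21,3), (10,22,0),
      (10,22,2), (10,23,0), (10,23,2), (10,24,2), (10,25,2), (10,26,2), (10,26,3), (10,27,2),
      (10,27,3), (10,28,2), (10,29,0), (10,29,2), (10,30,0), (10,30,2), (11,16,2), (11,17,2),
      (11,22,2), (11,23,2), (11,24,2), (11,25,2), (11,26,2), (11,27,2), (11,28,2), (11,29,2),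
      (11,30,2), (12,14,0), (12,14,1), (12,14,3), (12,15,0), (12,15,1), (12,15,3), (12,16,3),
      (12,17,1), (12,17,3), (12,18,0), (12,18,1), (12,18,3), (12,19,0), (12,19,1), (12,20,0),
      (12,20,1), (12,20,3), (12,21,3), (12,22,0), (12,22,1), (12,23,0), (12,23,1), (12,24,1),
      (12,25,0), (12,25,1), (12,26,1), (12,27,1), (12,27,3), (12,28,1), (12,29,0), (12,29,1),
      (12,30,0), (12,30,1), (13,16,0), (13,16,3), (13,17,0), (13,17,3), (13,18,0), (13,19,0),
      (13,20,0), (13,20,3), (13,21,3), (13,22,0), (13,22,1), (13,25,0), (13,28,1), (13,29,0),
      (13,29,1), (13,30,0), (13,30,1), (14,15,0), (14,15,1), (14,15,3), (14,17,1), (14,18,1),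
      (14,18,3), (14,19,0), (14,19,1), (14,20,0), (14,20,1), (14,20,3), (14,21,3), (14,23,1),
      (14,30,0), (14,30,1), (15,18,0), (15,18,1), (15,18,3), (15,20,0), (15,20,1), (15,21,3),
      (15,22,0), (15,22,1), (15,23,0), (15,23,1), (15,29,0), (15,30,0), (15,30,1), (16,19,0),
      (16,19,1), (16,20,1), (16,20,3), (16,21,3), (16,22,0), (16,22,1), (16,22,2), (16,23,0),
      (16,23,1), (16,23,2), (16,30,1), (16,30,2), (17,19,0), (17,19,1), (17,20,1), (17,21,3),
      (17,22,0), (17,22,1), (17,22,2), (17,23,0), (17,23,1), (17,30,1), (17,30,2), (18,20,0),
      (18,20,1), (18,20,3), (18,21,3), (18,23,0), (18,23,1), (18,30,1), (19,21,3), (19,22,0),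
      (19,22,1), (19,23,0), (19,23,1), (19,24,0), (19,24,1), (19,25,0), (19,25,1), (19,26,0),
      (19,26,1), (19,27,0), (19,27,1), (19,27,3), (19,28,1), (19,29,0), (19,29,1), (19,30,0),
      (19,30,1), (20,21,3), (20,23,0), (20,23,1), (20,25,1), (20,26,0), (20,26,1), (20,26,3),
      (20,27,0), (20,27,1), (20,27,3), (20,29,0), (20,29,1), (20,30,0), (20,30,1), (21,26,3),
      (21,27,3), (22,24,0), (22,24,1), (22,24,2), (22,25,0), (22,25,1), (22,25,2), (22,27,0),
      (22,27,1), (22,28,0), (22,28,1), (22,28,2), (22,29,0), (22,29,2), (22,30,0), (22,30,1),
      (22,30,2), (23,26,0), (23,26,1), (23,27,0), (23,27,1), (23,28,0), (23,28,1), (23,28,2),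
      (23,29,0), (23,30,0), (23,30,1), (24,25,0), (24,25,1), (24,25,2), (24,28,0), (24,28,1),
      (24,28,2), (24,29,0), (24,29,2), (24,30,0), (24,30,1), (24,30,2), (25,28,0), (25,28,1),
      (25,28,2), (25,30,0), (25,30,2), (26,29,0), (26,29,2), (26,30,1), (26,30,2), (27,29,0),
      (27,29,2), (27,30,2), (28,30,0), (28,30,1), (28,30,2)].
      col u i \<longrightarrow> col v i \<longrightarrow> same u v"
    and cross: "\<forall>(u,v,x,y)\<in>set
      [(0,1,2,30), (0,1,4,6), (0,1,5,6), (0,1,5,7), (0,1,6,7), (0,1,7,6), (0,1,8,7), (0,1,10,12),
      (0,1,12,13), (0,1,13,12), (0,1,13,14), (0,1,14,16), (0,1,15,16), (0,1,15,17), (0,1,16,14),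
      (0,1,16,15), (0,1,16,17), (0,1,17,15), (0,1,17,16), (0,1,17,18), (0,1,18,17), (0,1,18,19),
      (0,1,19,18), (0,1,19,20), (0,1,20,19), (0,1,20,22), (0,1,22,20), (0,1,22,23), (0,1,23,22),
      (0,1,23,24), (0,1,24,23), (0,1,24,26), (0,1,25,26), (0,1,25,27), (0,1,26,24), (0,1,26,25),
      (0,1,26,27), (0,1,27,25), (0,1,27,26), (0,1,27,28), (0,1,28,27), (0,1,28,29), (0,1,29,28),
      (0,1,29,30), (0,1,30,29), (0,11,2,30), (0,11,14,16), (0,11,15,16), (0,11,15,17),
      (0,11,16,17), (0,11,17,16), (0,11,18,17), (0,11,20,22), (0,11,22,23), (0,11,23,22),
      (0,11,23,24), (0,11,24,23), (0,11,24,26), (0,11,25,26), (0,11,25,27), (0,11,26,24),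
      (0,11,26,25), (0,11,26,27), (0,11,27,25), (0,11,27,26), (0,11,27,28), (0,11,28,27),
      (0,11,28,29), (0,11,29,28), (0,11,29,30), (0,11,30,29), (0,21,24,26), (0,21,25,26),
      (0,21,25,27), (0,21,26,27), (0,21,27,26), (0,21,28,27), (1,2,6,4), (1,2,6,7), (1,2,7,5),
      (1,2,7,6), (1,2,7,8), (1,2,12,10), (1,2,12,11), (1,2,12,13), (1,2,13,11), (1,2,13,12),
      (1,2,14,11), (1,2,14,13), (1,2,14,16), (1,2,15,11), (1,2,15,16), (1,2,16,14), (1,2,16,15),
      (1,2,16,17), (1,2,17,15), (1,2,17,16), (1,2,17,18), (1,2,18,11), (1,2,18,17), (1,2,19,11),
      (1,2,19,18), (1,2,19,20), (1,2,20,11), (1,2,20,19), (1,2,20,22), (1,2,22,20), (1,2,22,21),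
      (1,2,22,23), (1,2,23,21), (1,2,23,22), (1,2,24,21), (1,2,24,23), (1,2,24,26), (1,2,25,21),
      (1,2,25,27), (1,2,26,27), (1,2,27,25), (1,2,27,26), (1,2,28,21), (1,2,28,29), (1,2,29,21),
      (1,2,30,21), (1,2,30,29), (1,3,6,7), (1,3,7,6), (1,3,7,8), (1,3,12,10), (1,3,12,11),
      (1,3,12,13), (1,3,13,11), (1,3,13,12), (1,3,14,11), (1,3,14,13), (1,3,15,11), (1,3,18,11),
      (1,3,19,11), (1,3,19,20), (1,3,20,11), (1,3,20,19), (1,3,20,22), (1,3,22,20), (1,3,22,21),
      (1,3,23,21), (1,3,23,22), (1,3,24,21), (1,3,24,26), (1,3,26,24), (1,3,26,25), (1,3,26,27),
      (1,3,27,25), (1,3,27,26), (1,3,27,28), (1,3,29,21), (1,3,29,30), (1,3,30,21), (1,3,30,29),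
      (1,4,6,5), (1,4,12,10), (1,4,12,11), (1,4,13,11), (1,4,13,12), (1,4,20,11), (1,4,20,22),
      (1,4,22,20), (1,4,22,21), (1,4,23,21), (1,4,30,21), (1,4,30,29), (1,5,7,8), (1,5,12,10),
      (1,5,12,11), (1,5,12,13), (1,5,13,12), (1,5,19,11), (1,5,19,20), (1,5,20,11), (1,5,20,19),
      (1,5,20,22), (1,5,22,20), (1,5,22,21), (1,5,29,30), (1,5,30,21), (1,5,30,29), (1,8,12,10),
      (1,8,12,11), (1,8,12,13), (1,8,19,11), (1,8,20,11), (1,8,20,22), (1,8,22,20), (1,8,22,21),
      (1,8,29,21), (1,8,30,21), (1,8,30,29), (1,9,12,11), (1,9,12,13), (1,9,13,11), (1,9,13,12),
      (1,9,16,14), (1,9,16,15), (1,9,16,17), (1,9,17,15), (1,9,17,16), (1,9,18,11), (1,9,18,17),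
      (1,9,19,11), (1,9,19,20), (1,9,20,11), (1,9,20,19), (1,9,20,22), (1,9,22,20), (1,9,22,21),
      (1,9,22,23), (1,9,23,21), (1,9,24,23), (1,9,27,25), (1,9,28,21), (1,9,29,21), (1,9,29,30),
      (1,9,30,21), (1,9,30,29), (1,10,12,11), (1,10,12,13), (1,10,13,11), (1,10,14,11),
      (1,10,14,13), (1,10,15,11), (1,10,15,16), (1,10,16,15), (1,10,16,17), (1,10,17,16),
      (1,10,18,11), (1,10,18,17), (1,10,18,19), (1,10,19,11), (1,10,19,20), (1,10,20,11),
      (1,10,20,19), (1,10,20,22), (1,10,22,20), (1,10,22,21), (1,10,22,23), (1,10,23,21),
      (1,10,23,22), (1,10,23,24), (1,10,24,21), (1,10,24,26), (1,10,25,21), (1,10,25,27),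
      (1,10,26,24), (1,10,26,25), (1,10,26,27), (1,10,27,26), (1,10,27,28), (1,10,28,21),
      (1,10,28,27), (1,10,28,29), (1,10,29,21), (1,10,29,30), (1,10,30,21), (1,10,30,29),
      (2,3,4,6), (2,3,7,8), (2,3,8,7), (2,3,8,9), (2,3,9,8), (2,3,9,10), (2,3,10,9), (2,3,10,12),
      (2,3,11,12), (2,3,11,19), (2,3,11,20), (2,3,12,10), (2,3,13,12), (2,3,13,14), (2,3,16,14),
      (2,3,20,22), (2,3,21,22), (2,3,21,23), (2,3,21,24), (2,3,21,25), (2,3,21,28), (2,3,21,29),
      (2,3,21,30), (2,3,22,20), (2,3,23,22), (2,3,23,24), (2,3,29,28), (2,3,29,30), (3,2,11,12),
      (3,2,11,13), (3,2,11,15), (3,2,11,19), (3,2,11,20), (3,2,21,22), (3,2,21,23), (3,2,21,25),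
      (3,2,21,29), (3,4,8,9), (3,4,9,10), (3,4,10,9), (3,4,11,20), (3,4,12,10), (3,4,22,20),
      (3,4,30,29), (4,3,11,12), (4,3,21,22), (4,3,21,30), (4,6,9,10), (4,6,10,12), (4,6,11,12),
      (4,6,11,13), (4,6,11,20), (4,6,12,13), (4,6,20,22), (4,6,21,22), (4,6,22,20), (5,6,10,9),
      (5,6,13,11), (5,6,21,30), (5,6,22,20), (5,6,22,21), (5,6,29,21), (5,6,30,21), (5,7,11,12),
      (5,7,11,20), (5,7,12,11), (5,7,13,11), (5,7,19,11), (5,7,20,11), (5,7,20,22), (5,7,22,20),
      (5,7,22,21), (5,7,29,21), (6,4,11,20), (6,4,21,22), (6,4,21,29), (6,7,10,12), (6,7,11,12),
      (6,7,11,13), (6,7,12,10), (6,7,20,22), (6,7,21,22), (6,7,21,29), (6,7,21,30), (6,7,22,20),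
      (7,6,11,12), (7,6,11,13), (7,6,11,20), (7,6,21,22), (7,6,21,29), (7,6,21,30), (7,8,9,10),
      (7,8,11,13), (7,8,11,20), (7,8,12,10), (7,8,20,19), (7,8,20,22), (7,8,21,22), (7,8,21,29),
      (7,8,22,20), (8,7,11,20), (8,7,21,22), (8,7,21,29), (8,7,21,30), (8,9,10,12), (8,9,11,12),
      (8,9,11,19), (8,9,11,20), (8,9,13,12), (8,9,19,20), (8,9,20,19), (8,9,21,30), (8,9,22,20),
      (8,9,30,29), (9,8,21,22), (9,10,11,13), (9,10,11,15), (9,10,11,18), (9,10,11,19),
      (9,10,11,20), (9,10,12,13), (9,10,14,13), (9,10,17,18), (9,10,19,20), (9,10,20,19),
      (9,10,20,22), (9,10,21,22), (9,10,21,23), (9,10,21,29), (9,10,21,30), (9,10,22,20),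
      (9,10,28,27), (9,10,28,29), (9,10,30,29), (10,9,11,12), (10,9,11,13), (10,9,11,14),
      (10,9,11,15), (10,9,11,19), (10,9,11,20), (10,9,21,22), (10,9,21,23), (10,9,21,25),
      (10,9,21,29), (10,9,21,30), (10,12,11,14), (10,12,11,15), (10,12,11,18), (10,12,11,19),
      (10,12,11,20), (10,12,13,14), (10,12,16,14), (10,12,16,17), (10,12,17,16), (10,12,17,18),
      (10,12,19,18), (10,12,19,20), (10,12,20,19), (10,12,21,22), (10,12,21,23), (10,12,21,24),
      (10,12,21,25), (10,12,21,28), (10,12,21,29), (10,12,21,30), (10,12,22,23), (10,12,23,22),
      (10,12,24,23), (10,12,24,26), (10,12,25,26), (10,12,26,24), (10,12,26,27), (10,12,27,26),
      (10,12,27,28), (10,12,28,27), (10,12,28,29), (10,12,29,28), (10,12,29,30), (10,12,30,29),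
      (11,12,16,14), (11,12,16,17), (11,12,17,15), (11,12,17,16), (11,12,17,18), (11,12,22,20),
      (11,12,22,21), (11,12,22,23), (11,12,23,21), (11,12,23,22), (11,12,24,21), (11,12,24,23),
      (11,12,24,26), (11,12,25,21), (11,12,25,26), (11,12,26,24), (11,12,26,25), (11,12,26,27),
      (11,12,27,25), (11,12,27,28), (11,12,28,21), (11,12,28,27), (11,12,29,21), (11,12,29,28),
      (11,12,29,30), (11,12,30,21), (11,12,30,29), (11,13,16,17), (11,13,17,16), (11,13,22,20),
      (11,13,22,21), (11,13,23,21), (11,13,23,22), (11,13,24,21), (11,13,26,25), (11,13,28,21),
      (11,13,29,21), (11,13,29,30), (11,13,30,21), (11,13,30,29), (11,14,16,15), (11,14,16,17),
      (11,14,22,20), (11,14,22,21), (11,14,22,23), (11,14,23,21), (11,14,29,21), (11,14,30,21),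
      (11,15,17,18), (11,15,22,20), (11,15,22,21), (11,15,22,23), (11,15,23,22), (11,15,30,21),
      (11,15,30,29), (11,18,22,20), (11,18,22,21), (11,18,22,23), (11,18,29,21), (11,18,30,21),
      (11,19,22,21), (11,19,22,23), (11,19,23,21), (11,19,23,22), (11,19,26,24), (11,19,26,25),
      (11,19,26,27), (11,19,27,25), (11,19,27,26), (11,19,27,28), (11,19,28,21), (11,19,28,27),
      (11,19,29,21), (11,19,29,30), (11,19,30,21), (11,20,22,21), (11,20,22,23), (11,20,23,21),
      (11,20,24,21), (11,20,24,23), (11,20,25,21), (11,20,25,26), (11,20,26,25), (11,20,26,27),
      (11,20,27,26), (11,20,28,21), (11,20,28,27), (11,20,28,29), (11,20,29,21), (11,20,29,30),
      (11,20,30,21), (11,20,30,29), (12,10,15,17), (12,10,21,22), (12,10,21,23), (12,10,21,24),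
      (12,10,21,25), (12,10,21,28), (12,10,21,29), (12,10,21,30), (12,10,25,27), (12,13,14,16),
      (12,13,15,17), (12,13,17,18), (12,13,18,17), (12,13,18,19), (12,13,19,18), (12,13,19,20),
      (12,13,20,19), (12,13,20,22), (12,13,21,22), (12,13,21,25), (12,13,21,28), (12,13,21,29),
      (12,13,21,30), (12,13,22,20), (12,13,23,22), (12,13,27,28), (13,12,21,22), (13,12,21,23),
      (13,12,21,29), (13,12,21,30), (13,14,17,18), (13,14,18,17), (13,14,18,19), (13,14,19,18),
      (13,14,19,20), (13,14,20,19), (13,14,21,30), (13,14,22,20), (14,13,21,22), (14,16,18,19),
      (14,16,19,20), (14,16,20,19), (14,16,20,22), (14,16,21,22), (14,16,21,23), (14,16,21,30),
      (15,16,23,21), (15,16,30,21), (15,17,21,22), (15,17,21,30), (15,17,22,21), (15,17,23,21),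
      (15,17,29,21), (15,17,30,21), (16,14,21,23), (16,14,21,30), (16,17,20,22), (16,17,21,22),
      (16,17,21,23), (16,17,21,30), (16,17,22,20), (17,16,21,22), (17,16,21,23), (17,16,21,30),
      (17,18,19,20), (17,18,21,23), (17,18,21,30), (17,18,22,20), (18,17,21,30), (18,19,20,22),
      (18,19,21,22), (18,19,21,29), (18,19,21,30), (18,19,23,22), (18,19,23,24), (18,19,30,29),
      (19,20,21,23), (19,20,21,25), (19,20,21,29), (19,20,21,30), (19,20,22,23), (19,20,24,23),
      (19,20,28,29), (19,20,29,30), (19,20,30,29), (20,19,21,22), (20,19,21,23), (20,19,21,24),
      (20,19,21,25), (20,19,21,28), (20,19,21,29), (20,19,21,30), (20,22,21,24), (20,22,21,25),
      (20,22,21,28), (20,22,21,29), (20,22,21,30), (20,22,23,24), (20,22,25,27), (20,22,26,24),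
      (20,22,27,28), (20,22,29,28), (20,22,29,30), (20,22,30,29), (21,22,26,24), (21,22,26,25),
      (21,22,26,27), (21,22,27,25), (21,22,27,28), (21,23,26,27), (21,23,27,26), (21,23,27,28),
      (21,24,26,25), (21,24,27,28), (21,25,27,28), (22,23,24,26), (22,23,25,27), (22,23,27,28),
      (22,23,28,27), (22,23,28,29), (22,23,29,28), (22,23,29,30), (22,23,30,29), (23,24,27,28),
      (23,24,28,29), (23,24,29,28), (23,24,29,30), (23,24,30,29), (24,26,28,29), (24,26,29,30),
      (24,26,30,29), (25,26,30,29), (27,28,29,30)].
      same u x \<longrightarrow> same v y \<longrightarrow> (before u x \<longleftrightarrow> before v y)"
    and cross_flip: "\<forall>(u,v,x,y)\<in>set
      [(0,11,2,3), (0,11,3,2), (0,11,3,4), (0,11,4,3), (0,11,4,6), (0,11,5,6), (0,11,5,7), (0,11,6,4),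
      (0,11,6,7), (0,11,7,6), (0,11,7,8), (0,11,8,7), (0,11,8,9), (0,11,9,8), (0,11,9,10),
      (0,11,10,9), (0,11,12,10), (0,11,30,2), (0,21,2,3), (0,21,3,2), (0,21,3,4), (0,21,4,3),
      (0,21,4,6), (0,21,5,6), (0,21,5,7), (0,21,6,4), (0,21,6,7), (0,21,7,6), (0,21,7,8),
      (0,21,8,7), (0,21,8,9), (0,21,9,8), (0,21,9,10), (0,21,10,9), (0,21,10,12), (0,21,12,10),
      (0,21,12,13), (0,21,13,12), (0,21,13,14), (0,21,14,13), (0,21,14,16), (0,21,15,16),
      (0,21,15,17), (0,21,16,14), (0,21,16,17), (0,21,17,16), (0,21,17,18), (0,21,18,17),
      (0,21,19,18), (0,21,19,20), (0,21,20,19), (0,21,22,20), (0,21,30,2), (1,4,30,2), (1,5,6,4),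
      (1,5,30,2), (1,8,30,2), (1,9,6,4), (1,9,6,7), (1,9,30,2), (1,10,6,4), (1,10,6,7),
      (1,10,7,6), (1,10,7,8), (1,10,30,2), (2,30,4,6), (2,30,6,7), (2,30,8,9), (2,30,9,10),
      (2,30,11,12), (2,30,11,13), (2,30,11,14), (2,30,11,15), (2,30,11,18), (2,30,11,19),
      (2,30,11,20), (2,30,12,13), (2,30,13,14), (2,30,14,16), (2,30,15,16), (2,30,16,17),
      (2,30,17,18), (2,30,18,19), (2,30,19,20), (2,30,21,22), (2,30,21,23), (2,30,21,24),
      (2,30,21,25), (2,30,21,28), (2,30,22,23), (2,30,23,24), (2,30,26,27), (2,30,27,28),
      (3,4,30,2), (5,6,10,1), (5,6,11,0), (5,6,21,0), (5,7,8,1), (5,7,11,0), (5,7,21,0),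
      (6,7,30,2), (7,8,30,2), (8,9,30,2), (9,10,30,2), (11,12,30,2), (11,13,30,2), (11,14,30,2),
      (11,15,16,14), (11,15,30,2), (11,18,16,14), (11,18,30,2), (11,19,16,14), (11,19,16,17),
      (11,19,30,2), (11,20,16,14), (11,20,16,17), (11,20,17,16), (11,20,17,18), (11,20,30,2),
      (12,13,30,2), (13,14,30,2), (14,16,30,2), (15,16,20,11), (15,16,21,0), (15,16,30,2),
      (15,17,18,11), (15,17,21,0), (15,17,30,2), (16,17,30,2), (17,18,30,2), (19,20,30,2),
      (20,22,30,2), (21,25,26,24), (21,28,26,24), (21,29,26,24), (21,29,26,27), (21,29,27,26),
      (21,30,26,24), (21,30,26,27), (21,30,27,26), (21,30,27,28), (22,23,30,2), (24,26,30,2),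
      (25,26,30,2), (25,26,30,21), (25,27,28,21), (28,29,30,2)].
      same u x \<longrightarrow> same y v \<longrightarrow> (before u x \<longleftrightarrow> \<not> before y v)"
    and trans: "\<forall>(u,v,w)\<in>set
      [(0,22,30), (1,12,20), (1,12,23), (1,12,29), (1,12,30), (1,13,29), (1,13,30), (1,16,20),
      (1,16,30), (1,19,23), (1,19,30), (1,20,30), (1,22,30), (1,23,27), (2,7,11), (2,10,11),
      (2,10,13), (2,10,21), (2,10,29), (2,12,21), (2,13,21), (2,19,21), (2,19,29), (2,20,21),
      (3,6,29), (3,7,11), (3,7,29), (3,11,29), (3,12,21), (3,13,21), (3,19,21), (3,20,21),
      (3,20,30), (3,22,30), (3,26,29), (3,27,29), (6,9,13), (7,9,13), (9,11,23), (9,12,20),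
      (9,13,16), (9,13,17), (9,19,21), (9,19,23), (9,20,21), (10,11,23), (10,19,21), (10,20,21),
      (10,21,26), (11,22,30), (11,26,30), (12,17,21), (12,20,21), (12,20,23), (16,19,23),
      (17,19,23), (19,22,30), (19,23,26), (19,23,27)].
      before u v \<longrightarrow> before v w \<longrightarrow> before u w"
    and negtrans: "\<forall>(u,v,w)\<in>set
      [(0,12,20), (0,22,30), (1,6,20), (1,7,22), (1,12,20), (1,13,29), (1,13,30), (1,14,30), (1,16,20),
      (1,19,23), (1,22,30), (2,10,11), (2,10,13), (2,10,21), (2,10,29), (2,11,22), (2,12,21),
      (2,13,21), (2,14,21), (2,18,21), (2,19,21), (2,20,21), (3,6,29), (3,7,29), (3,11,22),
      (3,11,29), (3,12,21), (3,13,21), (3,19,21), (3,19,23), (3,20,21), (3,22,30), (3,26,29),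
      (3,27,29), (4,20,21), (6,9,13), (6,10,21), (7,9,13), (8,20,21), (9,11,22), (9,11,23),
      (9,11,29), (9,12,20), (9,12,21), (9,12,29), (9,13,16), (9,13,17), (9,13,21), (9,13,29),
      (9,20,21), (9,20,23), (10,11,22), (10,11,26), (10,11,29), (10,11,30), (10,20,21),
      (10,20,23), (11,22,30), (11,26,30), (12,17,21), (12,20,21), (13,17,21), (16,19,23),
      (17,19,23), (19,22,30), (19,23,26), (19,23,27)].
      before u w \<longrightarrow> before u v \<or> before v w"
  shows False
  using some proper same cross cross_flip trans negtrans [[argo_timeout = 1000]]
  unfolding list.set ball_simps bex_simps prod.case fixed simp_thms
  by (elim conjE) argo

section \<open>The Halin graph on 31 vertices\<close>

definition halin_nb :: "nat list list" where
  "halin_nb =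
    [[1,11,21], [0,2,3,4,5,8,9,10], [1], [1], [1], [1,6,7], [5], [5], [1], [1], [1],
    [0,12,13,14,15,18,19,20], [11], [11], [11], [11,16,17], [15], [15], [11], [11], [11],
    [0,22,23,24,25,28,29,30], [21], [21], [21], [21,26,27], [25], [25], [21], [21], [21]]"

text \<open>The tree is numbered in preorder, and each list in \<open>halin_nb\<close> gives the
  parent, if there is one, followed by the children in increasing order. The face walk therefore
  meets the leaves in increasing order, skipping the inner vertices, and closes up from 30 to
  2.\<close>

definition halin_rim :: "(nat \<times> nat) list" where
  "halin_rim =
    [(2,3), (3,4), (4,6), (6,7), (7,8), (8,9), (9,10), (10,12), (12,13), (13,14), (14,16), (16,17),
    (17,18), (18,19), (19,20), (20,22), (22,23), (23,24), (24,26), (26,27), (27,28), (28,29),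
    (29,30), (30,2)]"

lemma length_halin_nb: "length halin_nb = 31"
  by (simp add: halin_nb_def)

lemmas halin_nb_table [simp] = nth_table[OF halin_nb_def length_halin_nb, simplified]

lemma less_31_list: "u < 31 \<longleftrightarrow> u \<in> set (0 # 1 # [2..<31 :: nat])"
  unfolding list.set set_upt by auto

text \<open>In preorder a parent precedes its children, which gives the unique smaller neighbour.
  All conditions are evaluated over the explicit list of vertices; uniqueness is phrased as a bound
  on the length of a filtered list to make it computable.\<close>

interpretation hal: neighbour_lists 31 "(!) halin_nb"
proof -
  have "list_all (\<lambda>u. distinct (halin_nb ! u) \<and> list_all (\<lambda>v. v < 31 \<and> v \<noteq> u \<and> u \<in> set (halin_nb ! v)) (halin_nb ! u) \<and>
      (u = 0 \<or> (\<exists>p\<in>set (halin_nb ! u). p < u)) \<and> length (filter (\<lambda>v. v < u) (halin_nb ! u)) \<le> 1) (0 # 1 # [2..<31])"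
    by (simp add: halin_nb_table)
  then have *: "distinct (halin_nb ! u)"
    "\<forall>v\<in>set (halin_nb ! u). v < 31 \<and> v \<noteq> u \<and> u \<in> set (halin_nb ! v)"
    "u = 0 \<or> (\<exists>p\<in>set (halin_nb ! u). p < u)"
    "length (filter (\<lambda>v. v < u) (halin_nb ! u)) \<le> 1" if "u < 31" for u
    using that unfolding less_31_list list_all_iff by blast+
  show "neighbour_lists 31 ((!) halin_nb)"
  proof
    show "v = w" if u: "u < 31" and vw: "v \<in> set (halin_nb ! u)" "w \<in> set (halin_nb ! u)" "v < u" "w < u" for u v w
    proof -
      have "v \<in> set (filter (\<lambda>v. v < u) (halin_nb ! u))" "w \<in> set (filter (\<lambda>v. v < u) (halin_nb ! u))"
        using vw by auto
      moreover obtain x where "set (filter (\<lambda>v. v < u) (halin_nb ! u)) \<subseteq> {x}"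
        using *(4)[OF u] by (cases "filter (\<lambda>v. v < u) (halin_nb ! u)") auto
      ultimately show ?thesis by blast
    qed
    show "distinct (halin_nb ! u)" if "u < 31" for u using *(1) that .
    show "v < 31 \<and> v \<noteq> u \<and> u \<in> set (halin_nb ! v)" if "u < 31" "v \<in> set (halin_nb ! u)" for u v
      using *(2) that by blast
    show "\<exists>p<u. p \<in> set (halin_nb ! u)" if "0 < u" "u < 31" for u using *(3)[OF that(2)] that(1) by blast
  qed simp
qed

lemma next_leaf_halin: "next_leaf hal.T hal.rot a b \<longleftrightarrow> (a, b) \<in> set halin_rim"
proof -
  have rim: "list_all (\<lambda>(a, b). a < 31 \<and> b < 31 \<and> length (halin_nb ! a) = 1 \<and> length (halin_nb ! b) = 1 \<and>
      hal.walk (Suc (Suc (Suc (Suc 0)))) (hd (halin_nb ! a), a) = b) halin_rim"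
    by (simp add: halin_rim_def Let_def face_step_def hal.rot_def cyclic_next_def)
  \<comment> \<open>Every leaf has an entry in the rim, so uniqueness of the next leaf identifies
    the rim with the whole relation.\<close>
  have all: "list_all (\<lambda>a. length (halin_nb ! a) = 1 \<longrightarrow> a \<in> fst ` set halin_rim) (0 # 1 # [2..<31])"
    by (simp add: halin_rim_def halin_nb_table)
  have next_leaf: "next_leaf hal.T hal.rot a b' \<longleftrightarrow> b' = b" if "(a, b) \<in> set halin_rim" for a b b'
  proof -
    have *: "a < 31 \<and> b < 31 \<and> length (halin_nb ! a) = 1 \<and> length (halin_nb ! b) = 1 \<and>
        hal.walk (Suc (Suc (Suc (Suc 0)))) (hd (halin_nb ! a), a) = b"
      using bspec[OF rim[unfolded list_all_iff] that] unfolding prod.case .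
    then have "leaf hal.T a" "leaf hal.T (hal.walk (Suc (Suc (Suc (Suc 0)))) (hd (halin_nb ! a), a))"
      by (simp_all only: hal.leaf_T)
    from hal.next_leaf_walk[OF this, of b'] show ?thesis
      unfolding *[THEN conjunct2, THEN conjunct2, THEN conjunct2, THEN conjunct2] .
  qed
  show ?thesis
  proof
    assume nl: "next_leaf hal.T hal.rot a b"
    then have "a < 31" "length (halin_nb ! a) = 1" by (simp_all add: next_leaf_def hal.leaf_T)
    then have "a \<in> fst ` set halin_rim" using all unfolding less_31_list list_all_iff by blast
    then obtain b' where "(a, b') \<in> set halin_rim" by auto
    then show "(a, b) \<in> set halin_rim" using nl next_leaf[of a b' b] by simp
  qed (simp add: next_leaf)
qed

definition halin_E :: "nat set set" where
  "halin_E = hal.T \<union> {{a, b} | a b. (a, b) \<in> set halin_rim}"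

lemma halin_halin_E: "halin {..<31} halin_E"
  unfolding halin_E_def
proof (rule hal.halin)
  have "list_all (\<lambda>v. length (halin_nb ! v) \<noteq> 2) (0 # 1 # [2..<31])" by (simp add: halin_nb_table)
  then show "length (halin_nb ! v) \<noteq> 2" if "v < 31" for v
    using that unfolding less_31_list list_all_iff by blast
  have "list_all (\<lambda>(a, b). a < 31 \<and> b < 31 \<and> a \<noteq> b) halin_rim" by (simp add: halin_rim_def)
  then show "a < 31 \<and> b < 31 \<and> a \<noteq> b" if "(a, b) \<in> set halin_rim" for a b
    using that unfolding list_all_iff by blast
qed (simp_all add: next_leaf_halin)

definition halin_arcs :: "(nat \<times> nat) set" where
  "halin_arcs = arcs id halin_E"

lemma halin_arcs_iff:
  "(u, v) \<in> halin_arcs \<longleftrightarrow> u < 31 \<and> v \<in> set (halin_nb ! u) \<or> (u, v) \<in> set halin_rim \<or> (v, u) \<in> set halin_rim"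
proof -
  have "(u, v) \<in> halin_arcs \<longleftrightarrow> {u, v} \<in> halin_E" by (auto simp: halin_arcs_def arcs_def)
  also have "\<dots> \<longleftrightarrow> {u, v} \<in> hal.T \<or> (u, v) \<in> set halin_rim \<or> (v, u) \<in> set halin_rim"
    unfolding halin_E_def by (auto simp: doubleton_eq_iff)
  finally show ?thesis by (simp add: hal.edge_T)
qed

text \<open>Stated over the explicit lists so that simplification yields a rewrite rule for each
  arc, used to check the clause instances.\<close>

lemma halin_arcs_facts:
  "list_all (\<lambda>u. list_all (\<lambda>v. (u, v) \<in> halin_arcs) (halin_nb ! u)) (0 # 1 # [2..<31])"
  "list_all (\<lambda>(a, b). (a, b) \<in> halin_arcs \<and> (b, a) \<in> halin_arcs) halin_rim"
  unfolding list_all_iff using less_31_list halin_arcs_iff by blast+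

lemmas halin_arcs_table =
  halin_arcs_facts(1)[simplified]
  halin_arcs_facts(2)[unfolded halin_rim_def, simplified]

lemma halin_arcs_subset: "halin_arcs \<subseteq> {..<31} \<times> {..<31}"
proof -
  have "graph {..<31} halin_E" using halin_halin_E unfolding halin_def by blast
  then have "a < 31 \<and> b < 31" if "{a, b} \<in> halin_E" for a b
    using that unfolding graph_def by (metis doubleton_eq_iff lessThan_iff)
  then show ?thesis unfolding halin_arcs_def arcs_def by auto
qed

section \<open>The track number of the Halin graph\<close>

lemma halin_no_4_tracks_111:
  assumes lay: "rank_layout {..<31} halin_arcs 4 \<tau> L" and eq: "\<tau> 11 = \<tau> 1" "\<tau> 21 = \<tau> 1"
    and "distinct [\<tau> 0, \<tau> 1]"
  shows False
proof -
  have "set [\<tau> 0, \<tau> 1] \<subseteq> {..<4}" using rank_layout_lt[OF lay] by simp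
  with assms(4) obtain ks where ks: "length ks = 4" "set ks = {..<4}"
    and nth: "\<And>i. i < length [\<tau> 0, \<tau> 1] \<Longrightarrow> ks ! i = [\<tau> 0, \<tau> 1] ! i"
    by (rule extend_to_track_list) blast
  have fixed: "\<tau> 0 = ks ! 0" "\<tau> 1 = ks ! 1" "\<tau> 11 = ks ! 1" "\<tau> 21 = ks ! 1"
    using nth[of 0] nth[of 1] eq by (auto simp: eval_nat_numeral)
  have cs: "{..<4} \<subseteq> set [0, 1, 2, 3 :: nat]" by auto
  show False
    apply (rule halin_clauses_unsat_111[of "\<lambda>v i. \<tau> v = ks ! i" "\<lambda>u v. \<tau> u = \<tau> v" L])
             apply (simp_all only: fixed simp_thms)[4]
    subgoal
      by (rule colour_instances[OF lay ks cs, where fx = "[(0, 0), (1, 1), (11, 1), (21, 1)]"])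
        (simp_all add: fixed[unfolded One_nat_def] halin_arcs_table)
    subgoal by (rule proper_instances[OF lay]) (unfold list.set ball_simps prod.case, simp add: halin_arcs_table)
    subgoal by (rule same_instances)
    subgoal by (rule cross_instances[OF lay]) (unfold list.set ball_simps prod.case, simp add: halin_arcs_table)
    subgoal
      by (rule cross_flip_instances[OF lay halin_arcs_subset])
        (unfold list.set ball_simps prod.case, simp add: halin_arcs_table)
    subgoal by (rule trans_instances[OF lay]) (unfold list.set ball_simps prod.case, simp)
    subgoal by (rule negtrans_instances[OF lay]) (unfold list.set ball_simps prod.case, simp)
    done
qed

lemma halin_no_4_tracks_112:
  assumes lay: "rank_layout {..<31} halin_arcs 4 \<tau> L" and eq: "\<tau> 11 = \<tau> 1"
    and "distinct [\<tau> 0, \<tau> 1, \<tau> 21]"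
  shows False
proof -
  have "set [\<tau> 0, \<tau> 1, \<tau> 21] \<subseteq> {..<4}" using rank_layout_lt[OF lay] by simp
  with assms(3) obtain ks where ks: "length ks = 4" "set ks = {..<4}"
    and nth: "\<And>i. i < length [\<tau> 0, \<tau> 1, \<tau> 21] \<Longrightarrow> ks ! i = [\<tau> 0, \<tau> 1, \<tau> 21] ! i"
    by (rule extend_to_track_list) blast
  have fixed: "\<tau> 0 = ks ! 0" "\<tau> 1 = ks ! 1" "\<tau> 11 = ks ! 1" "\<tau> 21 = ks ! 2"
    using nth[of 0] nth[of 1] nth[of 2] eq by (auto simp: eval_nat_numeral)
  have cs: "{..<4} \<subseteq> set [0, 1, 2, 3 :: nat]" by auto
  show False
    apply (rule halin_clauses_unsat_112[of "\<lambda>v i. \<tau> v = ks ! i" "\<lambda>u v. \<tau> u = \<tau> v" L])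
             apply (simp_all only: fixed simp_thms)[4]
    subgoal
      by (rule colour_instances[OF lay ks cs, where fx = "[(0, 0), (1, 1), (11, 1), (21, 2)]"])
        (simp_all add: fixed[unfolded One_nat_def] halin_arcs_table)
    subgoal by (rule proper_instances[OF lay]) (unfold list.set ball_simps prod.case, simp add: halin_arcs_table)
    subgoal by (rule same_instances)
    subgoal by (rule cross_instances[OF lay]) (unfold list.set ball_simps prod.case, simp add: halin_arcs_table)
    subgoal
      by (rule cross_flip_instances[OF lay halin_arcs_subset])
        (unfold list.set ball_simps prod.case, simp add: halin_arcs_table)
    subgoal by (rule trans_instances[OF lay]) (unfold list.set ball_simps prod.case, simp)
    subgoal by (rule negtrans_instances[OF lay]) (unfold list.set ball_simps prod.case, simp)
    done
qed

lemma halin_no_4_tracks_123: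
  assumes lay: "rank_layout {..<31} halin_arcs 4 \<tau> L" and dist: "distinct [\<tau> 0, \<tau> 1, \<tau> 11, \<tau> 21]"
  shows False
proof -
  have "set [\<tau> 0, \<tau> 1, \<tau> 11, \<tau> 21] \<subseteq> {..<4}" using rank_layout_lt[OF lay] by simp
  with dist obtain ks where ks: "length ks = 4" "set ks = {..<4}"
    and nth: "\<And>i. i < length [\<tau> 0, \<tau> 1, \<tau> 11, \<tau> 21] \<Longrightarrow> ks ! i = [\<tau> 0, \<tau> 1, \<tau> 11, \<tau> 21] ! i"
    by (rule extend_to_track_list) blast
  have fixed: "\<tau> 0 = ks ! 0" "\<tau> 1 = ks ! 1" "\<tau> 11 = ks ! 2" "\<tau> 21 = ks ! 3"
    using nth[of 0] nth[of 1] nth[of 2] nth[of 3] by (auto simp: eval_nat_numeral)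
  have cs: "{..<4} \<subseteq> set [0, 1, 2, 3 :: nat]" by auto
  show False
    apply (rule halin_clauses_unsat_123[of "\<lambda>v i. \<tau> v = ks ! i" "\<lambda>u v. \<tau> u = \<tau> v" L])
             apply (simp_all only: fixed simp_thms)[4]
    subgoal
      by (rule colour_instances[OF lay ks cs, where fx = "[(0, 0), (1, 1), (11, 2), (21, 3)]"])
        (simp_all add: fixed[unfolded One_nat_def] halin_arcs_table)
    subgoal by (rule proper_instances[OF lay]) (unfold list.set ball_simps prod.case, simp add: halin_arcs_table)
    subgoal by (rule same_instances)
    subgoal by (rule cross_instances[OF lay]) (unfold list.set ball_simps prod.case, simp add: halin_arcs_table)
    subgoal
      by (rule cross_flip_instances[OF lay halin_arcs_subset])
        (unfold list.set ball_simps prod.case, simp add: halin_arcs_table)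
    subgoal by (rule trans_instances[OF lay]) (unfold list.set ball_simps prod.case, simp)
    subgoal by (rule negtrans_instances[OF lay]) (unfold list.set ball_simps prod.case, simp)
    done
qed

text \<open>The branches at the hub occupy 1 to 10, 11 to 20 and 21 to 30 with identical internal
  numbering; shifting by ten permutes them cyclically and is an automorphism.\<close>

definition halin_rotation :: "nat \<Rightarrow> nat" where
  "halin_rotation v = (if v = 0 then 0 else if v \<le> 20 then v + 10 else v - 20)"

text \<open>A layout pulls back along a symmetry of the graph; injectivity is what carries
  distinctness of vertices over to their images.\<close>

lemma rank_layout_relabel:
  assumes lay: "rank_layout N F t \<tau> L" and N: "\<And>v. v \<in> N \<Longrightarrow> \<rho> v \<in> N" and inj: "inj_on \<rho> N"
    and F: "\<And>u v. (u, v) \<in> F \<Longrightarrow> (\<rho> u, \<rho> v) \<in> F" and FN: "F \<subseteq> N \<times> N"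
  shows "rank_layout N F t (\<lambda>v. \<tau> (\<rho> v)) (\<lambda>u v. L (\<rho> u) (\<rho> v))"
proof (rule rank_layoutI)
  have ne: "\<rho> u \<noteq> \<rho> v" if "u \<in> N" "v \<in> N" "u \<noteq> v" for u v using inj that by (meson inj_onD)
  show "\<tau> (\<rho> v) < t" if "v \<in> N" for v using rank_layout_lt[OF lay N[OF that]] .
  show "\<tau> (\<rho> u) \<noteq> \<tau> (\<rho> v)" if "(u, v) \<in> F" for u v using rank_layout_proper[OF lay F[OF that]] .
  show "(L (\<rho> u) (\<rho> v) \<or> L (\<rho> v) (\<rho> u)) \<and> \<not> (L (\<rho> u) (\<rho> v) \<and> L (\<rho> v) (\<rho> u))"
    if "u \<in> N" "v \<in> N" "u \<noteq> v" for u v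
    using rank_layout_total[OF lay N N ne] that by blast
  show "L (\<rho> u) (\<rho> w)"
    if "u \<in> N" "v \<in> N" "w \<in> N" "u \<noteq> v" "v \<noteq> w" "u \<noteq> w" "L (\<rho> u) (\<rho> v)" "L (\<rho> v) (\<rho> w)" for u v w
    using rank_layout_trans[OF lay N[OF that(1)] N[OF that(2)] N[OF that(3)] ne ne ne that(7,8)] that by blast
  show "L (\<rho> u) (\<rho> x) \<longleftrightarrow> L (\<rho> v) (\<rho> y)"
    if "(u, v) \<in> F" "(x, y) \<in> F" "u \<noteq> x" "v \<noteq> y" "\<tau> (\<rho> u) = \<tau> (\<rho> x)" "\<tau> (\<rho> v) = \<tau> (\<rho> y)" for u v x y
    using rank_layout_cross[OF lay F[OF that(1)] F[OF that(2)] ne ne that(5,6)] that FN by blast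
qed

lemma rank_layout_halin_rotation:
  assumes "rank_layout {..<31} halin_arcs t \<tau> L"
  shows "rank_layout {..<31} halin_arcs t (\<lambda>v. \<tau> (halin_rotation v)) (\<lambda>u v. L (halin_rotation u) (halin_rotation v))"
proof (rule rank_layout_relabel[OF assms _ _ _ halin_arcs_subset])
  show "halin_rotation v \<in> {..<31}" if "v \<in> {..<31}" for v using that by (auto simp: halin_rotation_def)
  show "inj_on halin_rotation {..<31}" by (auto simp: inj_on_def halin_rotation_def split: if_splits)
  have 1: "list_all (\<lambda>u. list_all (\<lambda>v. (halin_rotation u, halin_rotation v) \<in> halin_arcs) (halin_nb ! u)) (0 # 1 # [2..<31])"
    by (simp add: halin_nb_table halin_rotation_def halin_arcs_table)
  have 2: "list_all (\<lambda>(a, b). (halin_rotation a, halin_rotation b) \<in> halin_arcs \<and>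
      (halin_rotation b, halin_rotation a) \<in> halin_arcs) halin_rim"
    by (simp add: halin_rim_def halin_rotation_def halin_arcs_table)
  show "(halin_rotation u, halin_rotation v) \<in> halin_arcs" if "(u, v) \<in> halin_arcs" for u v
    using that 1 2 unfolding halin_arcs_iff[of u v] less_31_list list_all_iff by blast
qed

text \<open>If exactly two children of the hub share a track, a rotation moves the third one to
  vertex 21: no rotation if it is 21 already, one if it is 1, two if it is 11.\<close>

lemma halin_no_4_tracks: "\<not> rank_layout {..<31} halin_arcs 4 \<tau> L"
proof
  assume lay: "rank_layout {..<31} halin_arcs 4 \<tau> L"
  have hub: "\<tau> 0 \<noteq> \<tau> 1" "\<tau> 0 \<noteq> \<tau> 11" "\<tau> 0 \<noteq> \<tau> 21"
    using rank_layout_proper[OF lay] by (simp_all add: halin_arcs_table)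
  note lay' = rank_layout_halin_rotation[OF lay]
  note lay'' = rank_layout_halin_rotation[OF lay']
  consider "\<tau> 1 = \<tau> 11" "\<tau> 11 = \<tau> 21" | "\<tau> 1 = \<tau> 11" "\<tau> 1 \<noteq> \<tau> 21" | "\<tau> 11 = \<tau> 21" "\<tau> 1 \<noteq> \<tau> 11"
    | "\<tau> 21 = \<tau> 1" "\<tau> 1 \<noteq> \<tau> 11" | "\<tau> 1 \<noteq> \<tau> 11" "\<tau> 1 \<noteq> \<tau> 21" "\<tau> 11 \<noteq> \<tau> 21" by metis
  then show False
  proof cases
    case 1 show ?thesis by (rule halin_no_4_tracks_111[OF lay]) (use 1 hub in \<open>simp_all\<close>)
  next
    case 2 show ?thesis by (rule halin_no_4_tracks_112[OF lay]) (use 2 hub in \<open>simp_all\<close>)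
  next
    case 3 show ?thesis by (rule halin_no_4_tracks_112[OF lay']) (use 3 hub in \<open>simp_all add: halin_rotation_def\<close>)
  next
    case 4 show ?thesis by (rule halin_no_4_tracks_112[OF lay'']) (use 4 hub in \<open>simp_all add: halin_rotation_def\<close>)
  next
    case 5 show ?thesis by (rule halin_no_4_tracks_123[OF lay]) (use 5 hub in \<open>simp_all\<close>)
  qed
qed

definition halin_track :: "nat list" where
  "halin_track =
    [0, 1, 3, 2, 0, 4, 3, 0, 3, 4, 0, 2, 3, 0, 4, 3, 2, 4, 3, 1, 0, 4, 1, 0, 1, 1, 0, 2, 3, 0, 1]"

definition halin_pos :: "nat list" where
  "halin_pos =
    [4, 14, 23, 18, 8, 30, 25, 7, 24, 29, 6, 16, 21, 5, 27, 22, 17, 28, 20, 12, 2, 26, 11, 1, 10, 9,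
    0, 15, 19, 3, 13]"

text \<open>A certificate of the same form as for the X-tree; these tables have no filler entry,
  since the vertices are numbered from 0.\<close>

definition halin_chains :: "(nat \<times> nat \<times> (nat \<times> nat) list) list" where
  "halin_chains =
    [(0,1,[(26,25), (26,24), (23,24), (23,22), (20,22), (20,19), (29,30), (0,1), (10,1), (4,1)]),
    (0,2,[(26,27), (20,11), (0,11), (13,11), (4,3)]), (0,3,[(29,28), (13,12), (10,12), (7,8),
    (7,6), (4,6)]), (0,4,[(23,21), (29,21), (0,21), (13,14), (10,9), (7,5)]), (1,2,[(25,27),
    (19,11), (1,3)]), (1,3,[(19,18), (30,2), (1,2), (1,8)]), (1,4,[(25,21), (24,21), (22,21),
    (30,21), (1,9), (1,5)]), (2,3,[(27,28), (11,18), (11,12), (11,15), (16,15), (3,2)]),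
    (2,4,[(11,14), (16,14), (16,17)]), (3,4,[(28,21), (18,17), (15,17), (8,9), (6,5)])]"

lemma halin_5_tracks:
  "rank_layout {..<31} halin_arcs 5 ((!) halin_track) (\<lambda>u v. halin_pos ! u < halin_pos ! v)"
proof (rule chains_imp_rank_layout)
  have "length halin_track = 31" "length halin_pos = 31" by (simp_all add: halin_track_def halin_pos_def)
  note track = nth_table[OF halin_track_def this(1), simplified]
    and pos = nth_table[OF halin_pos_def this(2), simplified]
  have N: "{..<31} = set (0 # 1 # [2..<31 :: nat])" using less_31_list by blast
  show "\<forall>v\<in>{..<31}. halin_track ! v < 5"
    unfolding N by (simp add: track del: set_upt)
  have "distinct (map ((!) halin_pos) (0 # 1 # [2..<31]))" by (simp add: pos)
  then show "inj_on ((!) halin_pos) {..<31}" unfolding N distinct_map by blast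
  show "halin_arcs \<subseteq> {..<31} \<times> {..<31}" by (rule halin_arcs_subset)
  show "\<forall>(i, j, es)\<in>set halin_chains. i < j \<and> (\<forall>(u, v)\<in>set es. halin_track ! u = i \<and> halin_track ! v = j) \<and>
      successively (\<lambda>(u, v) (x, y). halin_pos ! u \<le> halin_pos ! x \<and> halin_pos ! v \<le> halin_pos ! y) es"
    by (simp add: track pos halin_chains_def)
  show "distinct (map (\<lambda>(i, j, es). (i, j)) halin_chains)" by (simp add: halin_chains_def)
  let ?in = "\<lambda>u v. \<exists>(i, j, es)\<in>set halin_chains. (u, v) \<in> set es \<or> (v, u) \<in> set es"
  have nbs: "list_all (\<lambda>u. list_all (\<lambda>v. ?in u v) (halin_nb ! u)) (0 # 1 # [2..<31])"
    by (simp add: halin_nb_table halin_chains_def)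
  have rims: "list_all (\<lambda>(a, b). ?in a b) halin_rim"
    by (simp add: halin_rim_def halin_chains_def)
  have "?in u v" if "(u, v) \<in> halin_arcs" for u v
  proof -
    consider "u < 31" "v \<in> set (halin_nb ! u)" | "(u, v) \<in> set halin_rim" | "(v, u) \<in> set halin_rim"
      using \<open>(u, v) \<in> halin_arcs\<close> halin_arcs_iff by blast
    then show ?thesis
    proof cases
      case 1
      then show ?thesis using nbs unfolding less_31_list list_all_iff by blast
    next
      case 2
      then show ?thesis using rims unfolding list_all_iff by blast
    next
      case 3
      then have "?in v u" using rims unfolding list_all_iff by blast
      then show ?thesis by blast
    qed
  qed
  then show "\<forall>(u, v)\<in>halin_arcs. ?in u v" by blast
qed

lemma halin_track_number: "track_number {..<31} halin_E = 5"
proof -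
  have "track_number {..<31} halin_E = Suc 4"
  proof (rule track_number_eqI[OF _ inj_on_id])
    show "graph {..<31} halin_E" using halin_halin_E unfolding halin_def by blast
    show "rank_layout (id ` {..<31}) (arcs id halin_E) (Suc 4) ((!) halin_track)
        (\<lambda>u v. halin_pos ! u < halin_pos ! v)"
      using halin_5_tracks by (simp add: halin_arcs_def)
    show "\<not> rank_layout (id ` {..<31}) (arcs id halin_E) 4 \<tau> L" for \<tau> L
      using halin_no_4_tracks by (simp add: halin_arcs_def)
  qed
  then show ?thesis by simp
qed

section \<open>Weakly leveled planar graphs\<close>

text \<open>Vertices are numbered level by level and from left to right, so \<open>u\<close> and
  \<open>u + 1\<close> on one level are neighbours along it, and every level induces a path. The set
  \<open>S\<close> holds the edges between consecutive levels, directed towards the higher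
  level.\<close>

definition strip_arcs :: "nat \<Rightarrow> (nat \<Rightarrow> nat) \<Rightarrow> (nat \<times> nat) set \<Rightarrow> (nat \<times> nat) set" where
  "strip_arcs n lev S = {(u, u + 1) | u. u + 1 < n \<and> lev (u + 1) = lev u} \<union> S"

definition strip_edges :: "nat \<Rightarrow> (nat \<Rightarrow> nat) \<Rightarrow> (nat \<times> nat) set \<Rightarrow> nat set set" where
  "strip_edges n lev S = {{u, v} | u v. (u, v) \<in> strip_arcs n lev S}"

lemma real_gap_unit:
  assumes "real a + r = real b" "0 \<le> r" "r \<le> 1"
  shows "r = 0 \<or> r = 1"
proof -
  have "b = a \<or> b = a + 1" using assms by linarith
  then show ?thesis using assms(1) by auto
qed

text \<open>\<open>S_chain\<close> expresses planarity between two consecutive levels: two edges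
  there never exchange their left-to-right order. For edges starting on different levels it is
  consistent with \<open>lev_mono\<close>, which already puts both ends of one before those of the
  other.\<close>

locale strip_graph =
  fixes n :: nat and lev :: "nat \<Rightarrow> nat" and S :: "(nat \<times> nat) set"
  assumes lev_mono: "u \<le> v \<Longrightarrow> lev u \<le> lev v"
    and S: "(u, v) \<in> S \<Longrightarrow> v < n \<and> lev v = lev u + 1"
    and S_chain: "(u, v) \<in> S \<Longrightarrow> (x, y) \<in> S \<Longrightarrow> u \<le> x \<and> v \<le> y \<or> x \<le> u \<and> y \<le> v"
begin

abbreviation "D \<equiv> strip_arcs n lev S"
abbreviation "E \<equiv> strip_edges n lev S"

lemma D_cases:
  assumes "(u, v) \<in> D"
  obtains (step) "v = u + 1" "lev v = lev u" "v < n"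
  | (strip) "(u, v) \<in> S" "lev v = lev u + 1" "v < n" "u < v"
  using assms S lev_mono[of v u] unfolding strip_arcs_def by fastforce

lemma D_less: "(u, v) \<in> D \<Longrightarrow> u < v \<and> v < n"
  by (erule D_cases) auto

lemma edge_iff: "{u, v} \<in> E \<longleftrightarrow> (u, v) \<in> D \<or> (v, u) \<in> D"
  unfolding strip_edges_def by (auto simp: doubleton_eq_iff)

lemma graph: "graph {..<n} E"
  unfolding graph_def
proof (intro conjI ballI)
  fix e assume "e \<in> E"
  then obtain u v where "e = {u, v}" "(u, v) \<in> D" unfolding strip_edges_def by blast
  then show "\<exists>u v. e = {u, v} \<and> u \<noteq> v \<and> u \<in> {..<n} \<and> v \<in> {..<n}"
    using D_less[of u v] by fastforce
qed simp

abbreviation P :: "nat \<Rightarrow> real \<times> real" where "P v \<equiv> (real v, real (lev v))"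

lemma segment_D:
  assumes "(u, v) \<in> D" and "p \<in> closed_segment (P u) (P v)"
  obtains s where "0 \<le> s" "s \<le> 1" "fst p = real u + s * (real v - real u)"
    "snd p = real (lev u) + s * (real (lev v) - real (lev u))"
  using assms(2) unfolding in_segment by (auto simp: algebra_simps)

text \<open>Along an edge one coordinate grows by exactly 1: the horizontal one within a level, the
  vertical one between levels. It is integral at vertices, so a vertex on the segment must be at an
  end.\<close>

lemma vertex_in_segment:
  assumes "(u, v) \<in> D" and "P w \<in> closed_segment (P u) (P v)"
  shows "w = u \<or> w = v"
proof -
  obtain s where s: "0 \<le> s" "s \<le> 1" "real w = real u + s * (real v - real u)"
    "real (lev w) = real (lev u) + s * (real (lev v) - real (lev u))"
    using segment_D[OF assms] by auto
  from assms(1) show ?thesis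
  proof (cases rule: D_cases)
    case step
    then have "real w = real u + s" using s by simp
    then have "w = u \<or> w = u + 1" using s(1,2) by linarith
    then show ?thesis using step by simp
  next
    case strip
    then have "real (lev w) = real (lev u) + s" using s by simp
    then have "lev w = lev u \<or> lev w = lev u + 1" using s(1,2) by linarith
    then have "s = 0 \<or> s = 1" using \<open>real (lev w) = real (lev u) + s\<close> by auto
    then show ?thesis using s(3) by auto
  qed
qed

text \<open>The segment parameter measures horizontal distance within a level and height between
  levels. Comparing it with the integral coordinates of the vertices leaves, away from the ends,
  only two edges between the same two levels, and there \<open>S_chain\<close> excludes a
  meeting.\<close>

lemma segments_meet_at_vertex:
  assumes uv: "(u, v) \<in> D" and xy: "(x, y) \<in> D" and ne: "(u, v) \<noteq> (x, y)"
    and p: "p \<in> closed_segment (P u) (P v)" "p \<in> closed_segment (P x) (P y)"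
  shows "\<exists>w. p = P w"
proof -
  obtain s where s: "0 \<le> s" "s \<le> 1" "fst p = real u + s * (real v - real u)"
    "snd p = real (lev u) + s * (real (lev v) - real (lev u))"
    using segment_D[OF uv p(1)] .
  obtain r where r: "0 \<le> r" "r \<le> 1" "fst p = real x + r * (real y - real x)"
    "snd p = real (lev x) + r * (real (lev y) - real (lev x))"
    using segment_D[OF xy p(2)] .
  have "s = 0 \<Longrightarrow> p = P u" "s = 1 \<Longrightarrow> p = P v" using s(3,4) by (simp_all add: prod_eq_iff)
  then have s01: "\<exists>w. p = P w" if "s = 0 \<or> s = 1" using that by blast
  have "r = 0 \<Longrightarrow> p = P x" "r = 1 \<Longrightarrow> p = P y" using r(3,4) by (simp_all add: prod_eq_iff)
  then have r01: "\<exists>w. p = P w" if "r = 0 \<or> r = 1" using that by blast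
  from uv show ?thesis
  proof (cases rule: D_cases)
    case uv': step
    from xy show ?thesis
    proof (cases rule: D_cases)
      case step
      have "real u + s = real x + r" using s r uv' step by simp
      moreover have "u \<noteq> x" using ne uv' step by auto
      ultimately have "s = 0 \<or> s = 1" using s(1,2) r(1,2) by linarith
      then show ?thesis using s01 by blast
    next
      case strip
      have "real (lev x) + r = real (lev u)" using s r uv' strip by simp
      then have "r = 0 \<or> r = 1" using real_gap_unit r(1,2) by blast
      then show ?thesis using r01 by blast
    qed
  next
    case uv': strip
    from xy show ?thesis
    proof (cases rule: D_cases)
      case step
      have "real (lev u) + s = real (lev x)" using s r uv' step by simp
      then have "s = 0 \<or> s = 1" using real_gap_unit s(1,2) by blast
      then show ?thesis using s01 by blast
    next
      case strip
      have lv: "real (lev u) + s = real (lev x) + r" using s r uv' strip by simp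
      show ?thesis
      proof (cases "lev u = lev x")
        case False
        then have "s = 0 \<or> s = 1" using lv s(1,2) r(1,2) by linarith
        then show ?thesis using s01 by blast
      next
        case True
        then have "s = r" using lv by simp
        \<comment> \<open>At relative height \<open>s\<close> the horizontal distance of the two
          edges is the convex combination of the distances at their ends. By \<open>S_chain\<close>
          these have the same sign, so for \<open>0 < s < 1\<close> both vanish and the edges
          coincide.\<close>
        then have eq: "(1 - s) * (real x - real u) + s * (real y - real v) = 0"
          using s(3) r(3) by (simp add: algebra_simps)
        have "\<not> (0 < s \<and> s < 1)"
        proof
          assume "0 < s \<and> s < 1"
          then have pos: "0 < s" "0 < 1 - s" by auto
          have "u \<le> x \<and> v \<le> y \<or> x \<le> u \<and> y \<le> v" using S_chain uv'(1) strip(1) .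
          then show False
          proof
            assume "u \<le> x \<and> v \<le> y"
            then have "0 \<le> (1 - s) * (real x - real u)" "0 \<le> s * (real y - real v)" using pos by auto
            then have "(1 - s) * (real x - real u) = 0" "s * (real y - real v) = 0" using eq by linarith+
            then show False using pos ne by auto
          next
            assume "x \<le> u \<and> y \<le> v"
            then have "(1 - s) * (real x - real u) \<le> 0" "s * (real y - real v) \<le> 0"
              using pos by (auto simp: mult_le_0_iff)
            then have "(1 - s) * (real x - real u) = 0" "s * (real y - real v) = 0" using eq by linarith+
            then show False using pos ne by auto
          qed
        qed
        then show ?thesis using s01 s(1,2) by fastforce
      qed
    qed
  qed
qed

lemma segments_D:
  assumes "(u, v) \<in> D" "(x, y) \<in> D" "(u, v) \<noteq> (x, y)"
  shows "closed_segment (P u) (P v) \<inter> closed_segment (P x) (P y) \<subseteq> P ` ({u, v} \<inter> {x, y})"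
proof
  fix p assume p: "p \<in> closed_segment (P u) (P v) \<inter> closed_segment (P x) (P y)"
  then obtain w where w: "p = P w" using segments_meet_at_vertex[OF assms] by blast
  then have "w = u \<or> w = v" "w = x \<or> w = y"
    using p vertex_in_segment assms by blast+
  then show "p \<in> P ` ({u, v} \<inter> {x, y})" using w by blast
qed

lemma weakly_leveled_planar: "weakly_leveled_planar {..<n} E"
  unfolding weakly_leveled_planar_def Let_def
proof (intro exI conjI allI impI)
  show "strict_mono real" by (simp add: strict_mono_def)
  show "inj_on P {..<n}" by (auto simp: inj_on_def)
  show "lev u = lev v + 1 \<or> lev v = lev u + 1 \<or> lev u = lev v \<and>
      \<not> (\<exists>w\<in>{..<n}. lev w = lev u \<and> min (real u) (real v) < real w \<and> real w < max (real u) (real v))"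
    if "{u, v} \<in> E" for u v
    using that unfolding edge_iff by (elim disjE D_cases) (auto simp: min_def max_def)
  show "P w \<notin> closed_segment (P u) (P v)"
    if "{u, v} \<in> E" "w \<in> {..<n}" "w \<noteq> u" "w \<noteq> v" for u v w
    using that vertex_in_segment[of u v w] vertex_in_segment[of v u w]
    unfolding edge_iff by (auto simp: closed_segment_commute)
  show "closed_segment (P u) (P v) \<inter> closed_segment (P x) (P y) \<subseteq> P ` ({u, v} \<inter> {x, y})"
    if "{u, v} \<in> E" "{x, y} \<in> E" "{u, v} \<noteq> {x, y}" for u v x y
  proof -
    have ne: "(u, v) \<noteq> (x, y)" "(u, v) \<noteq> (y, x)" "(v, u) \<noteq> (x, y)" "(v, u) \<noteq> (y, x)"
      using that(3) by (auto simp: doubleton_eq_iff)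
    show ?thesis
      using that(1,2) segments_D[OF _ _ ne(1)] segments_D[OF _ _ ne(2)] segments_D[OF _ _ ne(3)]
        segments_D[OF _ _ ne(4)]
      unfolding edge_iff by (elim disjE) (simp_all add: closed_segment_commute insert_commute)
  qed
qed

lemma arcs_id: "arcs id E = D \<union> D\<inverse>"
  unfolding arcs_def using edge_iff by auto

text \<open>The tracks of an edge determine the levels of its ends modulo 3, hence whether it stays
  on a level or goes up, and in which direction. Edges that go up in the same direction do not cross
  by \<open>S_chain\<close>. The parity separates the ends of an edge within a level, and the
  numbering itself serves as the order on all tracks.\<close>

lemma rank_layout_6: "rank_layout {..<n} (arcs id E) 6 (\<lambda>v. 2 * (lev v mod 3) + v mod 2) (<)"
proof -
  let ?\<tau> = "\<lambda>v. 2 * (lev v mod 3) + v mod 2"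
  have dec: "lev u mod 3 = lev v mod 3 \<and> u mod 2 = v mod 2" if "?\<tau> u = ?\<tau> v" for u v
  proof -
    have "a = a' \<and> b = b'" if "2 * a + b = 2 * a' + b'" "b < 2" "b' < 2" for a a' b b' :: nat
      using that by presburger
    then show ?thesis using that by simp
  qed
  have mod3: "(a + 1) mod 3 \<noteq> a mod 3" "(a + 1 + 1) mod 3 \<noteq> a mod 3" for a :: nat by presburger+
  have neq: "?\<tau> u \<noteq> ?\<tau> v" if "(u, v) \<in> D" for u v
  proof
    assume "?\<tau> u = ?\<tau> v"
    then have "lev u mod 3 = lev v mod 3" "u mod 2 = v mod 2" using dec by auto
    with that show False using mod3(1)[of "lev u"] by (elim D_cases) (simp, presburger, simp)
  qed
  have fwd: "u < x \<longleftrightarrow> v < y"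
    if "(u, v) \<in> D" "(x, y) \<in> D" "u \<noteq> x" "v \<noteq> y" "?\<tau> u = ?\<tau> x" "?\<tau> v = ?\<tau> y" for u v x y
  proof -
    have m: "lev u mod 3 = lev x mod 3" "lev v mod 3 = lev y mod 3" using dec that by auto
    from that(1) show ?thesis
    proof (cases rule: D_cases)
      case uv: step
      from that(2) show ?thesis
      proof (cases rule: D_cases)
        case step then show ?thesis using uv by simp
      next
        case strip then show ?thesis using uv m mod3(1)[of "lev x"] by simp
      qed
    next
      case uv: strip
      from that(2) show ?thesis
      proof (cases rule: D_cases)
        case step then show ?thesis using uv m mod3(1)[of "lev u"] by simp
      next
        case strip
        then show ?thesis using S_chain[OF uv(1) strip(1)] that(3,4) by linarith
      qed
    qed
  qed
  have opp: "u < y \<longleftrightarrow> v < x"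
    if "(u, v) \<in> D" "(x, y) \<in> D" "u \<noteq> y" "v \<noteq> x" "?\<tau> u = ?\<tau> y" "?\<tau> v = ?\<tau> x" for u v x y
  proof -
    have m: "lev u mod 3 = lev y mod 3" "lev v mod 3 = lev x mod 3"
      and e: "u mod 2 = y mod 2" "v mod 2 = x mod 2" using dec that by auto
    from that(1) show ?thesis
    proof (cases rule: D_cases)
      case uv: step
      from that(2) show ?thesis
      proof (cases rule: D_cases)
        case step
        \<comment> \<open>Two edges of level paths taken in opposite directions: \<open>u\<close>
          and \<open>x + 1\<close> have the same parity and differ, so they are at least 2 apart,
          which leaves room for the strict comparison at the other ends.\<close>
        have "u mod 2 = (x + 1) mod 2" "u \<noteq> x + 1" "u + 1 \<noteq> x" using e that(3,4) uv(1) step(1) by auto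
        then have "u < x + 1 \<longleftrightarrow> u + 1 < x" by presburger
        then show ?thesis using uv(1) step(1) by simp
      next
        case strip then show ?thesis using uv m mod3(1)[of "lev x"] by simp
      qed
    next
      case uv: strip
      from that(2) show ?thesis
      proof (cases rule: D_cases)
        case step then show ?thesis using uv m mod3(1)[of "lev u"] by simp
      next
        case strip
        \<comment> \<open>Opposite directions would force levels differing by 2 to agree modulo 3.
          This is why the tracks are repeated with period 3; with period 2 there would be no
          contradiction.\<close>
        then have "(lev u + 1) mod 3 = lev x mod 3" "lev u mod 3 = (lev x + 1) mod 3"
          using uv(2) m by auto
        then show ?thesis using mod3(2)[of "lev u"] by (metis mod_add_left_eq)
      qed
    qed
  qed
  show ?thesis
    unfolding arcs_id
  proof (rule rank_layoutI)
    show "?\<tau> v < 6" for v by presburger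
    show "?\<tau> u \<noteq> ?\<tau> v" if "(u, v) \<in> D \<union> D\<inverse>" for u v
      using that neq[of u v] neq[of v u] by auto
    show "u < x \<longleftrightarrow> v < y"
      if "(u, v) \<in> D \<union> D\<inverse>" "(x, y) \<in> D \<union> D\<inverse>" "u \<noteq> x" "v \<noteq> y" "?\<tau> u = ?\<tau> x" "?\<tau> v = ?\<tau> y" for u v x y
      using that(1,2) fwd[of u v x y] fwd[of v u y x] opp[of u v y x] opp[of v u x y] that(3-6)
      by (auto simp del: mod_mult_self1)
  qed auto
qed

end

text \<open>A core of the same kind for five tracks, with the triangle 6, 7, 14 fixed. Crossing
  clauses do almost all the work: transitivity enters only for the triple 1, 7, 19.\<close>

lemma strip_clauses_unsat:
  fixes col same before :: "nat \<Rightarrow> nat \<Rightarrow> bool"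
  assumes fixed: "col 6 0 = True" "col 7 1 = True" "col 14 2 = True"
    and some: "\<forall>(v,is)\<in>set
      [(0,[0,1,2,3,4]), (1,[1,2,3,4]), (2,[2,3,4]), (3,[0,2,3,4]), (4,[0,1,2,3,4]), (5,[1,3,4]),
      (8,[0,2,3,4]), (9,[0,1,2,3,4]), (10,[0,1,2,3,4]), (11,[0,1,2,3,4]), (12,[0,1,2,3,4]),
      (13,[0,1,3,4]), (15,[0,3,4]), (16,[0,2,3,4]), (17,[0,2,3,4]), (18,[0,2,3,4]),
      (19,[0,1,2,3,4]), (20,[0,1,3,4])].
      \<exists>i\<in>set is. col v i"
    and proper: "\<forall>(u,v,i)\<in>set
      [(0,1,1), (0,1,2), (0,1,3), (0,1,4), (0,2,3), (0,2,4), (0,3,0), (0,3,3), (0,3,4), (1,2,2),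
      (1,2,3), (1,2,4), (1,4,2), (1,5,1), (1,5,3), (1,5,4), (2,3,3), (2,3,4), (4,5,1), (4,9,3),
      (4,9,4), (5,9,1), (5,10,1), (5,10,3), (5,11,1), (5,11,3), (5,12,1), (5,12,3), (5,12,4),
      (5,13,1), (5,13,3), (5,13,4), (8,18,0), (8,18,2), (8,19,0), (8,19,2), (8,19,3), (8,19,4),
      (9,10,2), (9,20,3), (9,20,4), (10,11,0), (10,11,1), (10,11,3), (10,11,4), (10,20,0),
      (10,20,3), (10,20,4), (11,12,0), (11,12,1), (11,12,2), (11,12,3), (11,12,4), (11,20,0),
      (11,20,3), (11,20,4), (12,13,0), (12,13,1), (12,13,3), (12,13,4), (12,20,0), (12,20,3),
      (12,20,4), (13,20,0), (13,20,3), (13,20,4), (15,16,0), (15,16,3), (15,16,4), (15,20,0),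
      (15,20,3), (15,20,4), (16,17,0), (16,17,2), (16,17,3), (16,17,4), (16,20,0), (16,20,3),
      (16,20,4), (17,18,0), (17,18,3), (17,18,4), (17,20,3), (17,20,4), (18,19,0), (18,19,2),
      (18,20,3), (18,20,4), (19,20,3), (19,20,4)].
      \<not> (col u i \<and> col v i)"
    and same: "\<forall>(u,v,i)\<in>set
      [(0,5,1), (0,6,0), (0,7,1), (0,8,3), (0,8,4), (0,9,3), (0,9,4), (0,13,1), (0,14,2), (0,15,0),
      (0,15,3), (0,15,4), (0,20,3), (0,20,4), (1,7,1), (1,8,3), (1,8,4), (1,11,3), (1,11,4),
      (1,13,1), (1,13,3), (1,13,4), (1,14,2), (1,15,3), (1,15,4), (1,16,3), (1,16,4), (1,19,1),
      (1,20,3), (1,20,4), (2,4,3), (2,4,4), (2,5,3), (2,5,4), (2,8,3), (2,8,4), (2,10,3),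
      (2,10,4), (2,11,3), (2,11,4), (2,13,3), (2,13,4), (2,14,2), (2,15,3), (2,15,4), (2,16,3),
      (2,16,4), (2,17,3), (2,17,4), (2,18,2), (2,18,3), (2,18,4), (2,19,3), (2,19,4), (2,20,3),
      (2,20,4), (3,4,0), (3,5,3), (3,5,4), (3,6,0), (3,9,0), (3,9,3), (3,9,4), (3,13,0), (3,13,3),
      (3,13,4), (3,14,2), (3,18,0), (3,18,2), (3,19,0), (3,19,2), (3,20,3), (3,20,4), (5,7,1),
      (5,15,3), (5,15,4), (5,16,3), (5,16,4), (5,19,1), (5,20,3), (5,20,4), (6,8,0), (6,9,0),
      (6,10,0), (6,11,0), (6,12,0), (6,13,0), (6,15,0), (6,16,0), (6,17,0), (6,18,0), (6,19,0),
      (6,20,0), (7,12,1), (7,13,1), (7,19,1), (7,20,1), (10,12,0), (10,12,1), (10,12,3),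
      (10,12,4), (10,13,0), (10,13,1), (10,13,3), (10,13,4), (10,14,2), (11,13,0), (11,13,1),
      (11,13,3), (11,13,4), (11,14,2), (12,14,2), (13,15,0), (13,15,3), (13,15,4), (14,16,2),
      (14,17,2), (14,18,2), (15,17,0), (15,17,3), (15,17,4), (15,18,0), (15,18,3), (15,18,4),
      (16,18,0), (16,18,3), (16,18,4)].
      col u i \<longrightarrow> col v i \<longrightarrow> same u v"
    and cross: "\<forall>(u,v,x,y)\<in>set
      [(0,1,5,11), (0,1,5,13), (0,1,6,7), (0,1,7,14), (0,1,8,19), (0,1,13,20), (0,1,14,7), (0,1,14,20),
      (0,1,15,7), (0,1,15,20), (0,1,20,13), (0,1,20,19), (0,2,8,19), (0,2,9,4), (0,2,9,20),
      (0,2,13,5), (0,2,14,5), (0,2,14,20), (0,2,15,20), (0,2,20,15), (0,2,20,16), (0,2,20,17),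
      (0,2,20,18), (0,2,20,19), (0,3,5,6), (0,3,6,14), (0,3,8,18), (0,3,8,19), (0,3,9,4),
      (0,3,14,6), (0,3,15,20), (0,3,20,13), (0,3,20,14), (0,3,20,18), (0,3,20,19), (1,0,7,8),
      (1,2,7,8), (1,2,7,14), (1,2,7,15), (1,2,7,17), (1,2,7,18), (1,2,8,18), (1,2,8,19),
      (1,2,11,20), (1,2,13,5), (1,2,13,20), (1,2,14,5), (1,2,14,13), (1,2,14,20), (1,2,15,14),
      (1,2,15,20), (1,2,20,13), (1,2,20,14), (1,2,20,15), (1,2,20,18), (1,2,20,19), (1,5,7,15),
      (1,5,14,7), (1,5,14,15), (1,5,15,7), (1,5,16,7), (1,5,20,15), (1,5,20,19), (1,6,7,8),
      (1,6,7,15), (1,6,7,18), (1,6,14,15), (1,6,14,20), (1,6,15,20), (1,6,16,20), (1,6,19,8),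
      (1,6,20,13), (1,6,20,15), (1,6,20,16), (1,6,20,17), (1,6,20,18), (1,6,20,19), (2,0,5,6),
      (2,3,5,13), (2,3,5,14), (2,3,8,18), (2,3,8,19), (2,3,15,14), (2,3,15,20), (2,3,20,9),
      (2,3,20,13), (2,3,20,14), (2,6,5,13), (2,6,10,20), (2,6,11,20), (2,6,13,20), (2,6,14,15),
      (2,6,14,20), (2,6,18,8), (2,6,19,8), (2,6,20,9), (2,6,20,10), (2,6,20,11), (2,6,20,12),
      (2,6,20,13), (2,6,20,15), (2,7,5,13), (2,7,8,19), (2,7,20,13), (3,0,5,6), (3,0,6,7),
      (3,0,14,15), (3,7,20,13), (5,1,7,8), (5,6,7,15), (5,6,7,16), (5,6,7,17), (5,6,7,18),
      (5,6,15,20), (5,6,16,15), (5,6,16,20), (5,10,7,14), (5,10,20,12), (5,10,20,13),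
      (5,10,20,14), (5,11,7,14), (5,11,20,13), (5,11,20,14), (5,12,7,14), (5,12,20,14),
      (5,14,7,16), (5,14,7,18), (6,1,13,14), (6,1,18,19), (6,2,13,14), (6,2,15,16), (6,2,18,19),
      (6,7,13,12), (6,7,20,12), (6,7,20,13), (6,14,8,18), (6,14,15,16), (6,14,17,18),
      (6,14,20,16), (7,2,13,14), (7,14,20,16), (7,14,20,17), (7,14,20,18), (7,15,20,17),
      (7,15,20,18), (7,16,20,18), (12,5,14,15), (12,13,14,15), (13,5,15,16), (13,14,15,16),
      (14,5,18,19), (14,6,16,17), (14,6,18,19), (14,7,18,19)].
      same u x \<longrightarrow> same v y \<longrightarrow> (before u x \<longleftrightarrow> before v y)"
    and cross_flip: "\<forall>(u,v,x,y)\<in>set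
      [(1,5,7,2), (1,5,7,3), (2,7,4,5), (2,7,10,5), (2,7,11,5), (2,7,13,5), (2,7,14,5), (3,7,4,5),
      (3,7,9,5), (3,7,13,5), (3,7,14,5), (5,6,7,3), (5,12,15,7), (5,12,20,10), (5,13,15,7),
      (5,13,16,7), (5,13,20,10), (5,13,20,11), (5,14,20,10), (5,14,20,11), (5,14,20,12),
      (6,7,9,5), (6,7,10,5), (6,7,11,5), (6,7,12,5), (6,7,13,5), (6,14,20,10), (6,14,20,11),
      (6,14,20,12), (7,15,12,13), (7,16,13,14), (7,16,20,14), (7,17,20,14), (7,17,20,15),
      (7,18,20,14), (7,18,20,15), (7,18,20,16), (12,13,14,6)].
      same u x \<longrightarrow> same y v \<longrightarrow> (before u x \<longleftrightarrow> \<not> before y v)"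
    and trans: "\<forall>(u,v,w)\<in>set
      [(1,7,19)].
      before u v \<longrightarrow> before v w \<longrightarrow> before u w"
    and negtrans: "\<forall>(u,v,w)\<in>set
      [(1,7,19)].
      before u w \<longrightarrow> before u v \<or> before v w"
  shows False
  using some proper same cross cross_flip trans negtrans [[argo_timeout = 1000]]
  unfolding list.set ball_simps bex_simps prod.case fixed simp_thms
  by (elim conjE) argo

section \<open>The leveled graph on 21 vertices\<close>

definition strip_level :: "nat \<Rightarrow> nat" where
  "strip_level v = (if v < 1 then 0 else if v < 4 then 1 else if v < 9 then 2 else if v < 20 then 3 else 4)"

definition strip_list :: "(nat \<times> nat) list" where
  "strip_list =
    [(0,1), (0,2), (0,3), (1,4), (1,5), (1,6), (2,6), (2,7), (3,7), (4,9), (5,9), (5,10), (5,11),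
    (5,12), (5,13), (5,14), (6,14), (7,14), (7,15), (7,16), (7,17), (7,18), (8,18), (8,19),
    (9,20), (10,20), (11,20), (12,20), (13,20), (14,20), (15,20), (16,20), (17,20), (18,20),
    (19,20)]"

abbreviation "strip_E \<equiv> strip_edges 21 strip_level (set strip_list)"

interpretation strip: strip_graph 21 strip_level "set strip_list"
proof
  show "strip_level u \<le> strip_level v" if "u \<le> v" for u v
    using that by (auto simp: strip_level_def)
  have "\<forall>(u, v)\<in>set strip_list. v < 21 \<and> strip_level v = strip_level u + 1"
    by (simp add: strip_list_def strip_level_def)
  then show "v < 21 \<and> strip_level v = strip_level u + 1" if "(u, v) \<in> set strip_list" for u v
    using that by blast
  \<comment> \<open>The list is already sorted in the product order, so comparing neighbouring
    entries proves the chain condition for all pairs.\<close>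
  have "successively (\<lambda>(u, v) (x, y). u \<le> x \<and> v \<le> y) strip_list"
    by (simp add: strip_list_def)
  then have *: "sorted_wrt (\<lambda>(u, v) (x, y). u \<le> x \<and> v \<le> y) strip_list"
    by (subst (asm) successively_conv_sorted_wrt) (auto simp: transp_def)
  show "u \<le> x \<and> v \<le> y \<or> x \<le> u \<and> y \<le> v"
    if uv: "(u, v) \<in> set strip_list" and xy: "(x, y) \<in> set strip_list" for u v x y
  proof -
    obtain m n where "m < length strip_list" "strip_list ! m = (u, v)" "n < length strip_list" "strip_list ! n = (x, y)"
      using uv xy by (metis in_set_conv_nth)
    then show ?thesis
      using * by (cases m n rule: linorder_cases) (fastforce simp: sorted_wrt_iff_nth_less)+
  qed
qed

lemma strip_no_5_tracks: "\<not> rank_layout {..<21} (arcs id strip_E) 5 \<tau> L"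
proof
  \<comment> \<open>A short name for the arc set, in terms of which the membership rules below are
    stated and applied.\<close>
  define F where "F = arcs id strip_E"
  assume "rank_layout {..<21} (arcs id strip_E) 5 \<tau> L"
  then have lay: "rank_layout {..<21} F 5 \<tau> L" by (simp add: F_def)
  have arcs_strip: "list_all (\<lambda>(u, v). (u, v) \<in> F \<and> (v, u) \<in> F) strip_list"
    unfolding F_def strip.arcs_id by (auto simp: list_all_iff strip_arcs_def)
  have step: "(v - 1, v) \<in> strip.D" if "2 \<le> v" "v < 21" "strip_level (v - 1) = strip_level v" for v
    using that unfolding strip_arcs_def by (cases v) auto
  have arcs_step: "list_all (\<lambda>v. strip_level (v - 1) = strip_level v \<longrightarrow> (v - 1, v) \<in> F \<and> (v, v - 1) \<in> F) [2..<21]"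
    unfolding F_def strip.arcs_id list_all_iff set_upt using step by simp
  note arcs = arcs_strip[unfolded strip_list_def, simplified] arcs_step[unfolded strip_level_def, simplified]
  have F_subset: "F \<subseteq> {..<21} \<times> {..<21}"
    unfolding F_def strip.arcs_id using strip.D_less by fastforce
  have "distinct [\<tau> 6, \<tau> 7, \<tau> 14]"
    using rank_layout_proper[OF lay, of 6 7] rank_layout_proper[OF lay, of 6 14]
      rank_layout_proper[OF lay, of 7 14] by (simp add: arcs)
  moreover have "set [\<tau> 6, \<tau> 7, \<tau> 14] \<subseteq> {..<5}" using rank_layout_lt[OF lay] by simp
  ultimately obtain ks where ks: "length ks = 5" "set ks = {..<5}"
    and nth: "\<And>i. i < length [\<tau> 6, \<tau> 7, \<tau> 14] \<Longrightarrow> ks ! i = [\<tau> 6, \<tau> 7, \<tau> 14] ! i"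
    by (rule extend_to_track_list) blast
  have fixed: "\<tau> 6 = ks ! 0" "\<tau> 7 = ks ! 1" "\<tau> 14 = ks ! 2"
    using nth[of 0] nth[of 1] nth[of 2] by auto
  have cs: "{..<5} \<subseteq> set [0, 1, 2, 3, 4 :: nat]" by auto
  show False
    apply (rule strip_clauses_unsat[of "\<lambda>v i. \<tau> v = ks ! i" "\<lambda>u v. \<tau> u = \<tau> v" L])
             apply (simp_all add: fixed)[3]
    subgoal
      by (rule colour_instances[OF lay ks cs, where fx = "[(6, 0), (7, 1), (14, 2)]"])
        (simp_all add: fixed arcs)
    subgoal by (rule proper_instances[OF lay]) (unfold list.set ball_simps prod.case, simp add: arcs)
    subgoal by (rule same_instances)
    subgoal by (rule cross_instances[OF lay]) (unfold list.set ball_simps prod.case, simp add: arcs)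
    subgoal by (rule cross_flip_instances[OF lay F_subset]) (unfold list.set ball_simps prod.case, simp add: arcs)
    subgoal by (rule trans_instances[OF lay]) (unfold list.set ball_simps prod.case, simp)
    subgoal by (rule negtrans_instances[OF lay]) (unfold list.set ball_simps prod.case, simp)
    done
qed

lemma strip_track_number: "track_number {..<21} strip_E = 6"
proof -
  have "track_number {..<21} strip_E = Suc 5"
  proof (rule track_number_eqI[OF strip.graph inj_on_id])
    show "rank_layout (id ` {..<21}) (arcs id strip_E) (Suc 5) (\<lambda>v. 2 * (strip_level v mod 3) + v mod 2) (<)"
      using strip.rank_layout_6 by simp
    show "\<not> rank_layout (id ` {..<21}) (arcs id strip_E) 5 \<tau> L" for \<tau> L
      using strip_no_5_tracks by simp
  qed
  then show ?thesis by simp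
qed

theorem theorem12:
  shows "(\<exists>D. track_number (xtree_V D) (xtree_E D) = 5) \<and>
         (\<exists>(V :: nat set) E. halin V E \<and> track_number V E = 5) \<and>
         (\<exists>(V :: nat set) E. graph V E \<and> weakly_leveled_planar V E \<and> track_number V E = 6)"
  using xtree_track_number halin_halin_E halin_track_number strip.graph strip.weakly_leveled_planar
    strip_track_number
  by blast

end
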